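(* The problem 4-Approval Conformant Manipulation is $\mathrm{NP}$-complete (under polynomial-time many-one reductions).
   Context: An election $(C,V)$ consists of a finite set of candidates $C$ and a finite collection (multiset, listed explicitly) of voters $V$; each voter has a vote, which is a strict total order over $C$. 4-Approval: in an election with $m$ candidates, a candidate receives 1 point from each vote in which it is ranked among the top 4 positions and 0 points from every other vote (scoring vector $\langle 1,1,1,1,0,\dots,0\rangle$). The winners are all candidates with the highest total score (several winners are allowed). 4-Approval Conformant Manipulation is the following decision problem. Given: an election $(C,V)$, a collection of manipulative voters $W$ (whose votes are not yet set), and a preferred candidate $p\in C$. Question: does there exist a way to set the votes of the manipulators in $W$ using only votes that occur in $V$ (a vote may be used by any number of manipulators; every manipulator must cast a vote) such that $p$ is a 4-approval winner of the election $(C,V\cup W)$? *)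

theory Defs
  imports Main "HOL-Computational_Algebra.Polynomial"
begin

section \<open>Deterministic multi-tape Turing machines\<close>

datatype move = MoveLeft | Stay | MoveRight

text \<open>
  The states of a machine are the numbers below \<open>nstates\<close>, with \<open>0\<close> the initial state; its tape
  symbols are the numbers below \<open>nsyms\<close>. Symbol \<open>0\<close> is the blank, and \<open>1\<close> and \<open>2\<close> are the bits
  (see \<open>bit_symbol\<close>). The transition function receives the state and the symbols scanned on the
  tapes; the machine halts where it is \<open>None\<close>.
\<close>

record machine =
  ntapes  :: nat
  nsyms   :: nat
  nstates :: nat
  trans_fun :: "nat \<Rightarrow> nat list \<Rightarrow> (nat \<times> (nat \<times> move) list) option"

definition machine_wf :: "machine \<Rightarrow> bool" where
  "machine_wf M \<longleftrightarrow>
     1 \<le> ntapes M \<and> 3 \<le> nsyms M \<and> 1 \<le> nstates M \<and>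
     (\<forall>q ss q' as.
        q < nstates M \<and> length ss = ntapes M \<and> set ss \<subseteq> {..<nsyms M} \<and>
        trans_fun M q ss = Some (q', as)
        \<longrightarrow> q' < nstates M \<and> length as = ntapes M \<and> fst ` set as \<subseteq> {..<nsyms M})"

text \<open>A two-way infinite tape, together with the position of its head.\<close>

type_synonym tape = "(int \<Rightarrow> nat) \<times> int"
type_synonym config = "nat \<times> tape list"

fun scanned :: "tape \<Rightarrow> nat" where
  "scanned (f, h) = f h"

fun shift :: "move \<Rightarrow> int \<Rightarrow> int" where
  "shift MoveLeft h = h - 1"
| "shift Stay h = h"
| "shift MoveRight h = h + 1"

fun act :: "nat \<times> move \<Rightarrow> tape \<Rightarrow> tape" where
  "act (s, d) (f, h) = (f(h := s), shift d h)"

definition halted :: "machine \<Rightarrow> config \<Rightarrow> bool" where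
  "halted M c \<longleftrightarrow> trans_fun M (fst c) (map scanned (snd c)) = None"

definition step :: "machine \<Rightarrow> config \<Rightarrow> config" where
  "step M c =
     (case trans_fun M (fst c) (map scanned (snd c)) of
        None \<Rightarrow> c
      | Some (q, as) \<Rightarrow> (q, map2 act as (snd c)))"

fun bit_symbol :: "bool \<Rightarrow> nat" where
  "bit_symbol False = 1"
| "bit_symbol True = 2"

definition input_tape :: "bool list \<Rightarrow> tape" where
  "input_tape x =
     (\<lambda>i. if 0 \<le> i \<and> i < int (length x) then bit_symbol (x ! nat i) else 0, 0)"

text \<open>The inputs are on the first tapes; the remaining tapes are blank.\<close>

definition init_config :: "machine \<Rightarrow> bool list list \<Rightarrow> config" where
  "init_config M xs = (0, map input_tape (xs @ replicate (ntapes M - length xs) []))"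

text \<open>The output is read off the first tape, from the head rightwards up to the first blank.\<close>

definition has_output :: "config \<Rightarrow> bool list \<Rightarrow> bool" where
  "has_output c y \<longleftrightarrow>
     (case hd (snd c) of (f, h) \<Rightarrow>
        (\<forall>i < length y. f (h + int i) = bit_symbol (y ! i)) \<and> f (h + int (length y)) = 0)"

text \<open>As \<open>step\<close> fixes halted configurations, \<open>t\<close> is an upper bound on the number of steps.\<close>

definition computes_within :: "machine \<Rightarrow> bool list list \<Rightarrow> nat \<Rightarrow> bool list \<Rightarrow> bool" where
  "computes_within M xs t y \<longleftrightarrow>
     (let c = (step M ^^ t) (init_config M xs) in halted M c \<and> has_output c y)"


section \<open>Polynomial time, NP and many-one reductions\<close>

definition poly_time_function :: "(bool list \<Rightarrow> bool list) \<Rightarrow> bool" where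
  "poly_time_function f \<longleftrightarrow>
     (\<exists>M (q :: nat poly). machine_wf M \<and>
        (\<forall>x. computes_within M [x] (poly q (length x)) (f x)))"

definition poly_time_relation :: "(bool list \<Rightarrow> bool list \<Rightarrow> bool) \<Rightarrow> bool" where
  "poly_time_relation R \<longleftrightarrow>
     (\<exists>M (q :: nat poly). machine_wf M \<and> 2 \<le> ntapes M \<and>
        (\<forall>x y. computes_within M [x, y] (poly q (length x + length y)) [R x y]))"

type_synonym language = "bool list set"

text \<open>NP, by polynomial-time verifiers with certificates of polynomial length.\<close>

definition in_NP :: "language \<Rightarrow> bool" where
  "in_NP L \<longleftrightarrow>
     (\<exists>R (p :: nat poly). poly_time_relation R \<and>
        (\<forall>x. x \<in> L \<longleftrightarrow> (\<exists>y. length y \<le> poly p (length x) \<and> R x y)))"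

definition poly_time_reducible :: "language \<Rightarrow> language \<Rightarrow> bool" where
  "poly_time_reducible L K \<longleftrightarrow>
     (\<exists>f. poly_time_function f \<and> (\<forall>x. x \<in> L \<longleftrightarrow> f x \<in> K))"

definition NP_hard :: "language \<Rightarrow> bool" where
  "NP_hard K \<longleftrightarrow> (\<forall>L. in_NP L \<longrightarrow> poly_time_reducible L K)"

definition NP_complete :: "language \<Rightarrow> bool" where
  "NP_complete K \<longleftrightarrow> in_NP K \<and> NP_hard K"


section \<open>Elections and conformant manipulation\<close>

text \<open>In a vote \<open>r\<close>, the pair \<open>(a, b) \<in> r\<close> means that \<open>a\<close> is strictly preferred to \<open>b\<close>.\<close>

definition is_vote :: "'a set \<Rightarrow> 'a rel \<Rightarrow> bool" where
  "is_vote C r \<longleftrightarrow> r \<subseteq> C \<times> C \<and> strict_linear_order_on C r"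

definition is_election :: "'a set \<Rightarrow> 'a rel list \<Rightarrow> bool" where
  "is_election C V \<longleftrightarrow> finite C \<and> (\<forall>r \<in> set V. is_vote C r)"

definition position :: "'a rel \<Rightarrow> 'a \<Rightarrow> nat" where
  "position r c = card {d. (d, c) \<in> r} + 1"

definition approval_score :: "nat \<Rightarrow> 'a rel list \<Rightarrow> 'a \<Rightarrow> nat" where
  "approval_score k V c = length (filter (\<lambda>r. position r c \<le> k) V)"

definition approval_winners :: "nat \<Rightarrow> 'a set \<Rightarrow> 'a rel list \<Rightarrow> 'a set" where
  "approval_winners k C V = {c \<in> C. \<forall>d \<in> C. approval_score k V d \<le> approval_score k V c}"

text \<open>
  As the votes of the manipulators are not yet set, the collection of manipulators enters
  only through its size \<open>n\<close>; the \<open>i\<close>-th entry of \<open>W\<close> is the vote cast by the \<open>i\<close>-th manipulator.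
\<close>

definition conformant_manipulation ::
  "nat \<Rightarrow> 'a set \<Rightarrow> 'a rel list \<Rightarrow> nat \<Rightarrow> 'a \<Rightarrow> bool" where
  "conformant_manipulation k C V n p \<longleftrightarrow>
     (\<exists>W. length W = n \<and> set W \<subseteq> set V \<and> p \<in> approval_winners k C (V @ W))"


section \<open>The decision problem as a language\<close>

text \<open>
  In an encoded instance the \<open>m\<close> candidates are \<open>0, \<dots>, m - 1\<close> and a vote is written down as the
  list of all candidates, most preferred first.
\<close>

definition order_of_list :: "'a list \<Rightarrow> 'a rel" where
  "order_of_list v = {(v ! i, v ! j) | i j. i < j \<and> j < length v}"

lemma is_vote_order_of_list:
  assumes "distinct v"
  shows "is_vote (set v) (order_of_list v)"
proof -
  have "trans (order_of_list v)"
    using assms unfolding trans_def order_of_list_def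
    by (auto simp: nth_eq_iff_index_eq) (metis less_trans nth_eq_iff_index_eq)
  moreover have "irrefl (order_of_list v)"
    using assms unfolding irrefl_def order_of_list_def
    by (auto simp: nth_eq_iff_index_eq)
  moreover have "total_on (set v) (order_of_list v)"
    unfolding total_on_def order_of_list_def
    by (auto simp: in_set_conv_nth) (metis nat_neq_iff)
  moreover have "order_of_list v \<subseteq> set v \<times> set v"
    unfolding order_of_list_def by auto
  ultimately show ?thesis
    unfolding is_vote_def strict_linear_order_on_def by blast
qed

lemma position_order_of_list:
  assumes "distinct v" "i < length v"
  shows "position (order_of_list v) (v ! i) = i + 1"
proof -
  have "{d. (d, v ! i) \<in> order_of_list v} = (!) v ` {..<i}"
    using assms unfolding order_of_list_def
    by (auto simp: nth_eq_iff_index_eq)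
  moreover have "inj_on ((!) v) {..<i}"
    using assms by (auto simp: inj_on_def nth_eq_iff_index_eq)
  ultimately show ?thesis
    by (simp add: position_def card_image)
qed

lemma ex_order_of_list:
  assumes "finite C" "is_vote C r"
  shows "\<exists>v. distinct v \<and> set v = C \<and> order_of_list v = r"
proof -
  define f where "f c = card {d. (d, c) \<in> r}" for c
  have sub: "r \<subseteq> C \<times> C" and tr: "trans r" and irr: "irrefl r" and tot: "total_on C r"
    using assms(2) by (auto simp: is_vote_def strict_linear_order_on_def)
  have fin: "finite {d. (d, c) \<in> r}" for c
    using sub by (intro finite_subset[OF _ assms(1)]) auto
  have mono: "f a < f b" if "(a, b) \<in> r" for a b
    unfolding f_def
  proof (rule psubset_card_mono[OF fin])
    have "a \<in> {d. (d, b) \<in> r}" "a \<notin> {d. (d, a) \<in> r}"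
      using that irr by (auto simp: irrefl_def)
    moreover have "{d. (d, a) \<in> r} \<subseteq> {d. (d, b) \<in> r}"
      using that tr by (auto dest: transD)
    ultimately show "{d. (d, a) \<in> r} \<subset> {d. (d, b) \<in> r}" by blast
  qed
  have less_iff: "(a, b) \<in> r \<longleftrightarrow> f a < f b" if "a \<in> C" "b \<in> C" for a b
    using that mono[of a b] mono[of b a] tot unfolding total_on_def
    by (metis less_irrefl less_asym)
  have inj: "inj_on f C"
  proof (rule inj_onI)
    fix a b assume "a \<in> C" "b \<in> C" "f a = f b"
    then show "a = b" using tot less_iff by (metis less_irrefl total_on_def)
  qed
  have "f ` C \<subseteq> {..<card C}"
  proof
    fix n assume "n \<in> f ` C"
    then obtain c where c: "c \<in> C" "n = f c" by auto
    have "{d. (d, c) \<in> r} \<subset> C"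
      using c sub irr by (auto simp: irrefl_def)
    then show "n \<in> {..<card C}"
      using c psubset_card_mono[OF assms(1)] by (simp add: f_def)
  qed
  then have bij: "bij_betw f C {..<card C}"
    using inj by (simp add: bij_betw_def card_image card_subset_eq)
  define g where "g = inv_into C f"
  have g: "bij_betw g {..<card C} C"
    unfolding g_def using bij by (rule bij_betw_inv_into)
  have fg: "f (g i) = i" if "i < card C" for i
    using that bij unfolding g_def by (metis bij_betw_inv_into_right lessThan_iff)
  have gf: "g (f c) = c" if "c \<in> C" for c
    using that inj unfolding g_def by simp
  have gC: "g i \<in> C" if "i < card C" for i
    using that g by (auto simp: bij_betw_def)
  define v where "v = map g [0..<card C]"
  have len: "length v = card C" and nth: "\<And>i. i < card C \<Longrightarrow> v ! i = g i"
    by (auto simp: v_def)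
  have "distinct v"
    using g by (simp add: v_def distinct_map bij_betw_def atLeast0LessThan)
  moreover have "set v = C"
    using g by (simp add: v_def bij_betw_def atLeast0LessThan)
  moreover have "order_of_list v = r"
  proof (rule set_eqI, clarify)
    fix a b
    have "(a, b) \<in> order_of_list v \<longleftrightarrow> (\<exists>i j. i < j \<and> j < card C \<and> a = g i \<and> b = g j)"
      unfolding order_of_list_def len by (auto simp: nth) (metis less_trans nth)+
    also have "\<dots> \<longleftrightarrow> (a, b) \<in> r"
    proof
      assume "\<exists>i j. i < j \<and> j < card C \<and> a = g i \<and> b = g j"
      then obtain i j where "i < j" "j < card C" "a = g i" "b = g j" by blast
      then show "(a, b) \<in> r" using less_iff[of a b] gC fg by simp
    next
      assume ab: "(a, b) \<in> r"
      then have C: "a \<in> C" "b \<in> C" using sub by auto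
      then have "f b < card C" using bij by (auto simp: bij_betw_def)
      then show "\<exists>i j. i < j \<and> j < card C \<and> a = g i \<and> b = g j"
        using mono[OF ab] gf C by metis
    qed
    finally show "(a, b) \<in> order_of_list v \<longleftrightarrow> (a, b) \<in> r" .
  qed
  ultimately show ?thesis by blast
qed

text \<open>Hence every election over \<open>{..<m}\<close> is written down in some instance, and nothing else is.\<close>

lemma is_election_iff_order_of_list:
  fixes m :: nat
  shows "is_election {..<m} V \<longleftrightarrow>
     (\<exists>vs. (\<forall>v \<in> set vs. distinct v \<and> set v = {..<m}) \<and> V = map order_of_list vs)"
proof
  assume "is_election {..<m} V"
  then have "\<forall>r \<in> set V. \<exists>v. distinct v \<and> set v = {..<m} \<and> order_of_list v = r"
    by (auto simp: is_election_def intro: ex_order_of_list)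
  then obtain h where h: "\<forall>r \<in> set V. distinct (h r) \<and> set (h r) = {..<m} \<and> order_of_list (h r) = r"
    by metis
  then have "V = map order_of_list (map h V)"
    by (simp add: map_idI)
  with h show "\<exists>vs. (\<forall>v \<in> set vs. distinct v \<and> set v = {..<m}) \<and> V = map order_of_list vs"
    by (metis (no_types, lifting) in_set_conv_nth length_map nth_map nth_mem)
next
  assume "\<exists>vs. (\<forall>v \<in> set vs. distinct v \<and> set v = {..<m}) \<and> V = map order_of_list vs"
  then obtain vs where "\<forall>v \<in> set vs. distinct v \<and> set v = {..<m}" "V = map order_of_list vs"
    by blast
  moreover have "is_vote {..<m} (order_of_list v)" if "distinct v" "set v = {..<m}" for v
    using is_vote_order_of_list[OF that(1)] that(2) by simp
  ultimately show "is_election {..<m} V"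
    by (simp add: is_election_def)
qed

text \<open>
  Numbers are encoded in unary. As candidates and manipulators are listed explicitly in an
  instance, the length of the code is polynomially related to that of a binary encoding of the
  candidates' names. Both codes are prefix-free, so they can be concatenated.
\<close>

definition encode_nat :: "nat \<Rightarrow> bool list" where
  "encode_nat n = replicate n True @ [False]"

definition encode_list :: "('a \<Rightarrow> bool list) \<Rightarrow> 'a list \<Rightarrow> bool list" where
  "encode_list f xs = concat (map (\<lambda>x. True # f x) xs) @ [False]"

definition encode_instance :: "nat \<Rightarrow> nat list list \<Rightarrow> nat \<Rightarrow> nat \<Rightarrow> bool list" where
  "encode_instance m vs n p =
     encode_nat m @ encode_list (encode_list encode_nat) vs @ encode_nat n @ encode_nat p"

lemma encode_nat_prefix_free:
  "encode_nat a @ s = encode_nat b @ t \<longleftrightarrow> a = b \<and> s = t"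
proof (induction a arbitrary: b)
  case 0
  show ?case by (cases b) (auto simp: encode_nat_def)
next
  case (Suc a)
  then show ?case by (cases b) (auto simp: encode_nat_def)
qed

lemma encode_list_prefix_free:
  assumes "\<And>a b s t. f a @ s = f b @ t \<longleftrightarrow> a = b \<and> s = t"
  shows "encode_list f xs @ s = encode_list f ys @ t \<longleftrightarrow> xs = ys \<and> s = t"
proof (induction xs arbitrary: ys)
  case Nil
  show ?case by (cases ys) (auto simp: encode_list_def)
next
  case (Cons x xs)
  then show ?case by (cases ys) (auto simp: encode_list_def assms)
qed

lemma encode_instance_inject:
  "encode_instance m vs n p = encode_instance m' vs' n' p' \<longleftrightarrow>
     m = m' \<and> vs = vs' \<and> n = n' \<and> p = p'"
  using encode_nat_prefix_free[of p "[]" p' "[]"]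
  by (simp add: encode_instance_def encode_nat_prefix_free encode_list_prefix_free)

definition approval_conformant_manipulation :: "nat \<Rightarrow> language" where
  "approval_conformant_manipulation k =
     {encode_instance m vs n p | m vs n p.
        (\<forall>v \<in> set vs. distinct v \<and> set v = {..<m}) \<and> p < m \<and>
        conformant_manipulation k {..<m} (map order_of_list vs) n p}"

end

theory Submission
  imports Defs
begin

text \<open>
  A certificate names, for every manipulator, the vote to be copied. For hardness, the computation
  of a polynomial-time verifier is described by a propositional formula, which becomes the
  question whether \<open>n\<close> disjoint triples can be chosen from a given collection: each variable is a
  wheel of alternating choices, and each clause has one triple per literal. A triple is turned into
  a vote for the preferred candidate \<open>p\<close> and its three elements, and padding votes put every
  element \<open>n - 1\<close> points ahead of \<open>p\<close>. Then \<open>p\<close> wins only if all \<open>n\<close> manipulators approve \<open>p\<close> and no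
  element is approved twice.

  The reduction and the checking of certificates are both given by nested loops over polynomially
  bounded counters. Turing machines execute such loops in polynomial time by taking head positions
  on tapes with a marked origin as counters.
\<close>

section \<open>Structured programs for Turing machines\<close>

text \<open>\<open>NP_hard\<close> quantifies over all languages with a machine verifier, so the
  chain of reductions begins with an arbitrary machine. Some choices keep it short. The intermediate
  problem is packing with a prescribed number of triples, not exact cover: the first elements of the
  triples take only as many values as triples have to be chosen, so disjoint triples use each of
  them exactly once, and nothing has to absorb leftover elements. Clauses may have any fixed width,
  since each literal gives one triple; the width \<open>ntapes M + 3\<close> is what a transition
  rule takes. Each clause has its own copy of every variable, so clauses using the same literal do
  not compete for an element. Triples have the right size for 4-approval: together with
  \<open>p\<close> they fill the approved positions. On the machine side, numbers are lengths of bit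
  lists, so polynomial bounds on output and time follow from the syntax of a program, and it is
  enough to build the reduction and the verifier by closure rules for sums, tests and loops.\<close>

datatype com =
    Act "(nat \<Rightarrow> nat) \<Rightarrow> nat \<Rightarrow> nat option \<times> move"
  | Seq com com
  | Cond "(nat \<Rightarrow> nat) \<Rightarrow> bool" com com
  | Loop "(nat \<Rightarrow> nat) \<Rightarrow> bool" com

text \<open>The list is a stack of commands still to be run. Control constructs take a step without
  touching the tapes, so that one \<open>cstep\<close> is one machine step and compilation is a
  step-for-step simulation.\<close>

fun cstep :: "com list \<Rightarrow> (nat \<Rightarrow> nat) \<Rightarrow> (com list \<times> (nat \<Rightarrow> nat option \<times> move)) option" where
  "cstep [] s = None"
| "cstep (Act a # K) s = Some (K, a s)"
| "cstep (Seq c d # K) s = Some (c # d # K, \<lambda>_. (None, Stay))"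
| "cstep (Cond b c d # K) s = Some ((if b s then c else d) # K, \<lambda>_. (None, Stay))"
| "cstep (Loop b c # K) s = Some (if b s then c # Loop b c # K else K, \<lambda>_. (None, Stay))"

text \<open>Symbols are written modulo 3, so that every action respects the tape alphabet.\<close>

fun upd :: "nat option \<times> move \<Rightarrow> tape \<Rightarrow> tape" where
  "upd (w, d) (f, h) = ((case w of None \<Rightarrow> f | Some s \<Rightarrow> f(h := s mod 3)), shift d h)"

definition scan :: "(nat \<Rightarrow> tape) \<Rightarrow> nat \<Rightarrow> nat" where
  "scan \<tau> j = scanned (\<tau> j)"

definition cfg_step :: "com list \<times> (nat \<Rightarrow> tape) \<Rightarrow> com list \<times> (nat \<Rightarrow> tape)" where
  "cfg_step C = (case cstep (fst C) (scan (snd C)) of None \<Rightarrow> C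
     | Some (K, a) \<Rightarrow> (K, \<lambda>j. upd (a j) (snd C j)))"

text \<open>The number of steps is chosen before the continuation \<open>K\<close>: a command never
  looks below itself on the stack, which is what makes runs composable.\<close>

definition runs :: "com \<Rightarrow> nat \<Rightarrow> (nat \<Rightarrow> tape) \<Rightarrow> (nat \<Rightarrow> tape) \<Rightarrow> bool" where
  "runs c n \<tau> \<tau>' \<longleftrightarrow> (\<exists>t\<le>n. \<forall>K. (cfg_step ^^ t) (c # K, \<tau>) = (K, \<tau>'))"

section \<open>Time-bounded execution of commands\<close>

lemma runs_mono: "runs c n \<tau> \<tau>' \<Longrightarrow> n \<le> m \<Longrightarrow> runs c m \<tau> \<tau>'"
  unfolding runs_def by (meson order_trans)

lemma upd_stay [simp]: "upd (None, Stay) T = T"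
  by (cases T) simp

lemma cfg_steps_trans:
  "(cfg_step ^^ s) C = C' \<Longrightarrow> (cfg_step ^^ t) C' = C'' \<Longrightarrow> (cfg_step ^^ (s + t)) C = C''"
  by (simp add: add.commute[of s t] funpow_add)

lemma cfg_steps_Suc: "(cfg_step ^^ t) (cfg_step C) = C' \<Longrightarrow> (cfg_step ^^ Suc t) C = C'"
  by (simp add: funpow_swap1)

lemma runs_Act: "runs (Act a) 1 \<tau> (\<lambda>j. upd (a (scan \<tau>) j) (\<tau> j))"
  unfolding runs_def by (rule exI[of _ 1]) (simp add: cfg_step_def)

text \<open>The strict inequality pays for the step that unfolds the \<open>Seq\<close>.\<close>

lemma runs_Seq:
  assumes "runs c n \<tau> \<tau>'" "runs d m \<tau>' \<tau>''" "n + m < k"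
  shows "runs (Seq c d) k \<tau> \<tau>''"
proof -
  obtain t u where t: "t \<le> n" "\<And>K. (cfg_step ^^ t) (c # K, \<tau>) = (K, \<tau>')"
    and u: "u \<le> m" "\<And>K. (cfg_step ^^ u) (d # K, \<tau>') = (K, \<tau>'')"
    using assms unfolding runs_def by metis
  have "(cfg_step ^^ Suc (t + u)) (Seq c d # K, \<tau>) = (K, \<tau>'')" for K
    by (rule cfg_steps_Suc, rule cfg_steps_trans[OF _ u(2)]) (simp add: cfg_step_def t(2))
  then show ?thesis unfolding runs_def using t(1) u(1) assms(3) by (intro exI[of _ "Suc (t + u)"]) auto
qed

lemma runs_Cond:
  assumes "runs (if b (scan \<tau>) then c else d) n \<tau> \<tau>'" "n < k"
  shows "runs (Cond b c d) k \<tau> \<tau>'"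
proof -
  obtain t where t: "t \<le> n" "\<And>K. (cfg_step ^^ t) ((if b (scan \<tau>) then c else d) # K, \<tau>) = (K, \<tau>')"
    using assms unfolding runs_def by metis
  have "(cfg_step ^^ Suc t) (Cond b c d # K, \<tau>) = (K, \<tau>')" for K
    by (rule cfg_steps_Suc) (use t(2) in \<open>simp add: cfg_step_def\<close>)
  then show ?thesis unfolding runs_def using t(1) assms(2) by (intro exI[of _ "Suc t"]) auto
qed

lemma runs_Loop_end: "\<not> b (scan \<tau>) \<Longrightarrow> runs (Loop b c) 1 \<tau> \<tau>"
  unfolding runs_def by (rule exI[of _ 1]) (simp add: cfg_step_def)

lemma runs_Loop_step:
  assumes "b (scan \<tau>)" "runs c n \<tau> \<tau>'" "runs (Loop b c) m \<tau>' \<tau>''" "n + m < k"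
  shows "runs (Loop b c) k \<tau> \<tau>''"
proof -
  obtain t u where t: "t \<le> n" "\<And>K. (cfg_step ^^ t) (c # K, \<tau>) = (K, \<tau>')"
    and u: "u \<le> m" "\<And>K. (cfg_step ^^ u) (Loop b c # K, \<tau>') = (K, \<tau>'')"
    using assms unfolding runs_def by metis
  have "(cfg_step ^^ Suc (t + u)) (Loop b c # K, \<tau>) = (K, \<tau>'')" for K
    by (rule cfg_steps_Suc, rule cfg_steps_trans[OF _ u(2)]) (simp add: cfg_step_def t(2) assms(1))
  then show ?thesis unfolding runs_def using t(1) u(1) assms(4) by (intro exI[of _ "Suc (t + u)"]) auto
qed

text \<open>\<open>S i\<close> is the tape content at the \<open>i\<close>-th test of the guard. The
  induction is on the number \<open>d\<close> of rounds still to come, because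
  \<open>runs_Loop_step\<close> peels off the first round.\<close>

lemma runs_Loop:
  assumes "\<And>i. i < k \<Longrightarrow> b (scan (S i))" "\<not> b (scan (S k))"
    and "\<And>i. i < k \<Longrightarrow> runs c n (S i) (S (Suc i))" and "k * (n + 1) < m"
  shows "runs (Loop b c) m (S 0) (S k)"
proof -
  have "runs (Loop b c) (Suc (d * (n + 1))) (S (k - d)) (S k)" if "d \<le> k" for d
    using that
  proof (induction d)
    case 0
    then show ?case using runs_Loop_end[of b "S k" c] assms(2) by simp
  next
    case (Suc d)
    then have *: "Suc (k - Suc d) = k - d" by simp
    show ?case
      by (rule runs_Loop_step[where m = "Suc (d * (n + 1))" and \<tau>' = "S (k - d)" and n = n])
        (use Suc assms(1)[of "k - Suc d"] assms(3)[of "k - Suc d", unfolded *] in auto)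
  qed
  from this[of k] show ?thesis using assms(4) by (auto elim!: runs_mono)
qed

subsection \<open>Compilation\<close>

text \<open>The states of the compiled machine are the reachable continuation stacks.\<close>

fun reach :: "com \<Rightarrow> com list \<Rightarrow> com list set" where
  "reach (Act a) K = {Act a # K}"
| "reach (Seq c d) K = insert (Seq c d # K) (reach c (d # K) \<union> reach d K)"
| "reach (Cond b c d) K = insert (Cond b c d # K) (reach c K \<union> reach d K)"
| "reach (Loop b c) K = insert (Loop b c # K) (reach c (Loop b c # K))"

text \<open>Syntactic recursion is enough for \<open>reach\<close>, because the body of a loop is
  always entered above the same continuation, the loop itself.\<close>

lemma finite_reach: "finite (reach c K)"
  by (induction c arbitrary: K) auto

lemma reach_start: "c # K \<in> reach c K"
  by (cases c) auto

lemma reach_step: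
  "L \<in> reach c K \<Longrightarrow> cstep L s = Some (L', a) \<Longrightarrow> L' \<in> insert K (reach c K)"
proof (induction c arbitrary: K)
  case (Act f)
  then show ?case by auto
next
  case (Seq c d)
  from Seq.prems(1) consider "L = Seq c d # K" | "L \<in> reach c (d # K)" | "L \<in> reach d K" by auto
  then show ?case
  proof cases
    case 1
    then show ?thesis using Seq.prems(2) reach_start by auto
  next
    case 2
    from Seq.IH(1)[OF this Seq.prems(2)] show ?thesis using reach_start[of d K] by auto
  next
    case 3
    from Seq.IH(2)[OF this Seq.prems(2)] show ?thesis by auto
  qed
next
  case (Cond b c d)
  from Cond.prems(1) consider "L = Cond b c d # K" | "L \<in> reach c K" | "L \<in> reach d K" by auto
  then show ?case
  proof cases
    case 1
    then show ?thesis using Cond.prems(2) reach_start[of c K] reach_start[of d K] by (auto split: if_splits)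
  next
    case 2
    from Cond.IH(1)[OF this Cond.prems(2)] show ?thesis by auto
  next
    case 3
    from Cond.IH(2)[OF this Cond.prems(2)] show ?thesis by auto
  qed
next
  case (Loop b c)
  from Loop.prems(1) consider "L = Loop b c # K" | "L \<in> reach c (Loop b c # K)" by auto
  then show ?case
  proof cases
    case 1
    then show ?thesis using Loop.prems(2) reach_start[of c "Loop b c # K"] by (auto split: if_splits)
  next
    case 2
    from Loop.IH[OF this Loop.prems(2)] show ?thesis by auto
  qed
qed

text \<open>Commands see a tape for every natural number, a machine has finitely many. What must be
  confined to the first \<open>n\<close> tapes is reading; the effect of an action on the other
  tapes is dropped by the compilation.\<close>

fun bounded :: "nat \<Rightarrow> com \<Rightarrow> bool" where
  "bounded n (Act a) \<longleftrightarrow> (\<forall>s s'. (\<forall>j<n. s j = s' j) \<longrightarrow> a s = a s')"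
| "bounded n (Seq c d) \<longleftrightarrow> bounded n c \<and> bounded n d"
| "bounded n (Cond b c d) \<longleftrightarrow> (\<forall>s s'. (\<forall>j<n. s j = s' j) \<longrightarrow> b s = b s') \<and> bounded n c \<and> bounded n d"
| "bounded n (Loop b c) \<longleftrightarrow> (\<forall>s s'. (\<forall>j<n. s j = s' j) \<longrightarrow> b s = b s') \<and> bounded n c"

lemma bounded_reach:
  "bounded n c \<Longrightarrow> list_all (bounded n) K \<Longrightarrow> L \<in> reach c K \<Longrightarrow> list_all (bounded n) L"
proof (induction c arbitrary: K)
  case (Seq c d)
  then show ?case by (auto intro: Seq.IH(1)[of "d # K"])
next
  case (Loop b c)
  then show ?case by (auto intro: Loop.IH[of "Loop b c # K"])
qed auto

lemma cstep_cong:
  assumes "list_all (bounded n) L" "\<forall>j<n. s j = s' j"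
  shows "cstep L s = cstep L s'"
proof (cases L)
  case LK: (Cons c K)
  with assms have bc: "bounded n c" by simp
  then show ?thesis 
  proof (cases c)
    case (Act f)
    from bc Act have "f s = f s'" using assms(2) by simp
    with Act LK show ?thesis by simp
  next
    case (Cond b d1 d2)
    with bc have "b s = b s'" using assms(2) by simp
    with Cond LK show ?thesis by simp
  next
    case (Loop b d)
    with bc have "b s = b s'" using assms(2) by simp
    with Loop LK show ?thesis by simp
  qed (simp add: LK)
qed simp

text \<open>A machine writes in every step, so an action that writes nothing rewrites the scanned
  symbol.\<close>

definition act_of :: "nat option \<times> move \<Rightarrow> nat \<Rightarrow> nat \<times> move" where
  "act_of a s = ((case fst a of None \<Rightarrow> s | Some r \<Rightarrow> r mod 3), snd a)"

lemma act_act_of: "act (act_of a (scanned T)) T = upd a T"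
  by (cases T; cases a) (auto simp: act_of_def split: option.splits)

lemma compile:
  assumes "bounded n c" "1 \<le> n"
  obtains M where "machine_wf M" "ntapes M = n"
    "\<And>t \<tau> \<tau>'. (cfg_step ^^ t) ([c], \<tau>) = ([], \<tau>') \<Longrightarrow>
       \<exists>q. (step M ^^ t) (0, map \<tau> [0..<n]) = (q, map \<tau>' [0..<n]) \<and> halted M (q, map \<tau>' [0..<n])"
proof -
  define S where "S = insert [] (reach c [])"
  have fin: "finite S" and cS: "[c] \<in> S" using finite_reach reach_start by (auto simp: S_def)
  have clos: "L' \<in> S" if "L \<in> S" "cstep L s = Some (L', a)" for L L' s a
    using that reach_step[of L c "[]" s L' a] unfolding S_def by auto
  have bS: "list_all (bounded n) L" if "L \<in> S" for L
    using that bounded_reach[OF assms(1), of "[]" L] by (auto simp: S_def)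
  obtain e0 where "bij_betw e0 (S - {[c]}) {0..<card (S - {[c]})}"
    using ex_bij_betw_finite_nat[of "S - {[c]}"] fin by auto
  moreover have pos: "card S = Suc (card (S - {[c]}))"
    using fin cS by (rule card_Suc_Diff1[symmetric])
  ultimately have e0: "inj_on e0 (S - {[c]})" "e0 ` (S - {[c]}) = {..<card S - 1}"
    by (auto simp: bij_betw_def atLeast0LessThan)
  \<comment> \<open>The initial state must be 0, so \<open>[c]\<close> gets 0 and a numbering of the
    other stacks is shifted by one. The empty stack becomes the halting state.\<close>
  define e where "e L = (if L = [c] then 0 else Suc (e0 L))" for L
  have "inj_on e S" using e0(1) by (auto simp: inj_on_def e_def)
  moreover have "e ` S = insert 0 (Suc ` e0 ` (S - {[c]}))"
    using cS by (auto simp: e_def image_iff)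
  ultimately have e: "bij_betw e S {..<card S}"
    unfolding bij_betw_def e0(2) image_Suc_lessThan using pos by (auto simp: less_Suc_eq_le)
  have e_c: "e [c] = 0" by (simp add: e_def)
  define dec where "dec = inv_into S (e)"
  have dec: "dec (e L) = L" if "L \<in> S" for L
    using that e unfolding dec_def by (simp add: bij_betw_def)
  have dS: "dec q \<in> S" if "q < card S" for q
    unfolding dec_def by (rule inv_into_into) (use e that in \<open>auto simp: bij_betw_def\<close>)
  \<comment> \<open>Tapes from \<open>n\<close> on are taken to read 0; by \<open>bounded\<close>,
    this value cannot influence the step.\<close>
  define tr where "tr q ss = (case cstep (dec q) (\<lambda>j. if j < n then ss ! j else 0) of None \<Rightarrow> None
     | Some (K, a) \<Rightarrow> Some (e K, map (\<lambda>j. act_of (a j) (ss ! j)) [0..<n]))" for q and ss :: "nat list"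
  define M where "M = \<lparr>ntapes = n, nsyms = 3, nstates = card S, trans_fun = tr\<rparr>"
  have eS: "e L < card S" if "L \<in> S" for L using that e by (auto simp: bij_betw_def)
  have wf: "machine_wf M"
    unfolding machine_wf_def
  proof (intro conjI allI impI)
    fix q ss q' as
    assume "q < nstates M \<and> length ss = ntapes M \<and> set ss \<subseteq> {..<nsyms M} \<and> trans_fun M q ss = Some (q', as)"
    then have A: "q < card S" "length ss = n" "set ss \<subseteq> {..<3}" "tr q ss = Some (q', as)"
      by (auto simp: M_def)
    then obtain K a where K: "cstep (dec q) (\<lambda>j. if j < n then ss ! j else 0) = Some (K, a)"
      "q' = e K" "as = map (\<lambda>j. act_of (a j) (ss ! j)) [0..<n]"
      by (auto simp: tr_def split: option.splits)
    have "K \<in> S" using clos[OF dS[OF A(1)] K(1)] .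
    then show "q' < nstates M" using eS K by (simp add: M_def)
    show "length as = ntapes M" using K by (simp add: M_def)
    have "ss ! j < 3" if "j < n" for j using subsetD[OF A(3) nth_mem[of j ss]] A(2) that by simp
    then show "fst ` set as \<subseteq> {..<nsyms M}"
      using K by (auto simp: M_def act_of_def split: option.splits)
  qed (use assms pos in \<open>auto simp: M_def\<close>)
  have sim: "step M (e L, map \<tau> [0..<n]) = (e L', map \<tau>' [0..<n]) \<and> L' \<in> S"
    if "L \<in> S" "cfg_step (L, \<tau>) = (L', \<tau>')" for L L' \<tau> \<tau>'
  proof -
    let ?s = "\<lambda>j. if j < n then map (scanned \<circ> \<tau>) [0..<n] ! j else 0"
    have s: "\<forall>j<n. scan \<tau> j = ?s j" by (simp add: scan_def)
    show ?thesis
    proof (cases "cstep L (scan \<tau>)")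
      case None
      with cstep_cong[OF bS[OF that(1)] s] have "cstep L ?s = None" by simp
      with None that show ?thesis by (auto simp: step_def M_def tr_def dec cfg_step_def)
    next
      case (Some p)
      then obtain K a where Ka: "cstep L (scan \<tau>) = Some (K, a)" by (cases p) auto
      with cstep_cong[OF bS[OF that(1)] s] have a': "cstep L ?s = Some (K, a)" by simp
      have L': "L' = K" "\<tau>' = (\<lambda>j. upd (a j) (\<tau> j))"
        using that(2) Ka by (auto simp: cfg_step_def)
      have "map2 act (map (\<lambda>j. act_of (a j) (map (scanned \<circ> \<tau>) [0..<n] ! j)) [0..<n]) (map \<tau> [0..<n])
        = map \<tau>' [0..<n]"
        by (rule nth_equalityI) (auto simp: L' act_act_of)
      then show ?thesis
        using a' clos[OF that(1) Ka] that(1) by (simp add: step_def M_def tr_def dec L'(1))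
    qed
  qed
  have sims: "(step M ^^ t) (e L, map \<tau> [0..<n]) = (e L', map \<tau>' [0..<n]) \<and> L' \<in> S"
    if "L \<in> S" "(cfg_step ^^ t) (L, \<tau>) = (L', \<tau>')" for t L L' \<tau> \<tau>'
    using that
  proof (induction t arbitrary: L \<tau>)
    case (Suc t)
    obtain L1 \<tau>1 where 1: "cfg_step (L, \<tau>) = (L1, \<tau>1)" by fastforce
    from sim[OF Suc.prems(1) 1] Suc.IH[of L1 \<tau>1] Suc.prems(2) 1 show ?case
      by (simp add: funpow_Suc_right del: funpow.simps)
  qed auto
  show thesis
  proof (rule that[OF wf])
    show "ntapes M = n" by (simp add: M_def)
    fix t \<tau> \<tau>' assume "(cfg_step ^^ t) ([c], \<tau>) = ([], \<tau>')"
    from sims[OF cS this] have "(step M ^^ t) (0, map \<tau> [0..<n]) = (e [], map \<tau>' [0..<n])"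
      by (simp add: e_c)
    moreover have "halted M (e [], map \<tau>' [0..<n])"
      by (simp add: halted_def M_def tr_def dec S_def)
    ultimately show "\<exists>q. (step M ^^ t) (0, map \<tau> [0..<n]) = (q, map \<tau>' [0..<n]) \<and> halted M (q, map \<tau>' [0..<n])"
      by blast
  qed
qed

section \<open>A language of bounded loops\<close>

definition sym_at :: "bool list \<Rightarrow> nat \<Rightarrow> nat" where
  "sym_at x i = (if i < length x then bit_symbol (x ! i) else 0)"

text \<open>
  Every program denotes a list of bits, and numbers are represented as lengths of such lists.
  Variables are de Bruijn indices, and the flag \<open>w\<close> selects the second input.
\<close>

datatype gen =
    NopG
  | EmitG bool
  | CatG gen gen
  | LetG gen gen
  | LetLen bool gen
  | ForG nat gen
  | IfLess nat nat gen gen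
  | IfSym bool nat nat gen gen

primrec sem :: "gen \<Rightarrow> bool list \<Rightarrow> bool list \<Rightarrow> (nat \<Rightarrow> nat) \<Rightarrow> bool list" where
  "sem NopG x y \<rho> = []"
| "sem (EmitG b) x y \<rho> = [b]"
| "sem (CatG g h) x y \<rho> = sem g x y \<rho> @ sem h x y \<rho>"
| "sem (LetG g h) x y \<rho> = sem h x y (case_nat (length (sem g x y \<rho>)) \<rho>)"
| "sem (LetLen w h) x y \<rho> = sem h x y (case_nat (length (if w then y else x)) \<rho>)"
| "sem (ForG i h) x y \<rho> = concat (map (\<lambda>v. sem h x y (case_nat v \<rho>)) [0..<\<rho> i])"
| "sem (IfLess i j g h) x y \<rho> = (if \<rho> i < \<rho> j then sem g x y \<rho> else sem h x y \<rho>)"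
| "sem (IfSym w i s g h) x y \<rho> =
     (if sym_at (if w then y else x) (\<rho> i) = s then sem g x y \<rho> else sem h x y \<rho>)"

subsection \<open>Counters and input heads\<close>

text \<open>
  Tape 0 takes the output, tapes 1 and 2 hold the second and the first input, and every further
  tape is a counter: its origin is marked, and its value is the position of its head.
  Counters 3 and 4 are scratch registers and counter 5 remains zero.
\<close>

definition strtape :: "int \<Rightarrow> bool list \<Rightarrow> int \<Rightarrow> nat" where
  "strtape b s i = (if b \<le> i \<and> i < b + int (length s) then bit_symbol (s ! nat (i - b)) else 0)"

text \<open>Scanning the blank 0 on a counter tape means that the counter is positive. Hence guards
  such as \<open>s 3 = 0\<close> test for a nonzero counter.\<close>

definition mark :: "int \<Rightarrow> nat" where
  "mark i = (if i = 0 then 1 else 0)"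

definition move_heads :: "nat set \<Rightarrow> nat set \<Rightarrow> com" where
  "move_heads D I = Act (\<lambda>_ j. (None, if j \<in> D then MoveLeft else if j \<in> I then MoveRight else Stay))"

definition emit_bit :: "bool \<Rightarrow> com" where
  "emit_bit c = Act (\<lambda>_ j. if j = 0 then (Some (bit_symbol c), MoveRight) else (None, Stay))"

definition shifted :: "nat set \<Rightarrow> nat set \<Rightarrow> nat \<Rightarrow> (nat \<Rightarrow> nat) \<Rightarrow> nat \<Rightarrow> nat" where
  "shifted D I k pos j = (if j \<in> D then pos j - k else if j \<in> I then pos j + k else pos j)"

text \<open>Both counters are decremented together until one is zero, register 3 recording how
  often. Counter \<open>j\<close> is then still positive exactly if \<open>i\<close> was smaller,
  which is noted in register 4; finally register 3 is used up to restore both counters.\<close>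

definition lessc :: "nat \<Rightarrow> nat \<Rightarrow> com" where
  "lessc i j = Seq (Loop (\<lambda>s. s i = 0 \<and> s j = 0) (move_heads {i, j} {3}))
     (Seq (Cond (\<lambda>s. s j = 0) (move_heads {} {4}) (move_heads {} {})) (Loop (\<lambda>s. s 3 = 0) (move_heads {3} {i, j})))"

definition clear :: "nat \<Rightarrow> com" where
  "clear r = Loop (\<lambda>s. s r = 0) (move_heads {r} {})"

text \<open>
  \<open>al\<close> assigns registers to the variables, the registers from \<open>nx\<close> on are free, and the output
  is either written to tape 0 or counted in a register.
\<close>

primrec compile_gen :: "gen \<Rightarrow> (nat \<Rightarrow> nat) \<Rightarrow> nat \<Rightarrow> nat option \<Rightarrow> com" where
  "compile_gen NopG al nx tgt = move_heads {} {}"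
| "compile_gen (EmitG b) al nx tgt = (case tgt of None \<Rightarrow> emit_bit b | Some r \<Rightarrow> move_heads {} {r})"
| "compile_gen (CatG g h) al nx tgt = Seq (compile_gen g al nx tgt) (compile_gen h al nx tgt)"
| "compile_gen (LetG g h) al nx tgt = Seq (compile_gen g al (Suc nx) (Some nx))
     (Seq (compile_gen h (case_nat nx al) (Suc nx) tgt) (clear nx))"
| "compile_gen (LetLen w h) al nx tgt =
     Seq (Loop (\<lambda>s. s (if w then 1 else 2) \<noteq> 0) (move_heads {} {if w then 1 else 2, nx, 3}))
       (Seq (Loop (\<lambda>s. s 3 = 0) (move_heads {3, if w then 1 else 2} {}))
         (Seq (compile_gen h (case_nat nx al) (Suc nx) tgt) (clear nx)))"
| "compile_gen (ForG i h) al nx tgt = Seq (lessc nx (al i))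
     (Seq (Loop (\<lambda>s. s 4 = 0) (Seq (move_heads {4} {}) (Seq (compile_gen h (case_nat nx al) (Suc nx) tgt)
         (Seq (move_heads {} {nx}) (lessc nx (al i))))))
       (clear nx))"
| "compile_gen (IfLess i j g h) al nx tgt = Seq (lessc (al i) (al j))
     (Cond (\<lambda>s. s 4 = 0) (Seq (move_heads {4} {}) (compile_gen g al nx tgt)) (compile_gen h al nx tgt))"
| "compile_gen (IfSym w i sy g h) al nx tgt =
     Seq (Loop (\<lambda>s. s (al i) = 0) (move_heads {al i} {if w then 1 else 2, 3}))
       (Seq (Cond (\<lambda>s. s (if w then 1 else 2) = sy) (move_heads {} {4}) (move_heads {} {}))
         (Seq (Loop (\<lambda>s. s 3 = 0) (move_heads {3, if w then 1 else 2} {al i}))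
           (Cond (\<lambda>s. s 4 = 0) (Seq (move_heads {4} {}) (compile_gen g al nx tgt)) (compile_gen h al nx tgt))))"

text \<open>\<open>N\<close> bounds all variables and both inputs. A loop variable stays below
  \<open>N\<close>, but a variable bound by \<open>LetG\<close> may exceed it, so the bound for its
  body has to grow. As the nesting is fixed by the program, the result is polynomial in
  \<open>N\<close>.\<close>

primrec size_bound :: "gen \<Rightarrow> nat \<Rightarrow> nat" where
  "size_bound NopG N = 0"
| "size_bound (EmitG b) N = 1"
| "size_bound (CatG g h) N = size_bound g N + size_bound h N"
| "size_bound (LetG g h) N = size_bound h (N + size_bound g N)"
| "size_bound (LetLen w h) N = size_bound h N"
| "size_bound (ForG i h) N = N * size_bound h N"
| "size_bound (IfLess i j g h) N = size_bound g N + size_bound h N"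
| "size_bound (IfSym w i s g h) N = size_bound g N + size_bound h N"

primrec time_bound :: "gen \<Rightarrow> nat \<Rightarrow> nat" where
  "time_bound NopG N = 1"
| "time_bound (EmitG b) N = 1"
| "time_bound (CatG g h) N = time_bound g N + time_bound h N + 1"
| "time_bound (LetG g h) N = time_bound g N + time_bound h (N + size_bound g N) + 2 * size_bound g N + 5"
| "time_bound (LetLen w h) N = time_bound h N + 6 * N + 9"
| "time_bound (ForG i h) N = N * (time_bound h N + 4 * N + 19) + 6 * N + 16"
| "time_bound (IfLess i j g h) N = time_bound g N + time_bound h N + 4 * N + 15"
| "time_bound (IfSym w i s g h) N = time_bound g N + time_bound h N + 4 * N + 15"

lemma length_sem_le:
  assumes "\<And>i. \<rho> i \<le> N" "length x \<le> N" "length y \<le> N"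
  shows "length (sem g x y \<rho>) \<le> size_bound g N"
  using assms
proof (induction g arbitrary: \<rho> N)
  case (CatG g h)
  then show ?case by (simp add: add_mono)
next
  case (LetG g h)
  have "length (sem g x y \<rho>) \<le> size_bound g N" using LetG by blast
  then show ?case
    using LetG.prems by (auto intro!: LetG.IH(2) split: nat.split simp: trans_le_add1)
next
  case (LetLen w h)
  then show ?case by (auto split: nat.split)
next
  case (ForG i h)
  have "sum_list (map (\<lambda>v. length (sem h x y (case_nat v \<rho>))) [0..<m]) \<le> m * size_bound h N" if "m \<le> N" for m
    using that
  proof (induction m)
    case (Suc m)
    have "length (sem h x y (case_nat m \<rho>)) \<le> size_bound h N"
      using Suc.prems ForG.prems by (intro ForG.IH) (auto split: nat.split)
    with Suc show ?case by simp
  qed simp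
  then have "sum_list (map (\<lambda>v. length (sem h x y (case_nat v \<rho>))) [0..<\<rho> i]) \<le> \<rho> i * size_bound h N"
    using ForG.prems(1) by blast
  also have "\<dots> \<le> N * size_bound h N" using ForG.prems(1) by simp
  finally show ?case by (simp add: length_concat o_def)
qed (auto intro: trans_le_add1 trans_le_add2)

definition emit_pos :: "nat option \<Rightarrow> nat \<Rightarrow> (nat \<Rightarrow> nat) \<Rightarrow> nat \<Rightarrow> nat" where
  "emit_pos tgt l pos = (case tgt of None \<Rightarrow> pos | Some r \<Rightarrow> pos(r := pos r + l))"

definition emit_out :: "nat option \<Rightarrow> bool list \<Rightarrow> bool list \<Rightarrow> bool list" where
  "emit_out tgt s out = (case tgt of None \<Rightarrow> out @ s | Some r \<Rightarrow> out)"

text \<open>The invariant between subprograms: input heads at their origins, scratch and free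
  registers zero. The register that counts output is not a variable, so emitting leaves the
  environment intact. Variables without a binder are mapped to register 5 and thus read 0.\<close>

definition good :: "(nat \<Rightarrow> nat) \<Rightarrow> nat \<Rightarrow> nat option \<Rightarrow> (nat \<Rightarrow> nat) \<Rightarrow> bool" where
  "good al nx tgt pos \<longleftrightarrow> 6 \<le> nx \<and> (\<forall>i. 5 \<le> al i \<and> al i < nx) \<and> (\<forall>j. nx \<le> j \<or> j \<in> {1..5} \<longrightarrow> pos j = 0)
     \<and> (\<forall>r. tgt = Some r \<longrightarrow> 6 \<le> r \<and> r < nx \<and> r \<notin> range al)"

context
  fixes b :: int and x y :: "bool list"
begin

definition tapes :: "(nat \<Rightarrow> nat) \<Rightarrow> bool list \<Rightarrow> nat \<Rightarrow> tape" where
  "tapes pos out j = (if j = 0 then (strtape b out, b + int (length out))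
     else (if j = 1 then strtape 0 y else if j = 2 then strtape 0 x else mark, int (pos j)))"

lemma scan_tapes:
  "3 \<le> j \<Longrightarrow> scan (tapes pos out) j = (if pos j = 0 then 1 else 0)"
  "scan (tapes pos out) (Suc 0) = sym_at y (pos 1)"
  "scan (tapes pos out) 2 = sym_at x (pos 2)"
  by (auto simp: scan_def tapes_def mark_def strtape_def sym_at_def)

section \<open>Execution of the register operations\<close>

lemma runs_move_heads:
  assumes "0 \<notin> D" "0 \<notin> I" "\<And>j. j \<in> D \<Longrightarrow> 0 < pos j" "pos' = shifted D I 1 pos"
  shows "runs (move_heads D I) 1 (tapes pos out) (tapes pos' out)"
proof -
  have "(\<lambda>j. upd (None, if j \<in> D then MoveLeft else if j \<in> I then MoveRight else Stay) (tapes pos out j)) = tapes pos' out"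
    using assms by (intro ext) (auto simp: tapes_def shifted_def of_nat_diff Suc_le_eq)
  then show ?thesis
    using runs_Act[of "\<lambda>_ j. (None, if j \<in> D then MoveLeft else if j \<in> I then MoveRight else Stay)" "tapes pos out"]
    unfolding move_heads_def by simp
qed

lemma strtape_snoc: "(strtape b s)(b + int (length s) := bit_symbol c) = strtape b (s @ [c])"
  by (auto simp: strtape_def nth_append fun_eq_iff)

lemma runs_emit_bit: "runs (emit_bit c) 1 (tapes pos out) (tapes pos (out @ [c]))"
proof -
  have "bit_symbol c mod 3 = bit_symbol c" by (cases c) auto
  then have "(\<lambda>j. upd (if j = 0 then (Some (bit_symbol c), MoveRight) else (None, Stay)) (tapes pos out j))
      = tapes pos (out @ [c])"
    by (intro ext) (simp add: tapes_def strtape_snoc)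
  then show ?thesis
    using runs_Act[of "\<lambda>_ j. if j = 0 then (Some (bit_symbol c), MoveRight) else (None, Stay)" "tapes pos out"]
    unfolding emit_bit_def by simp
qed

lemma runs_move_heads_loop:
  assumes "0 \<notin> D" "0 \<notin> I" "\<And>j. j \<in> D \<Longrightarrow> k \<le> pos j"
    and "\<And>i. i < k \<Longrightarrow> t (scan (tapes (shifted D I i pos) out))" "\<not> t (scan (tapes (shifted D I k pos) out))"
    and "2 * k < m" and "pos' = shifted D I k pos"
  shows "runs (Loop t (move_heads D I)) m (tapes pos out) (tapes pos' out)"
proof -
  have "runs (Loop t (move_heads D I)) m (tapes (shifted D I 0 pos) out) (tapes (shifted D I k pos) out)"
  proof (rule runs_Loop[where n = 1])
    fix i assume i: "i < k"
    show "runs (move_heads D I) 1 (tapes (shifted D I i pos) out) (tapes (shifted D I (Suc i) pos) out)"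
    proof (rule runs_move_heads)
      fix j assume "j \<in> D"
      then show "0 < shifted D I i pos j" using assms(3)[of j] i by (simp add: shifted_def)
    qed (use assms(1,2) in \<open>auto simp: shifted_def fun_eq_iff\<close>)
  qed (use assms in auto)
  moreover have "shifted D I 0 pos = pos" by (auto simp: shifted_def)
  ultimately show ?thesis using assms(7) by simp
qed

lemma runs_lessc:
  assumes "5 \<le> i" "5 \<le> j" "pos 3 = 0" "pos 4 = 0" "pos i \<le> N" "4 * N + 11 \<le> m"
    and "pos' = pos(4 := if pos i < pos j then 1 else 0)"
  shows "runs (lessc i j) m (tapes pos out) (tapes pos' out)"
  unfolding lessc_def assms(7)
proof (rule runs_Seq)
  let ?k = "min (pos i) (pos j)"
  let ?p = "shifted {i, j} {3} ?k pos"
  show "runs (Loop (\<lambda>s. s i = 0 \<and> s j = 0) (move_heads {i, j} {3})) (2 * N + 1) (tapes pos out) (tapes ?p out)"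
    by (rule runs_move_heads_loop[where k = ?k]) (use assms in \<open>auto simp: scan_tapes shifted_def\<close>)
  let ?q = "?p(4 := if pos i < pos j then 1 else 0)"
  show "runs (Seq (Cond (\<lambda>s. s j = 0) (move_heads {} {4}) (move_heads {} {})) (Loop (\<lambda>s. s 3 = 0) (move_heads {3} {i, j})))
     (2 * N + 8) (tapes ?p out) (tapes (pos(4 := if pos i < pos j then 1 else 0)) out)"
  proof (rule runs_Seq)
    show "runs (Cond (\<lambda>s. s j = 0) (move_heads {} {4}) (move_heads {} {})) 3 (tapes ?p out) (tapes ?q out)"
    proof (rule runs_Cond[where n = 1])
      have *: "scan (tapes ?p out) j = 0 \<longleftrightarrow> pos i < pos j" using assms by (auto simp: scan_tapes shifted_def)
      have "runs (move_heads {} {4}) 1 (tapes ?p out) (tapes ?q out)" if "pos i < pos j"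
        by (rule runs_move_heads) (use assms that in \<open>auto simp: shifted_def fun_eq_iff\<close>)
      moreover have "runs (move_heads {} {}) 1 (tapes ?p out) (tapes ?q out)" if "\<not> pos i < pos j"
        by (rule runs_move_heads) (use assms that in \<open>auto simp: shifted_def fun_eq_iff\<close>)
      ultimately show "runs (if scan (tapes ?p out) j = 0 then move_heads {} {4} else move_heads {} {}) 1 (tapes ?p out) (tapes ?q out)"
        unfolding * by auto
    qed simp
    show "runs (Loop (\<lambda>s. s 3 = 0) (move_heads {3} {i, j})) (2 * N + 1) (tapes ?q out)
        (tapes (pos(4 := if pos i < pos j then 1 else 0)) out)"
      by (rule runs_move_heads_loop[where k = ?k]) (use assms in \<open>auto simp: scan_tapes shifted_def fun_eq_iff\<close>)
  qed simp
qed (use assms in simp)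

lemma runs_clear:
  assumes "3 \<le> r" "pos r \<le> N" "2 * N < m" "pos' = pos(r := 0)"
  shows "runs (clear r) m (tapes pos out) (tapes pos' out)"
  unfolding clear_def
  by (rule runs_move_heads_loop[where k = "pos r"]) (use assms in \<open>auto simp: scan_tapes shifted_def fun_eq_iff\<close>)

lemma good_emit_pos: "good al nx tgt pos \<Longrightarrow> good al nx tgt (emit_pos tgt l pos)"
  by (auto simp: good_def emit_pos_def split: option.splits)

lemma emit_pos_al: "good al nx tgt pos \<Longrightarrow> emit_pos tgt l pos (al i) = pos (al i)"
  by (auto simp: good_def emit_pos_def split: option.splits)

lemma emit_pos_low: "good al nx tgt pos \<Longrightarrow> nx \<le> j \<or> j \<le> 5 \<Longrightarrow> emit_pos tgt l pos j = pos j"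
  by (auto simp: good_def emit_pos_def split: option.splits)

lemma emit_pos_upd: "good al nx tgt pos \<Longrightarrow> nx \<le> j \<or> j \<le> 5 \<Longrightarrow> emit_pos tgt l (pos(j := v)) = (emit_pos tgt l pos)(j := v)"
  by (auto simp: good_def emit_pos_def split: option.splits)

lemma emit_pos_add: "emit_pos tgt l (emit_pos tgt k pos) = emit_pos tgt (k + l) pos"
  by (auto simp: emit_pos_def split: option.splits)

lemma emit_out_append: "emit_out tgt t (emit_out tgt s out) = emit_out tgt (s @ t) out"
  by (auto simp: emit_out_def split: option.splits)

lemma emit_pos_0 [simp]: "emit_pos tgt 0 pos = pos" and emit_out_Nil [simp]: "emit_out tgt [] out = out"
  by (auto simp: emit_pos_def emit_out_def split: option.splits)

lemma good_bind: "good al nx tgt pos \<Longrightarrow> good (case_nat nx al) (Suc nx) tgt (pos(nx := v))"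
  by (auto simp: good_def less_Suc_eq split: nat.splits)

lemma bind_env: "good al nx tgt pos \<Longrightarrow> (\<lambda>i. (pos(nx := v)) (case_nat nx al i)) = case_nat v (\<lambda>i. pos (al i))"
  by (auto simp: good_def fun_eq_iff split: nat.splits)

lemma goodD:
  assumes "good al nx tgt pos"
  shows "6 \<le> nx" "5 \<le> al i" "al i < nx" "pos nx = 0" "pos (Suc 0) = 0" "pos 2 = 0" "pos 3 = 0" "pos 4 = 0" "pos 5 = 0"
  using assms by (auto simp: good_def)

text \<open>Common to all binders: the bound variable lives in the first free register
  \<open>nx\<close>, and the body is executed with the free registers starting one later.\<close>

lemma runs_body:
  assumes IH: "\<And>al nx tgt pos N out. good al nx tgt pos \<Longrightarrow> (\<And>i. pos (al i) \<le> N) \<Longrightarrow> length x \<le> N \<Longrightarrow> length y \<le> N \<Longrightarrow>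
       runs (compile_gen h al nx tgt) (time_bound h N) (tapes pos out) (tapes (emit_pos tgt (length (sem h x y (\<lambda>i. pos (al i)))) pos)
        (emit_out tgt (sem h x y (\<lambda>i. pos (al i))) out))"
    and g: "good al nx tgt pos" and N: "\<And>i. pos (al i) \<le> N" "v \<le> N" "length x \<le> N" "length y \<le> N"
  shows "runs (compile_gen h (case_nat nx al) (Suc nx) tgt) (time_bound h N) (tapes (pos(nx := v)) out)
     (tapes ((emit_pos tgt (length (sem h x y (case_nat v (\<lambda>i. pos (al i))))) pos)(nx := v)) (emit_out tgt (sem h x y (case_nat v (\<lambda>i. pos (al i)))) out))"
proof -
  have "(pos(nx := v)) (case_nat nx al i) \<le> N" for i
    using N goodD(3)[OF g] by (auto split: nat.split)
  from IH[OF good_bind[OF g] this N(3,4)] show ?thesis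
    unfolding bind_env[OF g] using emit_pos_upd[OF g, of nx] by (simp only: refl disj_not1 order_refl simp_thms)
qed

lemma runs_branch:
  assumes p4: "pos 4 = 0"
    and g: "P \<Longrightarrow> runs g m (tapes pos out) (tapes pos' out')"
    and h: "\<not> P \<Longrightarrow> runs h m' (tapes pos out) (tapes pos' out')"
  shows "runs (Cond (\<lambda>s. s 4 = 0) (Seq (move_heads {4} {}) g) h) (m + m' + 3)
    (tapes (pos(4 := if P then 1 else 0)) out) (tapes pos' out')"
proof (rule runs_Cond[where n = "m + m' + 2"])
  have "runs (move_heads {4} {}) 1 (tapes (pos(4 := 1)) out) (tapes pos out)"
    by (rule runs_move_heads) (use p4 in \<open>auto simp: shifted_def fun_eq_iff\<close>)
  then have "runs (Seq (move_heads {4} {}) g) (m + m' + 2) (tapes (pos(4 := 1)) out) (tapes pos' out')" if P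
    by (rule runs_Seq[OF _ g[OF that]]) simp
  moreover have "runs h (m + m' + 2) (tapes (pos(4 := 0)) out) (tapes pos' out')" if "\<not> P"
    using runs_mono[OF h[OF that]] fun_upd_idem[of pos 4 0, OF p4] by simp
  ultimately show "runs (if scan (tapes (pos(4 := if P then 1 else 0)) out) 4 = 0 then Seq (move_heads {4} {}) g else h)
     (m + m' + 2) (tapes (pos(4 := if P then 1 else 0)) out) (tapes pos' out')"
    by (simp add: scan_tapes)
qed simp

text \<open>Each construct clears the register it has allocated and returns the input heads and
  scratch registers to their origins, so the output is its only lasting effect and
  \<open>good\<close> holds again for whatever follows.\<close>

theorem compile_gen_correct:
  assumes "good al nx tgt pos" "\<And>i. pos (al i) \<le> N" "length x \<le> N" "length y \<le> N"
  shows "runs (compile_gen g al nx tgt) (time_bound g N) (tapes pos out)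
    (tapes (emit_pos tgt (length (sem g x y (\<lambda>i. pos (al i)))) pos) (emit_out tgt (sem g x y (\<lambda>i. pos (al i))) out))"
  using assms
proof (induction g arbitrary: al nx tgt pos N out)
  case NopG
  show ?case by (simp, rule runs_move_heads[THEN runs_mono]) (auto simp: shifted_def)
next
  case (EmitG c)
  show ?case
  proof (cases tgt)
    case None
    then show ?thesis using runs_emit_bit by (simp add: emit_pos_def emit_out_def)
  next
    case (Some r)
    with EmitG.prems(1) have "6 \<le> r" by (simp add: good_def)
    then have "runs (move_heads {} {r}) 1 (tapes pos out) (tapes (pos(r := pos r + 1)) out)"
      by (intro runs_move_heads) (auto simp: shifted_def fun_eq_iff)
    with Some show ?thesis by (simp add: emit_pos_def emit_out_def fun_upd_def)
  qed
next
  case (CatG g h)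
  let ?\<rho> = "\<lambda>i. pos (al i)"
  let ?pos = "emit_pos tgt (length (sem g x y ?\<rho>)) pos"
  have "runs (compile_gen h al nx tgt) (time_bound h N) (tapes ?pos (emit_out tgt (sem g x y ?\<rho>) out))
    (tapes (emit_pos tgt (length (sem g x y ?\<rho> @ sem h x y ?\<rho>)) pos) (emit_out tgt (sem g x y ?\<rho> @ sem h x y ?\<rho>) out))"
    using CatG.IH(2)[of al nx tgt ?pos N "emit_out tgt (sem g x y ?\<rho>) out"] CatG.prems
    by (simp add: good_emit_pos emit_pos_al emit_pos_add emit_out_append)
  from runs_Seq[OF CatG.IH(1)[OF CatG.prems] this] show ?case by (simp add:)
next
  case (LetG g h)
  note g = LetG.prems(1)
  let ?s = "sem g x y (\<lambda>i. pos (al i))"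
  let ?v = "length ?s"
  have v: "?v \<le> size_bound g N" using LetG.prems by (intro length_sem_le) auto
  have g1: "good al (Suc nx) (Some nx) pos" using g by (auto simp: good_def less_Suc_eq)
  have 1: "runs (compile_gen g al (Suc nx) (Some nx)) (time_bound g N) (tapes pos out) (tapes (pos(nx := ?v)) out)"
    using LetG.IH(1)[OF g1 LetG.prems(2-4)] goodD(4)[OF g] by (simp add: emit_pos_def emit_out_def fun_upd_def)
  let ?t = "sem h x y (case_nat ?v (\<lambda>i. pos (al i)))"
  let ?p = "emit_pos tgt (length ?t) pos"
  have 2: "runs (compile_gen h (case_nat nx al) (Suc nx) tgt) (time_bound h (N + size_bound g N)) (tapes (pos(nx := ?v)) out)
     (tapes (?p(nx := ?v)) (emit_out tgt ?t out))"
    by (rule runs_body[OF LetG.IH(2) g]) (use LetG.prems v in \<open>auto intro: trans_le_add1\<close>)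
  have 3: "runs (clear nx) (2 * size_bound g N + 1) (tapes (?p(nx := ?v)) (emit_out tgt ?t out)) (tapes ?p (emit_out tgt ?t out))"
    by (rule runs_clear[where N = "size_bound g N"]) (use goodD[OF g] v emit_pos_low[OF g, of nx] in \<open>auto simp: fun_eq_iff\<close>)
  show ?case
    by (simp only: compile_gen.simps sem.simps time_bound.simps, rule runs_Seq[OF 1 runs_Seq[OF 2 3 lessI]]) simp
next
  case (LetLen w h)
  note g = LetLen.prems(1)
  define k where "k = (if w then 1 else 2 :: nat)"
  define v where "v = length (if w then y else x)"
  have k: "k \<in> {1, 2}" and v: "v \<le> N" using LetLen.prems by (auto simp: k_def v_def)
  have sk: "scan (tapes p out) k = sym_at (if w then y else x) (p k)" for p out
    by (auto simp: k_def scan_tapes)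
  have sv: "sym_at (if w then y else x) i = 0 \<longleftrightarrow> v \<le> i" for i
    unfolding sym_at_def v_def using bit_symbol.elims[of "(if w then y else x) ! i"] by fastforce
  let ?q = "pos(nx := v, 3 := v, k := v)"
  have 1: "runs (Loop (\<lambda>s. s k \<noteq> 0) (move_heads {} {k, nx, 3})) (2 * N + 1) (tapes pos out) (tapes ?q out)"
    by (rule runs_move_heads_loop[where k = v])
       (use k v goodD[OF g] in \<open>auto simp: sk sv shifted_def fun_eq_iff\<close>)
  have 2: "runs (Loop (\<lambda>s. s 3 = 0) (move_heads {3, k} {})) (2 * N + 1) (tapes ?q out) (tapes (pos(nx := v)) out)"
    by (rule runs_move_heads_loop[where k = v])
       (use k v goodD[OF g] in \<open>auto simp: scan_tapes shifted_def fun_eq_iff\<close>)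
  let ?t = "sem h x y (case_nat v (\<lambda>i. pos (al i)))"
  let ?p = "emit_pos tgt (length ?t) pos"
  have 3: "runs (compile_gen h (case_nat nx al) (Suc nx) tgt) (time_bound h N) (tapes (pos(nx := v)) out)
     (tapes (?p(nx := v)) (emit_out tgt ?t out))"
    by (rule runs_body[OF LetLen.IH g]) (use LetLen.prems v in auto)
  have 4: "runs (clear nx) (2 * N + 1) (tapes (?p(nx := v)) (emit_out tgt ?t out)) (tapes ?p (emit_out tgt ?t out))"
    by (rule runs_clear[where N = N]) (use goodD[OF g] v emit_pos_low[OF g, of nx] in \<open>auto simp: fun_eq_iff\<close>)
  show ?case
    by (simp only: compile_gen.simps sem.simps time_bound.simps k_def[symmetric] v_def[symmetric],
        rule runs_Seq[OF 1 runs_Seq[OF 2 runs_Seq[OF 3 4 lessI] lessI]]) simp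
next
  case (ForG i h)
  note g = ForG.prems(1)
  let ?n = "pos (al i)"
  have n: "?n \<le> N" using ForG.prems(2) .
  define F where "F m = concat (map (\<lambda>v. sem h x y (case_nat v (\<lambda>i. pos (al i)))) [0..<m])" for m
  define P where "P m = emit_pos tgt (length (F m)) pos" for m
  define out' where "out' m = emit_out tgt (F m) out" for m
  \<comment> \<open>The tapes at the guard of the loop: register 4 tells whether another round
    follows.\<close>
  define S where "S m = tapes ((P m)(nx := m, 4 := if m < ?n then 1 else 0)) (out' m)" for m
  have gP: "good al nx tgt (P m)" for m unfolding P_def using g by (rule good_emit_pos)
  have Pal: "P m (al j) = pos (al j)" for m j unfolding P_def using g by (rule emit_pos_al)
  have al: "al i \<noteq> nx" "5 \<le> al i" "6 \<le> nx" using goodD(2,3)[OF g, of i] goodD(1)[OF g] by auto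
  have start: "P 0 = pos" "out' 0 = out" by (auto simp: P_def F_def out'_def)
  have less: "runs (lessc nx (al i)) (4 * N + 11) (tapes ((P m)(nx := m)) (out' m)) (S m)" if "m \<le> N" for m
    unfolding S_def
    by (rule runs_lessc[where N = N])
       (use al goodD[OF gP] that Pal in auto)
  have body: "runs (Seq (move_heads {4} {}) (Seq (compile_gen h (case_nat nx al) (Suc nx) tgt)
         (Seq (move_heads {} {nx}) (lessc nx (al i))))) (time_bound h N + 4 * N + 16) (S m) (S (Suc m))" if "m < ?n" for m
  proof -
    have 1: "runs (move_heads {4} {}) 1 (S m) (tapes ((P m)(nx := m)) (out' m))"
      unfolding S_def by (rule runs_move_heads) (use that goodD[OF gP[of m]] al in \<open>auto simp: shifted_def fun_eq_iff\<close>)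
    have 2: "runs (compile_gen h (case_nat nx al) (Suc nx) tgt) (time_bound h N) (tapes ((P m)(nx := m)) (out' m))
       (tapes ((P (Suc m))(nx := m)) (out' (Suc m)))"
    proof -
      have "P (Suc m) = emit_pos tgt (length (sem h x y (case_nat m (\<lambda>i. P m (al i))))) (P m)"
        "out' (Suc m) = emit_out tgt (sem h x y (case_nat m (\<lambda>i. P m (al i)))) (out' m)"
        unfolding Pal by (simp_all add: P_def out'_def emit_pos_add emit_out_append F_def)
      then show ?thesis
        using runs_body[OF ForG.IH gP, where N = N and v = m and out = "out' m"] ForG.prems n that Pal by simp
    qed
    have 3: "runs (move_heads {} {nx}) 1 (tapes ((P (Suc m))(nx := m)) (out' (Suc m))) (tapes ((P (Suc m))(nx := Suc m)) (out' (Suc m)))"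
      by (rule runs_move_heads) (use al in \<open>auto simp: shifted_def fun_eq_iff\<close>)
    have 4: "runs (lessc nx (al i)) (4 * N + 11) (tapes ((P (Suc m))(nx := Suc m)) (out' (Suc m))) (S (Suc m))"
      by (rule less) (use that n in simp)
    show ?thesis by (rule runs_Seq[OF 1 runs_Seq[OF 2 runs_Seq[OF 3 4 lessI] lessI]]) simp
  qed
  have 1: "runs (lessc nx (al i)) (4 * N + 11) (tapes pos out) (S 0)"
    using less[of 0] goodD(4)[OF g] by (simp add: start fun_upd_idem)
  have 2: "runs (Loop (\<lambda>s. s 4 = 0) (Seq (move_heads {4} {}) (Seq (compile_gen h (case_nat nx al) (Suc nx) tgt)
         (Seq (move_heads {} {nx}) (lessc nx (al i)))))) (Suc (N * (time_bound h N + 4 * N + 16 + 1))) (S 0) (S ?n)"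
  proof (rule runs_Loop[where S = S and k = ?n and n = "time_bound h N + 4 * N + 16"])
    show "?n * (time_bound h N + 4 * N + 16 + 1) < Suc (N * (time_bound h N + 4 * N + 16 + 1))"
      by (rule le_imp_less_Suc[OF mult_right_mono[OF n]]) simp
  qed (use body in \<open>auto simp: S_def scan_tapes\<close>)
  have 3: "runs (clear nx) (2 * N + 1) (S ?n) (tapes (P ?n) (out' ?n))"
    unfolding S_def
    by (rule runs_clear[where N = N]) (use n al goodD[OF gP[of ?n]] in \<open>auto simp: fun_eq_iff\<close>)
  have "runs (compile_gen (ForG i h) al nx tgt) (time_bound (ForG i h) N) (tapes pos out) (tapes (P ?n) (out' ?n))"
    by (simp only: compile_gen.simps sem.simps time_bound.simps, rule runs_Seq[OF 1 runs_Seq[OF 2 3 lessI]]) (simp add: algebra_simps)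
  then show ?case by (simp add: P_def out'_def F_def)
next
  case (IfLess i j g h)
  note d = goodD[OF IfLess.prems(1)]
  have "runs (lessc (al i) (al j)) (4 * N + 11) (tapes pos out) (tapes (pos(4 := if pos (al i) < pos (al j) then 1 else 0)) out)"
    by (rule runs_lessc[where N = N]) (use d IfLess.prems(2) in auto)
  then show ?case
    unfolding compile_gen.simps
  proof (rule runs_Seq)
    let ?t = "sem (IfLess i j g h) x y (\<lambda>i. pos (al i))"
    show "runs (Cond (\<lambda>s. s 4 = 0) (Seq (move_heads {4} {}) (compile_gen g al nx tgt)) (compile_gen h al nx tgt)) (time_bound g N + time_bound h N + 3)
      (tapes (pos(4 := if pos (al i) < pos (al j) then 1 else 0)) out) (tapes (emit_pos tgt (length ?t) pos) (emit_out tgt ?t out))"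
      by (rule runs_branch) (use IfLess.IH(1)[OF IfLess.prems] IfLess.IH(2)[OF IfLess.prems] d in auto)
  qed simp
next
  case (IfSym w i sy g h)
  note d = goodD[OF IfSym.prems(1)]
  define k where "k = (if w then 1 else 2 :: nat)"
  have k: "k \<in> {1, 2}" by (auto simp: k_def)
  have sk: "scan (tapes p out) k = sym_at (if w then y else x) (p k)" for p out
    by (auto simp: k_def scan_tapes)
  let ?n = "pos (al i)"
  let ?P = "sym_at (if w then y else x) ?n = sy"
  have n: "?n \<le> N" using IfSym.prems(2) .
  have ai: "al i \<noteq> k" "3 < al i" "4 < al i" using d(2)[of i] k by auto
  let ?q = "pos(al i := 0, 3 := ?n, k := ?n)"
  have 1: "runs (Loop (\<lambda>s. s (al i) = 0) (move_heads {al i} {k, 3})) (2 * N + 1) (tapes pos out) (tapes ?q out)"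
    by (rule runs_move_heads_loop[where k = ?n]) (use k n d ai in \<open>auto simp: scan_tapes shifted_def fun_eq_iff\<close>)
  have 2: "runs (Cond (\<lambda>s. s k = sy) (move_heads {} {4}) (move_heads {} {})) 2 (tapes ?q out) (tapes (?q(4 := if ?P then 1 else 0)) out)"
  proof (rule runs_Cond[where n = 1])
    have "runs (move_heads {} {4}) 1 (tapes ?q out) (tapes (?q(4 := 1)) out)"
      by (rule runs_move_heads) (use d ai k in \<open>auto simp: shifted_def fun_eq_iff\<close>)
    moreover have "runs (move_heads {} {}) 1 (tapes ?q out) (tapes (?q(4 := 0)) out)"
      by (rule runs_move_heads) (use d ai k in \<open>auto simp: shifted_def fun_eq_iff\<close>)
    ultimately show "runs (if scan (tapes ?q out) k = sy then move_heads {} {4} else move_heads {} {}) 1 (tapes ?q out)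
      (tapes (?q(4 := if ?P then 1 else 0)) out)"
      by (simp add: sk)
  qed simp
  have 3: "runs (Loop (\<lambda>s. s 3 = 0) (move_heads {3, k} {al i})) (2 * N + 1) (tapes (?q(4 := if ?P then 1 else 0)) out)
      (tapes (pos(4 := if ?P then 1 else 0)) out)"
    by (rule runs_move_heads_loop[where k = ?n]) (use k n d ai in \<open>auto simp: scan_tapes shifted_def fun_eq_iff\<close>)
  let ?B = "Cond (\<lambda>s. s 4 = 0) (Seq (move_heads {4} {}) (compile_gen g al nx tgt)) (compile_gen h al nx tgt)"
  let ?t = "if ?P then sem g x y (\<lambda>i. pos (al i)) else sem h x y (\<lambda>i. pos (al i))"
  have 4: "runs (Seq (Loop (\<lambda>s. s 3 = 0) (move_heads {3, k} {al i})) ?B) (time_bound g N + time_bound h N + 2 * N + 7)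
      (tapes (?q(4 := if ?P then 1 else 0)) out) (tapes (emit_pos tgt (length ?t) pos) (emit_out tgt ?t out))"
  proof (rule runs_Seq[OF 3])
    show "runs ?B (time_bound g N + time_bound h N + 3) (tapes (pos(4 := if ?P then 1 else 0)) out) (tapes (emit_pos tgt (length ?t) pos) (emit_out tgt ?t out))"
      by (rule runs_branch) (use IfSym.IH(1)[OF IfSym.prems] IfSym.IH(2)[OF IfSym.prems] d in auto)
  qed simp
  show ?case
    by (simp only: compile_gen.simps sem.simps time_bound.simps k_def[symmetric], rule runs_Seq[OF 1 runs_Seq[OF 2 4 lessI]]) simp
qed

end

subsection \<open>Polynomial time\<close>

definition poly_bounded :: "(nat \<Rightarrow> nat) \<Rightarrow> bool" where
  "poly_bounded f \<longleftrightarrow> (\<exists>p. \<forall>n. f n \<le> poly p n)"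

lemma poly_nat_mono: "a \<le> b \<Longrightarrow> poly p a \<le> poly p (b :: nat)"
  by (induction p) (auto intro!: add_mono mult_mono)

lemma poly_bounded_const: "poly_bounded (\<lambda>_. c)"
  unfolding poly_bounded_def by (rule exI[of _ "[:c:]"]) simp

lemma poly_bounded_id: "poly_bounded (\<lambda>n. n)"
  unfolding poly_bounded_def by (rule exI[of _ "[:0, 1:]"]) simp

lemma poly_bounded_add: "poly_bounded f \<Longrightarrow> poly_bounded g \<Longrightarrow> poly_bounded (\<lambda>n. f n + g n)"
  unfolding poly_bounded_def by (metis add_mono poly_add)

lemma poly_bounded_mult: "poly_bounded f \<Longrightarrow> poly_bounded g \<Longrightarrow> poly_bounded (\<lambda>n. f n * g n)"
  unfolding poly_bounded_def by (metis mult_le_mono poly_mult)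

lemma poly_bounded_comp:
  assumes "poly_bounded f" "poly_bounded g"
  shows "poly_bounded (\<lambda>n. f (g n))"
proof -
  obtain p q where p: "\<And>n. f n \<le> poly p n" and q: "\<And>n. g n \<le> poly q n"
    using assms unfolding poly_bounded_def by blast
  have "f (g n) \<le> poly (pcompose p q) n" for n
    unfolding poly_pcompose by (rule order_trans[OF p poly_nat_mono[OF q]])
  then show ?thesis unfolding poly_bounded_def by blast
qed

lemma poly_bounded_Suc: "poly_bounded f \<Longrightarrow> poly_bounded (\<lambda>n. Suc (f n))"
  using poly_bounded_add[OF poly_bounded_const[of 1]] by simp

lemmas poly_bounded_intros = poly_bounded_const poly_bounded_id poly_bounded_Suc poly_bounded_add poly_bounded_mult

lemma poly_bounded_size_bound: "poly_bounded (size_bound g)"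
proof (induction g)
  case (LetG g h)
  then show ?case by (simp, intro poly_bounded_comp[OF LetG(2)] poly_bounded_add poly_bounded_id LetG(1))
qed (auto intro!: poly_bounded_intros)

lemma poly_bounded_time_bound: "poly_bounded (time_bound g)"
proof (induction g)
  case (LetG g h)
  then show ?case by (simp, intro poly_bounded_add poly_bounded_mult poly_bounded_comp[OF LetG(2)] poly_bounded_const poly_bounded_id poly_bounded_size_bound LetG(1))
qed (auto intro!: poly_bounded_intros)

section \<open>Dependence on finitely many tapes\<close>

lemma bounded_mono: "bounded n c \<Longrightarrow> n \<le> m \<Longrightarrow> bounded m c"
proof (induction c)
  case (Act a)
  then show ?case by (simp, (meson order_less_le_trans)?)
next
  case (Cond b c d)
  then show ?case by (simp, (meson order_less_le_trans)?)
next
  case (Loop b c)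
  then show ?case by (simp, (meson order_less_le_trans)?)
qed simp

lemma bounded_max:
  "\<exists>n. bounded n c \<Longrightarrow> \<exists>n. bounded n d \<Longrightarrow> \<exists>n. bounded n c \<and> bounded n d"
  using bounded_mono by (metis nat_le_linear)

lemma bounded_move_heads: "bounded n (move_heads D I)" and bounded_emit_bit: "bounded n (emit_bit c)"
  by (simp_all add: move_heads_def emit_bit_def)

lemma ex_bounded_Seq: "\<exists>n. bounded n c \<Longrightarrow> \<exists>n. bounded n d \<Longrightarrow> \<exists>n. bounded n (Seq c d)"
  using bounded_max[of c d] by simp

lemma ex_bounded_Loop:
  assumes "\<exists>n. bounded n c" "\<exists>n. \<forall>s s'. (\<forall>j<n. s j = s' j) \<longrightarrow> b s = b s'"
  shows "\<exists>n. bounded n (Loop b c)"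
proof -
  obtain n m where "bounded n c" "\<forall>s s'. (\<forall>j<m. s j = s' j) \<longrightarrow> b s = b s'" using assms by blast
  then have "bounded (max n m) (Loop b c)" using bounded_mono[of n c "max n m"] by auto
  then show ?thesis by blast
qed

lemma ex_bounded_Cond:
  assumes "\<exists>n. bounded n c" "\<exists>n. bounded n d" "\<exists>n. \<forall>s s'. (\<forall>j<n. s j = s' j) \<longrightarrow> b s = b s'"
  shows "\<exists>n. bounded n (Cond b c d)"
proof -
  obtain n m where n: "bounded n c" "bounded n d" and "\<forall>s s'. (\<forall>j<m. s j = s' j) \<longrightarrow> b s = b s'"
    using assms bounded_max[of c d] by blast
  then have "bounded (max n m) (Cond b c d)"
    using bounded_mono[of n c "max n m"] bounded_mono[of n d "max n m"] by auto
  then show ?thesis by blast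
qed

lemma ex_bounded_move_heads: "\<exists>n. bounded n (move_heads D I)" "\<exists>n. bounded n (emit_bit c)"
  using bounded_move_heads bounded_emit_bit by auto

lemma test_bounded:
  fixes P :: "nat \<Rightarrow> bool" and Q :: "nat \<Rightarrow> nat \<Rightarrow> bool" and i k :: nat
  shows "\<exists>n. \<forall>s s'. (\<forall>j<n. s j = s' j) \<longrightarrow> P (s i) = P (s' i)"
    and "\<exists>n. \<forall>s s'. (\<forall>j<n. s j = s' j) \<longrightarrow> Q (s i) (s k) = Q (s' i) (s' k)"
  by (rule exI[of _ "Suc i"], simp) (rule exI[of _ "Suc (max i k)"], simp)

lemmas ex_bounded_intros = ex_bounded_Seq ex_bounded_Cond ex_bounded_Loop ex_bounded_move_heads
  test_bounded(1)[where P = "\<lambda>v. v = 0"] test_bounded(1)[where P = "\<lambda>v. v \<noteq> 0"]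
  test_bounded(1)[where P = "\<lambda>v. v = c" for c]
  test_bounded(2)[where Q = "\<lambda>v w. v = 0 \<and> w = 0"]

lemma bounded_compile_gen: "\<exists>n. bounded n (compile_gen g al nx tgt)"
proof (induction g arbitrary: al nx tgt)
  case (EmitG x)
  show ?case by (cases tgt) (simp_all add: ex_bounded_move_heads)
next
  case (CatG g h)
  show ?case unfolding compile_gen.simps by (intro ex_bounded_intros CatG)
next
  case (LetG g h)
  show ?case unfolding compile_gen.simps clear_def by (intro ex_bounded_intros LetG)
next
  case (LetLen w h)
  show ?case unfolding compile_gen.simps clear_def by (intro ex_bounded_intros LetLen)
next
  case (ForG i h)
  show ?case unfolding compile_gen.simps clear_def lessc_def by (intro ex_bounded_intros ForG)
next
  case (IfLess i j g h)
  show ?case unfolding compile_gen.simps lessc_def by (intro ex_bounded_intros IfLess)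
next
  case (IfSym w i s g h)
  show ?case unfolding compile_gen.simps by (intro ex_bounded_intros IfSym)
qed (simp add: ex_bounded_move_heads)

text \<open>The head stands on the blank behind a word. It steps onto the word, runs left to the
  blank in front of it and steps back. This relies on a blank in front of the word.\<close>

definition rewind :: "nat \<Rightarrow> com" where
  "rewind j = Seq (move_heads {j} {}) (Seq (Loop (\<lambda>s. s j \<noteq> 0) (move_heads {j} {})) (move_heads {} {j}))"

lemma runs_move_heads_head:
  assumes "\<tau> j = (f, h)"
  shows "runs (move_heads {j} {}) 1 \<tau> (\<tau>(j := (f, h - 1)))" "runs (move_heads {} {j}) 1 \<tau> (\<tau>(j := (f, h + 1)))"
proof -
  have *: "runs (move_heads D I) 1 \<tau> \<tau>'"
    if "(\<lambda>i. upd (None, if i \<in> D then MoveLeft else if i \<in> I then MoveRight else Stay) (\<tau> i)) = \<tau>'" for D I \<tau>'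
    unfolding move_heads_def that[symmetric] by (rule runs_Act)
  show "runs (move_heads {j} {}) 1 \<tau> (\<tau>(j := (f, h - 1)))" "runs (move_heads {} {j}) 1 \<tau> (\<tau>(j := (f, h + 1)))"
    by (intro * ext; simp add: assms)+
qed

lemma bit_symbol_nz: "bit_symbol c \<noteq> 0" "bit_symbol c mod 3 = bit_symbol c"
  by (cases c; simp)+

lemma runs_rewind:
  assumes "\<tau> j = (strtape b s, b + int (length s))"
  shows "runs (rewind j) (2 * length s + 6) \<tau> (\<tau>(j := (strtape b s, b)))"
proof -
  define S where "S i = \<tau>(j := (strtape b s, b + int (length s) - 1 - int i))" for i
  have 1: "runs (move_heads {j} {}) 1 \<tau> (S 0)"
    using runs_move_heads_head(1)[of \<tau> j, OF assms] by (simp add: S_def)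
  have 2: "runs (Loop (\<lambda>s. s j \<noteq> 0) (move_heads {j} {})) (2 * length s + 1) (S 0) (S (length s))"
  proof (rule runs_Loop[where n = 1])
    fix i assume i: "i < length s"
    show "runs (move_heads {j} {}) 1 (S i) (S (Suc i))"
      using runs_move_heads_head(1)[of "S i" j "strtape b s" "b + int (length s) - 1 - int i"]
      by (simp add: S_def algebra_simps)
    show "scan (S i) j \<noteq> 0" using i by (simp add: S_def scan_def strtape_def bit_symbol_nz)
  qed (auto simp: S_def scan_def strtape_def)
  have 3: "runs (move_heads {} {j}) 1 (S (length s)) (\<tau>(j := (strtape b s, b)))"
    using runs_move_heads_head(2)[of "S (length s)" j "strtape b s" "b - 1"] by (simp add: S_def)
  show ?thesis unfolding rewind_def by (rule runs_Seq[OF 1 runs_Seq[OF 2 3 lessI]]) simp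
qed

definition mark_origins :: com where
  "mark_origins = Act (\<lambda>_ j. (if 3 \<le> j then Some 1 else None, Stay))"

text \<open>Erasing the input while copying it leaves tape 0 blank with the head at cell
  \<open>length x\<close>. The output starts there, and the blank in front of it is what stops the
  final \<open>rewind 0\<close>.\<close>

definition copy_input :: com where
  "copy_input = Loop (\<lambda>s. s 0 \<noteq> 0) (Act (\<lambda>s j. if j = 0 then (Some 0, MoveRight)
     else if j = 2 then (Some (s 0), MoveRight) else (None, Stay)))"

definition prog :: "gen \<Rightarrow> com" where
  "prog g = Seq mark_origins (Seq copy_input (Seq (rewind 2) (Seq (compile_gen g (\<lambda>_. 5) 6 None) (rewind 0))))"

lemma bounded_prog: "\<exists>n. bounded n (prog g)"
proof -
  have "bounded 1 mark_origins" "bounded 1 copy_input" by (auto simp: mark_origins_def copy_input_def)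
  moreover have "\<exists>n. bounded n (rewind j)" for j
    unfolding rewind_def by (intro ex_bounded_intros)
  ultimately show ?thesis unfolding prog_def by (intro ex_bounded_Seq bounded_compile_gen) blast+
qed

definition start :: "bool list \<Rightarrow> bool list \<Rightarrow> nat \<Rightarrow> tape" where
  "start x y j = input_tape (if j = 0 then x else if j = 1 then y else [])"

lemma input_tape_eq: "input_tape x = (strtape 0 x, 0)"
  by (auto simp: input_tape_def strtape_def)

lemma runs_prog:
  assumes N: "N = length x + length y"
  shows "\<exists>\<tau>. runs (prog g) (6 * N + time_bound g N + 2 * size_bound g N + 23) (start x y) \<tau> \<and>
     \<tau> 0 = (strtape (int (length x)) (sem g x y (\<lambda>_. 0)), int (length x))"
proof -
  define S where "S i j = (if j = 0 then ((\<lambda>k. if k < int i then 0 else strtape 0 x k), int i)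
    else if j = 2 then (strtape 0 (take i x), int i) else if j = 1 then (strtape 0 y, 0) else (mark, 0))"
    for i j :: nat
  have 1: "runs mark_origins 1 (start x y) (S 0)"
  proof -
    have "(\<lambda>j. upd (if 3 \<le> j then Some 1 else None, Stay) (start x y j)) = S 0"
      by (rule ext) (auto simp: start_def input_tape_eq S_def mark_def strtape_def fun_eq_iff)
    moreover have "runs mark_origins 1 (start x y) (\<lambda>j. upd (if 3 \<le> j then Some 1 else None, Stay) (start x y j))"
      unfolding mark_origins_def by (rule runs_Act)
    ultimately show ?thesis by simp
  qed
  have 2: "runs copy_input (2 * N + 1) (S 0) (S (length x))"
    unfolding copy_input_def
  proof (rule runs_Loop[where n = 1])
    fix i assume i: "i < length x"
    have s0: "scan (S i) 0 = bit_symbol (x ! i)" using i by (simp add: scan_def S_def strtape_def)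
    then show "scan (S i) 0 \<noteq> 0" by (simp add: bit_symbol_nz)
    have "strtape 0 (take (Suc i) x) = (strtape 0 (take i x))(int i := bit_symbol (x ! i))"
      using strtape_snoc[of 0 "take i x" "x ! i"] i by (simp add: take_Suc_conv_app_nth)
    then have "(\<lambda>j. upd (if j = 0 then (Some 0, MoveRight) else if j = 2 then (Some (scan (S i) 0), MoveRight)
       else (None, Stay)) (S i j)) = S (Suc i)"
      unfolding s0 by (intro ext) (auto simp: S_def bit_symbol_nz fun_eq_iff)
    then show "runs (Act (\<lambda>s j. if j = 0 then (Some 0, MoveRight)
     else if j = 2 then (Some (s 0), MoveRight) else (None, Stay))) 1 (S i) (S (Suc i))"
      using runs_Act[of "\<lambda>s j. if j = 0 then (Some 0, MoveRight)
     else if j = 2 then (Some (s 0), MoveRight) else (None, Stay)" "S i"] by simp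
  qed (use N in \<open>auto simp: scan_def S_def strtape_def\<close>)
  let ?b = "int (length x)"
  have "(S (length x))(2 := (strtape 0 x, 0)) = tapes ?b x y (\<lambda>_. 0) []"
    by (auto simp: S_def tapes_def strtape_def fun_eq_iff)
  then have 3: "runs (rewind 2) (2 * N + 6) (S (length x)) (tapes ?b x y (\<lambda>_. 0) [])"
    using runs_rewind[of "S (length x)" 2 0 x] N by (auto simp: S_def elim: runs_mono)
  let ?s = "sem g x y (\<lambda>_. 0)"
  have "good (\<lambda>_. 5) 6 None (\<lambda>_. 0)" by (auto simp: good_def)
  from compile_gen_correct[OF this, where N = N and x = x and y = y and b = ?b and g = g and out = "[]"] N
  have 4: "runs (compile_gen g (\<lambda>_. 5) 6 None) (time_bound g N) (tapes ?b x y (\<lambda>_. 0) []) (tapes ?b x y (\<lambda>_. 0) ?s)"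
    by (simp add: emit_pos_def emit_out_def)
  have len: "length ?s \<le> size_bound g N" by (rule length_sem_le) (use N in auto)
  let ?\<tau> = "(tapes ?b x y (\<lambda>_. 0) ?s)(0 := (strtape ?b ?s, ?b))"
  have 5: "runs (rewind 0) (2 * size_bound g N + 6) (tapes ?b x y (\<lambda>_. 0) ?s) ?\<tau>"
    using runs_rewind[of "tapes ?b x y (\<lambda>_. 0) ?s" 0 ?b ?s] len by (auto simp: tapes_def elim: runs_mono)
  have "runs (prog g) (6 * N + time_bound g N + 2 * size_bound g N + 23) (start x y) ?\<tau>"
    unfolding prog_def
    by (rule runs_Seq[OF 1 runs_Seq[OF 2 runs_Seq[OF 3 runs_Seq[OF 4 5 lessI] lessI] lessI]]) simp
  then show ?thesis by (intro exI[of _ ?\<tau>]) simp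
qed

lemma halted_steps: "halted M c \<Longrightarrow> (step M ^^ k) c = c"
  by (induction k) (auto simp: halted_def step_def)

theorem gen_poly_time:
  "\<exists>M q. machine_wf M \<and> 2 \<le> ntapes M \<and>
     (\<forall>x y. computes_within M [x, y] (poly q (length x + length y)) (sem g x y (\<lambda>_. 0)))"
proof -
  obtain n0 where "bounded n0 (prog g)" using bounded_prog by blast
  then have n: "bounded (max n0 2) (prog g)" using bounded_mono by simp
  define n where "n = max n0 2"
  obtain M where M: "machine_wf M" "ntapes M = n"
    "\<And>t \<tau> \<tau>'. (cfg_step ^^ t) ([prog g], \<tau>) = ([], \<tau>') \<Longrightarrow>
       \<exists>q. (step M ^^ t) (0, map \<tau> [0..<n]) = (q, map \<tau>' [0..<n]) \<and> halted M (q, map \<tau>' [0..<n])"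
    by (rule compile[of n "prog g"]) (use n in \<open>simp add: n_def\<close>, simp add: n_def, rule that)
  have "poly_bounded (\<lambda>N. 6 * N + time_bound g N + 2 * size_bound g N + 23)"
    by (intro poly_bounded_intros poly_bounded_time_bound poly_bounded_size_bound)
  then obtain q where q: "\<And>N. 6 * N + time_bound g N + 2 * size_bound g N + 23 \<le> poly q N" unfolding poly_bounded_def by blast
  have "computes_within M [x, y] (poly q (length x + length y)) (sem g x y (\<lambda>_. 0))" for x y
  proof -
    let ?s = "sem g x y (\<lambda>_. 0)"
    have "map input_tape ([x, y] @ replicate (n - 2) []) = map (start x y) [0..<n]"
      by (rule nth_equalityI) (auto simp: start_def n_def nth_append nth_Cons')
    then have init: "init_config M [x, y] = (0, map (start x y) [0..<n])"
      by (simp add: init_config_def M(2) numeral_2_eq_2)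
    obtain \<tau> t where t: "t \<le> poly q (length x + length y)" "(cfg_step ^^ t) ([prog g], start x y) = ([], \<tau>)"
      and \<tau>: "\<tau> 0 = (strtape (int (length x)) ?s, int (length x))"
      using runs_prog[OF refl, of g x y] q[of "length x + length y"] unfolding runs_def
      by (meson order_trans)
    from M(3)[OF t(2)] obtain c where c: "(step M ^^ t) (0, map (start x y) [0..<n]) = (c, map \<tau> [0..<n])"
      "halted M (c, map \<tau> [0..<n])" by blast
    obtain k where k: "poly q (length x + length y) = k + t" using t(1) by (metis add.commute le_Suc_ex)
    have "(step M ^^ poly q (length x + length y)) (init_config M [x, y]) = (c, map \<tau> [0..<n])"
      unfolding k funpow_add o_apply init c(1) using c(2) by (rule halted_steps)
    moreover have "hd (map \<tau> [0..<n]) = \<tau> 0" by (simp add: n_def hd_map)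
    ultimately show ?thesis
      using c(2) by (simp add: computes_within_def has_output_def \<tau> strtape_def)
  qed
  moreover have "2 \<le> ntapes M" by (simp add: M(2) n_def)
  ultimately show ?thesis using M(1) by blast
qed

lemma poly_time_function_gen:
  assumes "\<And>x. sem g x [] (\<lambda>_. 0) = f x"
  shows "poly_time_function f"
proof -
  obtain M q where M: "machine_wf M" "2 \<le> ntapes M"
    "\<And>x y. computes_within M [x, y] (poly q (length x + length y)) (sem g x y (\<lambda>_. 0))"
    using gen_poly_time[of g] by blast
  \<comment> \<open>A missing second input looks like an empty one: either way the second tape is
    blank.\<close>
  have "init_config M [x] = init_config M [x, []]" for x
  proof -
    have "ntapes M - 1 = Suc (ntapes M - 2)" using M(2) by simp
    then show ?thesis by (simp add: init_config_def numeral_2_eq_2)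
  qed
  then have "computes_within M [x] (poly q (length x)) (f x)" for x
    using M(3)[of x "[]"] by (simp add: computes_within_def assms)
  with M(1) show ?thesis unfolding poly_time_function_def by blast
qed

lemma poly_time_relation_gen:
  assumes "\<And>x y. sem g x y (\<lambda>_. 0) = [R x y]"
  shows "poly_time_relation R"
  using gen_poly_time[of g] unfolding poly_time_relation_def assms by blast

section \<open>Functions defined by bounded loops\<close>

type_synonym ctx = "bool list \<times> bool list \<times> (nat \<Rightarrow> nat)"

definition in1 :: "ctx \<Rightarrow> bool list" where "in1 c = fst c"
definition in2 :: "ctx \<Rightarrow> bool list" where "in2 c = fst (snd c)"
definition arg :: "ctx \<Rightarrow> nat \<Rightarrow> nat" where "arg c = snd (snd c)"
definition pop :: "ctx \<Rightarrow> ctx" where "pop c = (in1 c, in2 c, \<lambda>i. arg c (Suc i))"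

lemma pop_simps: "in1 (pop c) = in1 c" "in2 (pop c) = in2 c" "arg (pop c) i = arg c (Suc i)"
  by (simp_all add: in1_def in2_def arg_def pop_def)

text \<open>
  \<open>lexp\<close>, \<open>nexp\<close> and \<open>bexp\<close> hold of the list-valued, number-valued and Boolean functions of the
  context that the loop language expresses. In the premise for the body of a binder, the
  bound variable is \<open>arg c 0\<close> and the outer context is \<open>pop c\<close>.
\<close>

definition lexp :: "(ctx \<Rightarrow> bool list) \<Rightarrow> bool" where
  "lexp F \<longleftrightarrow> (\<exists>g. \<forall>c. sem g (in1 c) (in2 c) (arg c) = F c)"

definition nexp :: "(ctx \<Rightarrow> nat) \<Rightarrow> bool" where
  "nexp f \<longleftrightarrow> lexp (\<lambda>c. replicate (f c) True)"

definition bexp :: "(ctx \<Rightarrow> bool) \<Rightarrow> bool" where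
  "bexp P \<longleftrightarrow> nexp (\<lambda>c. if P c then 1 else 0)"

section \<open>Closure properties of the expressible functions\<close>

lemma lexpI: "(\<And>x y \<rho>. sem g x y \<rho> = F (x, y, \<rho>)) \<Longrightarrow> lexp F"
  unfolding lexp_def in1_def in2_def arg_def by (metis prod.collapse)

lemma lexpE:
  assumes "lexp F"
  obtains g where "\<And>x y \<rho>. sem g x y \<rho> = F (x, y, \<rho>)"
  using assms unfolding lexp_def in1_def in2_def arg_def by (metis fst_conv snd_conv)

text \<open>Renaming moves a program obtained for one context below further binders; the bound
  variable 0 is kept and the outer ones are renamed.\<close>

primrec ren :: "gen \<Rightarrow> (nat \<Rightarrow> nat) \<Rightarrow> gen" where
  "ren NopG r = NopG"
| "ren (EmitG b) r = EmitG b"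
| "ren (CatG g h) r = CatG (ren g r) (ren h r)"
| "ren (LetG g h) r = LetG (ren g r) (ren h (case_nat 0 (\<lambda>i. Suc (r i))))"
| "ren (LetLen w h) r = LetLen w (ren h (case_nat 0 (\<lambda>i. Suc (r i))))"
| "ren (ForG i h) r = ForG (r i) (ren h (case_nat 0 (\<lambda>i. Suc (r i))))"
| "ren (IfLess i j g h) r = IfLess (r i) (r j) (ren g r) (ren h r)"
| "ren (IfSym w i s g h) r = IfSym w (r i) s (ren g r) (ren h r)"

lemma case_nat_ren:
  "(\<lambda>i. case_nat v \<rho> (case_nat 0 (\<lambda>i. Suc (r i)) i)) = case_nat v (\<lambda>i. \<rho> (r i))"
  by (auto simp: fun_eq_iff split: nat.split)

lemma sem_ren: "sem (ren g r) x y \<rho> = sem g x y (\<lambda>i. \<rho> (r i))"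
  by (induction g arbitrary: r \<rho>) (simp_all add: case_nat_ren)

lemma lexp_pop: "lexp F \<Longrightarrow> lexp (\<lambda>c. F (pop c))"
  by (elim lexpE, rule_tac g = "ren g Suc" in lexpI) (simp add: sem_ren pop_def in1_def in2_def arg_def)

lemma nexp_pop: "nexp f \<Longrightarrow> nexp (\<lambda>c. f (pop c))"
  unfolding nexp_def by (rule lexp_pop)

lemma pop_eq: "pop (x, y, case_nat v \<rho>) = (x, y, \<rho>)" "arg (x, y, case_nat v \<rho>) 0 = v"
  by (simp_all add: pop_def in1_def in2_def arg_def)

text \<open>The bound of \<open>ForG\<close> must be a variable, so \<open>LetG\<close> binds it
  first, and a renaming makes the body skip this additional binder.\<close>

lemma lexp_for:
  assumes "nexp f" "lexp (\<lambda>c. h (pop c) (arg c 0))"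
  shows "lexp (\<lambda>c. concat (map (\<lambda>i. h c i) [0..<f c]))"
proof -
  from assms obtain g1 g2 where g1: "\<And>x y \<rho>. sem g1 x y \<rho> = replicate (f (x, y, \<rho>)) True"
    and g2: "\<And>x y \<rho>. sem g2 x y \<rho> = h (pop (x, y, \<rho>)) (arg (x, y, \<rho>) 0)"
    unfolding nexp_def by (elim lexpE) blast
  have *: "(\<lambda>i. case_nat v (case_nat w \<rho>) (case i of 0 \<Rightarrow> 0 | Suc i \<Rightarrow> Suc (Suc i))) = case_nat v \<rho>" for v w \<rho>
    by (auto simp: fun_eq_iff split: nat.split)
  show ?thesis
    by (rule lexpI[of "LetG g1 (ForG 0 (ren g2 (\<lambda>i. case i of 0 \<Rightarrow> 0 | Suc i \<Rightarrow> Suc (Suc i))))"])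
      (simp add: g1 g2 sem_ren * pop_eq)
qed

lemma concat_replicate_sum: "concat (map (\<lambda>i. replicate (h i) a) [0..<n]) = replicate (\<Sum>i<n. h i) a"
  by (induction n) (auto simp: replicate_add)

lemma nexp_arg: "nexp (\<lambda>c. arg c i)"
  unfolding nexp_def
  by (rule lexpI[of "ForG i (EmitG True)"])
    (use concat_replicate_sum[of "\<lambda>_. 1" True] in \<open>simp add: arg_def\<close>)

lemma nexp_length_in1: "nexp (\<lambda>c. length (in1 c))"
  unfolding nexp_def using concat_replicate_sum[of "\<lambda>_. 1" True]
  by (intro lexpI[of "LetLen False (ForG 0 (EmitG True))"]) (simp add: in1_def)

lemma nexp_length_in2: "nexp (\<lambda>c. length (in2 c))"
  unfolding nexp_def using concat_replicate_sum[of "\<lambda>_. 1" True]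
  by (intro lexpI[of "LetLen True (ForG 0 (EmitG True))"]) (simp add: in2_def)

lemma lexp_Nil: "lexp (\<lambda>_. [])"
  by (rule lexpI[of NopG]) simp

lemma lexp_append:
  assumes "lexp F" "lexp G"
  shows "lexp (\<lambda>c. F c @ G c)"
proof -
  from assms obtain f g where "\<And>x y \<rho>. sem f x y \<rho> = F (x, y, \<rho>)" "\<And>x y \<rho>. sem g x y \<rho> = G (x, y, \<rho>)"
    by (elim lexpE) blast
  then show ?thesis by (intro lexpI[of "CatG f g"]) simp
qed

lemma lexp_Cons: "lexp F \<Longrightarrow> lexp (\<lambda>c. b # F c)"
  using lexp_append[of "\<lambda>_. [b]" F] lexpI[of "EmitG b" "\<lambda>_. [b]"] by simp

lemma nexp_const: "nexp (\<lambda>_. k)"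
  unfolding nexp_def by (induction k) (auto intro: lexp_Nil lexp_Cons)

lemma lexp_if_less:
  assumes "nexp f" "nexp g" "lexp F" "lexp G"
  shows "lexp (\<lambda>c. if f c < g c then F c else G c)"
proof -
  from assms obtain f' g' F' G' where
    e: "\<And>x y \<rho>. sem f' x y \<rho> = replicate (f (x, y, \<rho>)) True" "\<And>x y \<rho>. sem g' x y \<rho> = replicate (g (x, y, \<rho>)) True"
    "\<And>x y \<rho>. sem F' x y \<rho> = F (x, y, \<rho>)" "\<And>x y \<rho>. sem G' x y \<rho> = G (x, y, \<rho>)"
    unfolding nexp_def by (elim lexpE) blast
  show ?thesis
    by (rule lexpI[of "LetG f' (LetG (ren g' Suc) (IfLess 1 0 (ren F' (\<lambda>i. Suc (Suc i))) (ren G' (\<lambda>i. Suc (Suc i)))))"])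
      (simp add: sem_ren e)
qed

lemma lexp_if:
  assumes "bexp P" "lexp F" "lexp G"
  shows "lexp (\<lambda>c. if P c then F c else G c)"
proof -
  have "lexp (\<lambda>c. if 0 < (if P c then 1 else 0 :: nat) then F c else G c)"
    using assms by (intro lexp_if_less nexp_const) (auto simp: bexp_def)
  also have "(\<lambda>c. if 0 < (if P c then 1 else 0 :: nat) then F c else G c) = (\<lambda>c. if P c then F c else G c)"
    by auto
  finally show ?thesis .
qed

lemma nexp_if: "bexp P \<Longrightarrow> nexp f \<Longrightarrow> nexp g \<Longrightarrow> nexp (\<lambda>c. if P c then f c else g c)"
  unfolding nexp_def using lexp_if[of P "\<lambda>c. replicate (f c) True" "\<lambda>c. replicate (g c) True"]
  by (simp add: if_distrib[of "\<lambda>n. replicate n True"])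

lemma bexp_if: "bexp P \<Longrightarrow> bexp Q \<Longrightarrow> bexp R \<Longrightarrow> bexp (\<lambda>c. if P c then Q c else R c)"
  unfolding bexp_def[of "\<lambda>c. if P c then Q c else R c"]
  using nexp_if[of P "\<lambda>c. if Q c then 1 else 0" "\<lambda>c. if R c then 1 else 0"]
  by (simp add: bexp_def if_distrib[of "\<lambda>b. if b then 1 else 0 :: nat"])

lemma bexp_const: "bexp (\<lambda>_. b)"
  unfolding bexp_def by (rule nexp_const)

lemma bexp_not: "bexp P \<Longrightarrow> bexp (\<lambda>c. \<not> P c)"
proof -
  assume "bexp P"
  then have "bexp (\<lambda>c. if P c then False else True)" by (intro bexp_if bexp_const)
  also have "(\<lambda>c. if P c then False else True) = (\<lambda>c. \<not> P c)" by auto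
  finally show ?thesis .
qed

lemma bexp_conj: "bexp P \<Longrightarrow> bexp Q \<Longrightarrow> bexp (\<lambda>c. P c \<and> Q c)"
  using bexp_if[of P Q "\<lambda>_. False"] bexp_const[of False] by (simp add: if_bool_eq_disj)

lemma bexp_disj: "bexp P \<Longrightarrow> bexp Q \<Longrightarrow> bexp (\<lambda>c. P c \<or> Q c)"
  using bexp_not[OF bexp_conj[OF bexp_not bexp_not]] by simp

lemma bexp_imp: "bexp P \<Longrightarrow> bexp Q \<Longrightarrow> bexp (\<lambda>c. P c \<longrightarrow> Q c)"
  using bexp_disj[OF bexp_not, of P Q] by simp

lemma bexp_less: "nexp f \<Longrightarrow> nexp g \<Longrightarrow> bexp (\<lambda>c. f c < g c)"
proof -
  assume "nexp f" "nexp g"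
  then have "lexp (\<lambda>c. if f c < g c then [True] else [])" by (intro lexp_if_less lexp_Cons lexp_Nil)
  also have "(\<lambda>c. if f c < g c then [True] else []) = (\<lambda>c. replicate (if f c < g c then 1 else 0) True)" by auto
  finally show ?thesis unfolding bexp_def nexp_def .
qed

lemma bexp_le: "nexp f \<Longrightarrow> nexp g \<Longrightarrow> bexp (\<lambda>c. f c \<le> g c)"
  using bexp_not[OF bexp_less, of g f] by (simp add: not_less)

lemma bexp_eq: "nexp f \<Longrightarrow> nexp g \<Longrightarrow> bexp (\<lambda>c. f c = g c)"
  using bexp_conj[OF bexp_le bexp_le, of f g g f] by (simp add: eq_iff)

lemma bexp_sym:
  assumes "nexp f"
  shows "bexp (\<lambda>c. sym_at (if w then in2 c else in1 c) (f c) = s)"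
proof -
  from assms obtain f' where f': "\<And>x y \<rho>. sem f' x y \<rho> = replicate (f (x, y, \<rho>)) True"
    unfolding nexp_def by (elim lexpE) blast
  show ?thesis unfolding bexp_def nexp_def
    by (rule lexpI[of "LetG f' (IfSym w 0 s (EmitG True) NopG)"]) (simp add: f' in1_def in2_def)
qed

lemma sym_at_True: "sym_at x i = 2 \<longleftrightarrow> i < length x \<and> x ! i"
  by (cases "x ! i") (auto simp: sym_at_def)

lemma bexp_in1: "nexp f \<Longrightarrow> bexp (\<lambda>c. f c < length (in1 c) \<and> in1 c ! f c)"
  using bexp_sym[of f False 2] by (simp add: sym_at_True)

lemma bexp_in2: "nexp f \<Longrightarrow> bexp (\<lambda>c. f c < length (in2 c) \<and> in2 c ! f c)"
  using bexp_sym[of f True 2] by (simp add: sym_at_True)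

text \<open>In unary, a sum is the concatenation of its summands. Quantifiers, products, differences
  and quotients are then obtained by counting with such sums.\<close>

lemma nexp_sum:
  assumes "nexp f" "nexp (\<lambda>c. h (pop c) (arg c 0))"
  shows "nexp (\<lambda>c. \<Sum>i<f c. h c i)"
  using lexp_for[of f "\<lambda>c i. replicate (h c i) True"] assms unfolding nexp_def[of "\<lambda>c. h (pop c) (arg c 0)"]
  by (simp add: nexp_def[of "\<lambda>c. \<Sum>i<f c. h c i"] concat_replicate_sum)

lemma bexp_ex:
  assumes "nexp f" "bexp (\<lambda>c. P (pop c) (arg c 0))"
  shows "bexp (\<lambda>c. \<exists>i<f c. P c i)"
proof -
  have "bexp (\<lambda>c. 0 < (\<Sum>i<f c. if P c i then 1 else 0 :: nat))"
    using assms by (intro bexp_less nexp_const nexp_sum) (auto simp: bexp_def)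
  also have "(\<lambda>c. 0 < (\<Sum>i<f c. if P c i then 1 else 0 :: nat)) = (\<lambda>c. \<exists>i<f c. P c i)"
    by (auto simp: fun_eq_iff sum_eq_0_iff simp flip: neq0_conv)
  finally show ?thesis .
qed

lemma bexp_all:
  assumes "nexp f" "bexp (\<lambda>c. P (pop c) (arg c 0))"
  shows "bexp (\<lambda>c. \<forall>i<f c. P c i)"
  using bexp_not[OF bexp_ex[OF assms(1), of "\<lambda>c i. \<not> P c i"]] bexp_not[OF assms(2)] by simp

lemma nexp_add: "nexp f \<Longrightarrow> nexp g \<Longrightarrow> nexp (\<lambda>c. f c + g c)"
  unfolding nexp_def using lexp_append[of "\<lambda>c. replicate (f c) True" "\<lambda>c. replicate (g c) True"]
  by (simp add: replicate_add)

lemma nexp_Suc: "nexp f \<Longrightarrow> nexp (\<lambda>c. Suc (f c))"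
  using nexp_add[OF nexp_const[of 1]] by simp

lemma nexp_mult: "nexp f \<Longrightarrow> nexp g \<Longrightarrow> nexp (\<lambda>c. f c * g c)"
  using nexp_sum[of f "\<lambda>c _. g c"] nexp_pop[of g] by simp

lemma nexp_diff:
  assumes "nexp f" "nexp g"
  shows "nexp (\<lambda>c. f c - g c)"
proof -
  have "nexp (\<lambda>c. \<Sum>i<f c. if g c \<le> i then 1 else 0)"
    using assms by (intro nexp_sum nexp_if bexp_le nexp_const nexp_arg) (auto intro: nexp_pop)
  also have "(\<lambda>c. \<Sum>i<f c. if g c \<le> i then 1 else 0) = (\<lambda>c. f c - g c)"
  proof
    fix c
    have "{..<f c} \<inter> {i. g c \<le> i} = {g c..<f c}" by auto
    then show "(\<Sum>i<f c. if g c \<le> i then 1 else 0) = f c - g c" by (simp add: sum.If_cases)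
  qed
  finally show ?thesis .
qed

text \<open>The sum counts the positive multiples of the divisor up to the dividend. A zero divisor
  would have every index counted, hence the separate case.\<close>

lemma nexp_div:
  assumes "nexp f" "nexp g"
  shows "nexp (\<lambda>c. f c div g c)"
proof -
  have "nexp (\<lambda>c. if g c = 0 then 0 else \<Sum>i<f c. if (i + 1) * g c \<le> f c then 1 else 0)"
    using assms by (intro nexp_sum nexp_if bexp_le bexp_eq nexp_const nexp_arg nexp_mult nexp_add) (auto intro: nexp_pop)
  also have "(\<lambda>c. if g c = 0 then 0 else \<Sum>i<f c. if (i + 1) * g c \<le> f c then 1 else 0) = (\<lambda>c. f c div g c)"
  proof
    fix c
    have "{..<f c} \<inter> {i. (i + 1) * g c \<le> f c} = {..<f c div g c}" if "g c \<noteq> 0"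
    proof -
      have "(i + 1) * g c \<le> f c \<longleftrightarrow> i < f c div g c" for i
        using less_eq_div_iff_mult_less_eq[of "g c" "Suc i" "f c"] that by (simp add: Suc_le_eq)
      then have "{..<f c} \<inter> {i. (i + 1) * g c \<le> f c} = {..<f c} \<inter> {..<f c div g c}" by blast
      also have "\<dots> = {..<f c div g c}" by (auto intro: order.strict_trans2[OF _ div_le_dividend])
      finally show ?thesis .
    qed
    then show "(if g c = 0 then 0 else \<Sum>i<f c. if (i + 1) * g c \<le> f c then 1 else 0) = f c div g c"
      by (simp add: sum.If_cases)
  qed
  finally show ?thesis .
qed

lemma nexp_mod: "nexp f \<Longrightarrow> nexp g \<Longrightarrow> nexp (\<lambda>c. f c mod g c)"
  using nexp_diff[OF _ nexp_mult[OF nexp_div], of f f g g]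
  by (simp add: minus_div_mult_eq_mod)

lemma nexp_poly: "nexp f \<Longrightarrow> nexp (\<lambda>c. poly q (f c))"
  by (induction q) (auto intro: nexp_const nexp_add nexp_mult)

text \<open>Serves for data with a constant number of entries, namely the clause schemas of a fixed
  machine: the lookup is unrolled into nested tests.\<close>

lemma nexp_table:
  assumes "nexp f" "\<And>k. k < K \<Longrightarrow> nexp (\<lambda>c. F k c)"
  shows "nexp (\<lambda>c. if f c < K then F (f c) c else 0)"
  using assms(2)
proof (induction K)
  case 0
  then show ?case by (simp add: nexp_const)
next
  case (Suc K)
  have "nexp (\<lambda>c. if f c = K then F K c else if f c < K then F (f c) c else 0)"
    using Suc by (intro nexp_if[OF bexp_eq[OF assms(1) nexp_const]]) auto
  also have "(\<lambda>c. if f c = K then F K c else if f c < K then F (f c) c else 0) =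
     (\<lambda>c. if f c < Suc K then F (f c) c else 0)" by (auto simp: less_Suc_eq)
  finally show ?case .
qed

lemma lexp_replicate: "nexp f \<Longrightarrow> lexp (\<lambda>c. replicate (f c) b)"
  using lexp_for[of f "\<lambda>_ _. [b]"] lexp_Cons[OF lexp_Nil, of b] concat_replicate_sum[of "\<lambda>_. 1" b] by simp

lemma lexp_encode_nat: "nexp f \<Longrightarrow> lexp (\<lambda>c. encode_nat (f c))"
  unfolding encode_nat_def by (intro lexp_append lexp_replicate lexp_Cons lexp_Nil)

lemmas nexp_intros = nexp_const nexp_arg nexp_add nexp_Suc nexp_mult nexp_diff nexp_div nexp_mod nexp_poly
  nexp_length_in1 nexp_length_in2 nexp_sum nexp_if
lemmas bexp_intros = bexp_const bexp_not bexp_conj bexp_disj bexp_imp bexp_less bexp_le bexp_eq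
  bexp_ex bexp_all bexp_if
lemmas lexp_intros = lexp_Nil lexp_append lexp_Cons lexp_for lexp_if lexp_replicate lexp_encode_nat
lemmas exp_intros = nexp_intros bexp_intros lexp_intros

lemma poly_time_function_lexp:
  assumes "lexp (\<lambda>c. f (in1 c))"
  shows "poly_time_function f"
proof -
  from assms obtain g where "\<And>x y \<rho>. sem g x y \<rho> = f (in1 (x, y, \<rho>))" by (elim lexpE) blast
  then show ?thesis by (intro poly_time_function_gen[of g]) (simp add: in1_def)
qed

lemma poly_time_relation_bexp:
  assumes "bexp (\<lambda>c. R (in1 c) (in2 c))"
  shows "poly_time_relation R"
proof -
  have "lexp (\<lambda>c. if R (in1 c) (in2 c) then [True] else [False])"
    by (intro lexp_intros assms)
  also have "(\<lambda>c. if R (in1 c) (in2 c) then [True] else [False]) = (\<lambda>c. [R (in1 c) (in2 c)])" by auto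
  finally obtain g where "\<And>x y \<rho>. sem g x y \<rho> = [R (in1 (x, y, \<rho>)) (in2 (x, y, \<rho>))]" by (elim lexpE) blast
  then show ?thesis by (intro poly_time_relation_gen[of g]) (simp add: in1_def in2_def)
qed

section \<open>Membership in NP\<close>

definition top_score :: "nat \<Rightarrow> 'a list list \<Rightarrow> 'a \<Rightarrow> nat" where
  "top_score k us d = length (filter (\<lambda>v. d \<in> set (take k v)) us)"

lemma position_le_iff:
  assumes "distinct v" "d \<in> set v"
  shows "position (order_of_list v) d \<le> k \<longleftrightarrow> d \<in> set (take k v)"
proof -
  obtain i where i: "i < length v" "d = v ! i" using assms(2) by (auto simp: in_set_conv_nth)
  have "v ! i \<in> set (take k v) \<longleftrightarrow> i < k"
    using assms(1) i(1) by (auto simp: in_set_conv_nth nth_eq_iff_index_eq)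
  then show ?thesis using position_order_of_list[OF assms(1) i(1)] i(2) by auto
qed

lemma conformant_manipulation_lists:
  assumes "\<forall>v \<in> set vs. distinct v \<and> set v = {..<m}" "p < m"
  shows "conformant_manipulation k {..<m} (map order_of_list vs) n p \<longleftrightarrow>
    (\<exists>ws. length ws = n \<and> set ws \<subseteq> set vs \<and> (\<forall>d<m. top_score k (vs @ ws) d \<le> top_score k (vs @ ws) p))"
proof -
  have score: "approval_score k (map order_of_list us) d = top_score k us d"
    if "set us \<subseteq> set vs" "d < m" for us d
  proof -
    have "filter (\<lambda>v. position (order_of_list v) d \<le> k) us = filter (\<lambda>v. d \<in> set (take k v)) us"
      by (rule filter_cong) (use that assms(1) in \<open>auto simp: position_le_iff\<close>)
    then show ?thesis by (simp add: approval_score_def top_score_def filter_map o_def)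
  qed
  have win: "p \<in> approval_winners k {..<m} (map order_of_list vs @ map order_of_list ws) \<longleftrightarrow>
      (\<forall>d<m. top_score k (vs @ ws) d \<le> top_score k (vs @ ws) p)" if "set ws \<subseteq> set vs" for ws
    using score[of "vs @ ws"] that assms(2) by (auto simp: approval_winners_def)
  have "set W \<subseteq> set (map order_of_list vs) \<longleftrightarrow> (\<exists>ws. W = map order_of_list ws \<and> set ws \<subseteq> set vs)" for W
    using lists_image[of order_of_list "set vs"] by (auto simp: in_lists_conv_set subset_eq image_iff set_eq_iff)
  then show ?thesis unfolding conformant_manipulation_def
    using win by (metis length_map)
qed

subsection \<open>Decoding\<close>

definition tick :: "bool list \<Rightarrow> nat \<Rightarrow> bool" where
  "tick x i \<longleftrightarrow> i < length x \<and> x ! i"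

definition falses :: "bool list \<Rightarrow> nat" where
  "falses x = (\<Sum>i<length x. if tick x i then 0 else 1)"

text \<open>The length of the \<open>k\<close>-th block of \<open>True\<close>s, counted from 0,
  where blocks are separated by single \<open>False\<close>s: it counts the \<open>True\<close>s
  preceded by exactly \<open>k\<close> \<open>False\<close>s, and so is a nested sum that the loop
  language can evaluate.\<close>

definition gap :: "bool list \<Rightarrow> nat \<Rightarrow> nat" where
  "gap x k = (\<Sum>i<length x. if tick x i \<and> (\<Sum>j<i. if tick x j then 0 else 1) = k then 1 else 0)"

definition unary :: "nat list \<Rightarrow> bool list" where
  "unary gs = concat (map encode_nat gs)"

lemma tick_Cons [simp]: "tick (a # x) 0 = a" "tick (a # x) (Suc i) = tick x i"
  by (simp_all add: tick_def)

lemma falses_simps [simp]: "falses [] = 0" "falses (True # x) = falses x" "falses (False # x) = Suc (falses x)"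
  unfolding falses_def by (simp_all add: sum.lessThan_Suc_shift del: sum.lessThan_Suc)

lemma gap_simps [simp]:
  "gap [] k = 0" "gap (True # x) 0 = Suc (gap x 0)" "gap (True # x) (Suc k) = gap x (Suc k)"
  "gap (False # x) 0 = 0" "gap (False # x) (Suc k) = gap x k"
  unfolding gap_def by (simp_all add: sum.lessThan_Suc_shift del: sum.lessThan_Suc sum_eq_0_iff)

lemma unary_simps [simp]: "unary [] = []" "unary (0 # gs) = False # unary gs" "unary (Suc g # gs) = True # unary (g # gs)"
  "unary (gs @ hs) = unary gs @ unary hs"
  by (simp_all add: unary_def encode_nat_def)

lemma gap_encode_nat: "gap (encode_nat a @ x) k = (case k of 0 \<Rightarrow> a | Suc l \<Rightarrow> gap x l)"
proof (induction a arbitrary: k)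
  case 0
  then show ?case by (cases k) (simp_all add: encode_nat_def)
next
  case (Suc a)
  then show ?case by (cases k) (simp_all add: encode_nat_def)
qed

lemma gap_unary: "k < length gs \<Longrightarrow> gap (unary gs) k = gs ! k"
proof (induction gs arbitrary: k)
  case (Cons a gs)
  have "unary (a # gs) = encode_nat a @ unary gs" by (simp add: unary_def)
  then show ?case using Cons by (cases k) (simp_all add: gap_encode_nat)
qed simp

lemma falses_unary [simp]: "falses (unary gs) = length gs"
proof (induction gs)
  case (Cons a gs)
  then show ?case by (induction a) simp_all
qed simp

lemma length_unary: "length (unary gs) = sum_list (map Suc gs)"
  by (induction gs) (auto simp: unary_def encode_nat_def)

lemma ex_unary: "x = [] \<or> \<not> last x \<Longrightarrow> \<exists>gs. x = unary gs"
proof (induction x)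
  case (Cons a x)
  show ?case
  proof (cases a)
    case False
    from Cons obtain gs where "x = unary gs" by (auto split: if_splits)
    with False have "a # x = unary (0 # gs)" by simp
    then show ?thesis by blast
  next
    case True
    with Cons have "x \<noteq> []" "\<exists>gs. x = unary gs" by (auto split: if_splits)
    then obtain g gs where "x = unary (g # gs)" by (metis list.exhaust unary_simps(1))
    with True have "a # x = unary (Suc g # gs)" by simp
    then show ?thesis by blast
  qed
qed (auto intro: exI[of _ "[]"])

text \<open>Block lengths determine a word that does not end inside a block. This turns parsing into
  arithmetic on \<open>gap\<close>.\<close>

lemma unary_gap: "x = [] \<or> \<not> last x \<Longrightarrow> x = unary (map (gap x) [0..<falses x])"
proof -
  assume "x = [] \<or> \<not> last x"
  then obtain gs where gs: "x = unary gs" using ex_unary by blast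
  have "map (gap x) [0..<falses x] = gs" by (rule nth_equalityI) (simp_all add: gs gap_unary)
  then show ?thesis using gs by simp
qed

text \<open>\<open>encode_list\<close> puts a \<open>True\<close> in front of every entry, which
  lengthens the block of a candidate by 1. The first candidate also absorbs the \<open>True\<close>
  that the outer list puts in front of the vote, hence 2. The final 0 is the \<open>False\<close>
  that ends the vote.\<close>

definition vote_gaps :: "nat list \<Rightarrow> nat list" where
  "vote_gaps v = map (\<lambda>j. v ! j + (if j = 0 then 2 else 1)) [0..<length v] @ [0]"

lemma length_vote_gaps [simp]: "length (vote_gaps v) = Suc (length v)"
  by (simp add: vote_gaps_def)

lemma unary_vote:
  assumes "v \<noteq> []"
  shows "True # encode_list encode_nat v = unary (vote_gaps v)"
proof -
  obtain a r where v: "v = a # r" using assms by (cases v) auto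
  have "encode_list encode_nat s = unary (map Suc s @ [0])" for s
    by (induction s) (simp_all add: encode_list_def unary_def encode_nat_def)
  moreover have "vote_gaps v = Suc (Suc a) # map Suc r @ [0]"
    unfolding vote_gaps_def v by (rule nth_equalityI) (auto simp: nth_Cons' nth_append)
  ultimately show ?thesis by (simp add: v) (simp add: unary_def encode_nat_def)
qed

lemma unary_instance:
  assumes "\<forall>v\<in>set vs. v \<noteq> []"
  shows "encode_instance m vs n p = unary (m # concat (map vote_gaps vs) @ [0, n, p])"
proof -
  have "concat (map (\<lambda>v. True # encode_list encode_nat v) vs) = unary (concat (map vote_gaps vs))"
    using assms by (induction vs) (simp_all add: unary_vote)
  then show ?thesis
    by (simp add: encode_instance_def encode_list_def[of "encode_list encode_nat"])
       (simp add: unary_def encode_nat_def)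
qed

lemma length_concat_uniform: "\<forall>l\<in>set ls. length l = B \<Longrightarrow> length (concat ls) = length ls * B"
  by (induction ls) auto

lemma nth_concat_uniform:
  "\<forall>l\<in>set ls. length l = B \<Longrightarrow> i < length ls \<Longrightarrow> j < B \<Longrightarrow> concat ls ! (i * B + j) = ls ! i ! j"
proof (induction ls arbitrary: i)
  case (Cons l ls)
  then show ?case by (cases i) (auto simp: nth_append)
qed simp

lemma map_upt_mult: "map f [0..<n * B] = concat (map (\<lambda>i. map (\<lambda>j. f (i * B + j)) [0..<B]) [0..<n])"
proof (induction n)
  case (Suc n)
  have "map f [0..<Suc n * B] = map f [0..<n * B] @ map f [n * B..<n * B + B]"
    using upt_add_eq_append[of 0 "n * B" B] by (simp add: add.commute)
  also have "map f [n * B..<n * B + B] = map (\<lambda>j. f (n * B + j)) [0..<B]"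
    by (rule nth_equalityI) auto
  finally show ?case using Suc by simp
qed simp

lemma map_upt_4: "map f [0..<n + 4] = f 0 # map (\<lambda>k. f (1 + k)) [0..<n] @ [f (n + 1), f (n + 2), f (n + 3)]"
proof -
  have "[0..<n + 4] = 0 # map Suc [0..<n + 3]" by (simp add: upt_conv_Cons map_Suc_upt add.commute)
  moreover have "[0..<n + 3] = [0..<n] @ [n, n + 1, n + 2]" by (simp add: numeral_3_eq_3)
  ultimately show ?thesis by (simp add: numeral_3_eq_3)
qed

definition cands_of :: "bool list \<Rightarrow> nat" where
  "cands_of x = gap x 0"

text \<open>Four blocks do not belong to votes: the number of candidates, the empty block that ends
  the list of votes, the number of manipulators and the preferred candidate. A vote has one block
  per candidate and an empty one.\<close>

definition votes_of :: "bool list \<Rightarrow> nat" where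
  "votes_of x = (falses x - 4) div (cands_of x + 1)"

definition entry :: "bool list \<Rightarrow> nat \<Rightarrow> nat \<Rightarrow> nat" where
  "entry x i j = gap x (1 + (i * (cands_of x + 1) + j))"

definition cand :: "bool list \<Rightarrow> nat \<Rightarrow> nat \<Rightarrow> nat" where
  "cand x i j = entry x i j - (if j = 0 then 2 else 1)"

definition manips_of :: "bool list \<Rightarrow> nat" where
  "manips_of x = gap x (falses x - 2)"

definition pref_of :: "bool list \<Rightarrow> nat" where
  "pref_of x = gap x (falses x - 1)"

text \<open>Well-formedness in terms of blocks. The equation between \<open>entry\<close> and
  \<open>cand\<close> says that the truncated subtraction in \<open>cand\<close> loses nothing, that
  is, the \<open>True\<close>s inserted by the list code are really there.\<close>

definition instance_ok :: "bool list \<Rightarrow> bool" where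
  "instance_ok x \<longleftrightarrow> 0 < length x \<and> \<not> tick x (length x - 1) \<and> pref_of x < cands_of x
     \<and> falses x = votes_of x * (cands_of x + 1) + 4 \<and> gap x (votes_of x * (cands_of x + 1) + 1) = 0
     \<and> (\<forall>i<votes_of x. entry x i (cands_of x) = 0 \<and>
          (\<forall>j<cands_of x. entry x i j = cand x i j + (if j = 0 then 2 else 1) \<and> cand x i j < cands_of x
             \<and> (\<forall>l<j. cand x i l \<noteq> cand x i j)))"

definition vote_lists :: "bool list \<Rightarrow> nat list list" where
  "vote_lists x = map (\<lambda>i. map (cand x i) [0..<cands_of x]) [0..<votes_of x]"

lemma decode_instance:
  assumes "\<forall>v\<in>set vs. distinct v \<and> set v = {..<m}" "p < m" "x = encode_instance m vs n p"
  shows "instance_ok x" "cands_of x = m" "vote_lists x = vs" "manips_of x = n" "pref_of x = p"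
    "votes_of x \<le> length x" "manips_of x \<le> length x"
proof -
  have len: "length v = m" if "v \<in> set vs" for v
    using assms(1) that distinct_card[of v] by simp
  define gs where "gs = m # concat (map vote_gaps vs) @ [0, n, p]"
  have x: "x = unary gs" unfolding assms(3) gs_def
    by (rule unary_instance) (use len assms(2) in fastforce)
  have lc: "length (concat (map vote_gaps vs)) = length vs * Suc m"
    using length_concat_uniform[of "map vote_gaps vs" "Suc m"] len by simp
  then have lg: "length gs = length vs * Suc m + 4" by (simp add: gs_def)
  have f: "falses x = length vs * Suc m + 4" by (simp add: x lg)
  show c: "cands_of x = m" by (simp add: cands_of_def x gap_unary lg) (simp add: gs_def)
  have v: "votes_of x = length vs" by (simp add: votes_of_def f c del: mult_Suc_right)
  have g: "gap x k = gs ! k" if "k < length vs * Suc m + 4" for k using that lg by (simp add: x gap_unary)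
  show n: "manips_of x = n" and p: "pref_of x = p"
    using g[of "falses x - 2"] g[of "falses x - 1"] lc
    by (simp_all add: manips_of_def pref_of_def f gs_def nth_append nth_Cons')
  have e: "entry x i j = vote_gaps (vs ! i) ! j" if "i < length vs" "j \<le> m" for i j
  proof -
    have "i * Suc m + j < length vs * Suc m"
    proof -
      have "Suc i * Suc m \<le> length vs * Suc m" using that by (intro mult_right_mono) auto
      then show ?thesis using that by simp
    qed
    then show ?thesis
      using g[of "Suc (i * Suc m + j)"] nth_concat_uniform[of "map vote_gaps vs" "Suc m" i j] that len lc
      by (simp add: entry_def c gs_def nth_append)
  qed
  have e': "cand x i j = vs ! i ! j" "entry x i j = cand x i j + (if j = 0 then 2 else 1)" if "i < length vs" "j < m" for i j
    using e[of i j] that len[of "vs ! i"] by (simp_all add: cand_def vote_gaps_def nth_append)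
  show vl: "vote_lists x = vs"
    by (rule nth_equalityI) (auto simp: vote_lists_def v c e' len intro!: nth_equalityI)
  show "instance_ok x"
    unfolding instance_ok_def c v p f
  proof (intro conjI allI impI)
    have "x \<noteq> []" "\<not> last x"
      by (simp_all add: x gs_def unary_def encode_nat_def)
    then show "0 < length x" "\<not> tick x (length x - 1)" by (auto simp: tick_def last_conv_nth)
    show "gap x (length vs * (m + 1) + 1) = 0" using g[of "length vs * (m + 1) + 1"] lc
      by (simp add: gs_def nth_append)
    fix i assume i: "i < length vs"
    show "entry x i m = 0" using e[OF i, of m] len[of "vs ! i"] i by (simp add: vote_gaps_def nth_append)
    fix j assume j: "j < m"
    show "entry x i j = cand x i j + (if j = 0 then 2 else 1)" using e' i j by blast
    have d: "distinct (vs ! i)" "set (vs ! i) = {..<m}" "length (vs ! i) = m" using assms(1) i len by auto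
    then show "cand x i j < m" using e'(1)[OF i j] j nth_mem by fastforce
    fix l assume "l < j"
    then show "cand x i l \<noteq> cand x i j" using e'(1)[OF i j] e'(1)[OF i, of l] j d by (simp add: nth_eq_iff_index_eq)
  qed (use assms(2) in simp_all)
  have "g' < length x" if "g' \<in> set gs" for g'
    using member_le_sum_list[of "Suc g'" "map Suc gs"] that by (auto simp: x length_unary)
  then show "manips_of x \<le> length x" unfolding n by (simp add: gs_def less_imp_le)
  have "length hs \<le> sum_list (map Suc hs)" for hs by (induction hs) auto
  from this[of gs] have "length vs * Suc m + 4 \<le> length x" by (simp add: x length_unary lg)
  moreover have "length vs \<le> length vs * Suc m" by simp
  ultimately show "votes_of x \<le> length x" unfolding v by linarith
qed

text \<open>The checks determine every block length, and these determine \<open>x\<close>. A decoded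
  vote is a permutation because \<open>cands_of x\<close> distinct numbers below
  \<open>cands_of x\<close> exhaust them.\<close>

lemma instance_okD:
  assumes "instance_ok x"
  shows "\<forall>v\<in>set (vote_lists x). distinct v \<and> set v = {..<cands_of x}" "pref_of x < cands_of x"
    "x = encode_instance (cands_of x) (vote_lists x) (manips_of x) (pref_of x)"
proof -
  let ?m = "cands_of x" and ?v = "votes_of x"
  note ok = assms[unfolded instance_ok_def]
  have ne: "x \<noteq> []" "\<not> last x" using ok by (auto simp: tick_def last_conv_nth)
  show p: "pref_of x < ?m" using ok by blast
  have c: "cand x i j < ?m" "\<And>l. l < j \<Longrightarrow> cand x i l \<noteq> cand x i j" "entry x i ?m = 0"
     "entry x i j = cand x i j + (if j = 0 then 2 else 1)" if "i < ?v" "j < ?m" for i j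
    using ok that by blast+
  show "\<forall>v\<in>set (vote_lists x). distinct v \<and> set v = {..<?m}"
  proof
    fix v assume "v \<in> set (vote_lists x)"
    then obtain i where i: "i < ?v" "v = map (cand x i) [0..<?m]" by (auto simp: vote_lists_def)
    have "inj_on (cand x i) {..<?m}"
      by (rule inj_onI) (metis c(2)[OF i(1)] lessThan_iff linorder_neqE_nat)
    then have d: "distinct v" by (simp add: i(2) distinct_map atLeast0LessThan)
    moreover have "set v \<subseteq> {..<?m}" using c(1)[OF i(1)] by (auto simp: i(2))
    moreover have "card (set v) = ?m" using distinct_card[OF d] by (simp add: i(2))
    ultimately show "distinct v \<and> set v = {..<?m}" using card_subset_eq[of "{..<?m}" "set v"] by simp
  qed
  have f: "falses x = ?v * (?m + 1) + 4" using ok by blast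
  have "map (\<lambda>k. gap x (1 + k)) [0..<?v * (?m + 1)] = concat (map vote_gaps (vote_lists x))"
    unfolding map_upt_mult vote_lists_def map_map o_def
  proof (intro arg_cong[where f = concat] map_cong refl)
    fix i assume "i \<in> set [0..<?v]"
    then have i: "i < ?v" by simp
    have "map (\<lambda>j. gap x (1 + (i * (?m + 1) + j))) [0..<?m + 1] = map (entry x i) [0..<?m] @ [entry x i ?m]"
      by (simp add: entry_def)
    also have "\<dots> = vote_gaps (map (cand x i) [0..<?m])"
      using c(3,4)[OF i] p by (auto simp: vote_gaps_def intro: map_cong)
    finally show "map (\<lambda>j. gap x (1 + (i * (?m + 1) + j))) [0..<?m + 1] = vote_gaps (map (cand x i) [0..<?m])" .
  qed
  moreover have "map (gap x) [0..<falses x] = gap x 0 # map (\<lambda>k. gap x (1 + k)) [0..<?v * (?m + 1)]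
     @ [gap x (?v * (?m + 1) + 1), gap x (?v * (?m + 1) + 2), gap x (?v * (?m + 1) + 3)]"
    unfolding f by (rule map_upt_4)
  moreover have "gap x (?v * (?m + 1) + 1) = 0" using ok by blast
  moreover have "gap x (?v * (?m + 1) + 2) = manips_of x" "gap x (?v * (?m + 1) + 3) = pref_of x"
    by (simp_all add: manips_of_def pref_of_def f add.commute)
  ultimately have "map (gap x) [0..<falses x] = ?m # concat (map vote_gaps (vote_lists x)) @ [0, manips_of x, pref_of x]"
    by (simp add: cands_of_def)
  then have "x = unary (?m # concat (map vote_gaps (vote_lists x)) @ [0, manips_of x, pref_of x])"
    using unary_gap[of x] ne by simp
  also have "\<dots> = encode_instance ?m (vote_lists x) (manips_of x) (pref_of x)"
    by (rule unary_instance[symmetric]) (use p in \<open>auto simp: vote_lists_def\<close>)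
  finally show "x = encode_instance ?m (vote_lists x) (manips_of x) (pref_of x)" .
qed

subsection \<open>The verifier\<close>

definition in_top :: "bool list \<Rightarrow> nat \<Rightarrow> nat \<Rightarrow> bool" where
  "in_top x i d \<longleftrightarrow> (\<exists>j<4. j < cands_of x \<and> cand x i j = d)"

definition cert_score :: "bool list \<Rightarrow> bool list \<Rightarrow> nat \<Rightarrow> nat" where
  "cert_score x y d = (\<Sum>i<votes_of x. if in_top x i d then 1 else 0)
     + (\<Sum>j<manips_of x. if in_top x (gap y j) d then 1 else 0)"

text \<open>The certificate lists, in unary, the index of the vote copied by each manipulator.\<close>

definition verifier :: "bool list \<Rightarrow> bool list \<Rightarrow> bool" where
  "verifier x y \<longleftrightarrow> instance_ok x \<and> (\<forall>j<manips_of x. gap y j < votes_of x)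
     \<and> (\<forall>d<cands_of x. cert_score x y d \<le> cert_score x y (pref_of x))"

lemma length_filter_upt: "length (filter P (map h [0..<n])) = (\<Sum>i<n. if P (h i) then 1 else 0)"
  by (induction n) auto

lemma cert_score_eq:
  assumes "\<forall>j<manips_of x. gap y j < votes_of x"
  shows "cert_score x y d =
     top_score 4 (vote_lists x @ map (\<lambda>j. vote_lists x ! gap y j) [0..<manips_of x]) d"
proof -
  let ?h = "\<lambda>i. map (cand x i) [0..<cands_of x]"
  have "set (take 4 [0..<m]) = {j. j < 4 \<and> j < m}" for m :: nat
    by (cases "4 \<le> m") (auto simp: take_upt)
  then have top: "d \<in> set (take 4 (?h i)) \<longleftrightarrow> in_top x i d" for i
    by (auto simp: in_top_def take_map)
  have *: "map (\<lambda>j. vote_lists x ! gap y j) [0..<manips_of x] = map (\<lambda>j. ?h (gap y j)) [0..<manips_of x]"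
    using assms by (auto simp: vote_lists_def)
  show ?thesis
    unfolding * unfolding top_score_def filter_append length_append vote_lists_def length_filter_upt top
    by (simp add: cert_score_def)
qed

lemma acm_iff_verifier:
  "x \<in> approval_conformant_manipulation 4 \<longleftrightarrow> (\<exists>y. length y \<le> length x * length x \<and> verifier x y)"
proof
  assume "x \<in> approval_conformant_manipulation 4"
  then obtain m vs n p where x: "x = encode_instance m vs n p"
    and vs: "\<forall>v\<in>set vs. distinct v \<and> set v = {..<m}" "p < m"
    and "conformant_manipulation 4 {..<m} (map order_of_list vs) n p"
    unfolding approval_conformant_manipulation_def by blast
  then obtain ws where ws: "length ws = n" "set ws \<subseteq> set vs"
    "\<forall>d<m. top_score 4 (vs @ ws) d \<le> top_score 4 (vs @ ws) p"
    using conformant_manipulation_lists by blast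
  note d = decode_instance[OF vs x]
  have "\<forall>w\<in>set ws. \<exists>i<length vs. vs ! i = w" using ws(2) by (meson in_set_conv_nth subsetD)
  then obtain idx where idx: "\<forall>w\<in>set ws. idx w < length vs \<and> vs ! idx w = w" by metis
  define y where "y = unary (map idx ws)"
  have lv: "votes_of x = length vs" using arg_cong[OF d(3), of length] by (simp add: vote_lists_def)
  have g: "gap y j = idx (ws ! j)" if "j < n" for j using that ws(1) by (simp add: y_def gap_unary)
  have lt: "\<forall>j<manips_of x. gap y j < votes_of x"
    unfolding d(4) lv using g idx ws(1) by (metis nth_mem)
  have "map (\<lambda>j. vs ! gap y j) [0..<n] = ws"
    by (rule nth_equalityI) (use ws(1) g idx in auto)
  then have "verifier x y"
    unfolding verifier_def cert_score_eq[OF lt] using lt d(1) ws(3) by (simp add: d)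
  \<comment> \<open>There are at most \<open>length x\<close> manipulators, and the code of an
    index, including its final \<open>False\<close>, is no longer than the number of votes.\<close>
  moreover have "length y \<le> length x * length x"
  proof -
    have "sum_list (map Suc (map idx us)) \<le> length us * length vs" if "set us \<subseteq> set ws" for us
      using that by (induction us) (use idx in \<open>auto simp: Suc_le_eq intro!: add_mono\<close>)
    from this[of ws] have "length y \<le> n * length vs" by (simp add: y_def length_unary ws(1))
    also have "\<dots> \<le> length x * length x" using d(4,6,7) lv by (intro mult_mono) auto
    finally show ?thesis .
  qed
  ultimately show "\<exists>y. length y \<le> length x * length x \<and> verifier x y" by blast
next
  assume "\<exists>y. length y \<le> length x * length x \<and> verifier x y"
  then obtain y where "verifier x y" by blast
  then have ok: "instance_ok x" and lt: "\<forall>j<manips_of x. gap y j < votes_of x"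
    and s: "\<forall>d<cands_of x. cert_score x y d \<le> cert_score x y (pref_of x)"
    unfolding verifier_def by auto
  note i = instance_okD[OF ok]
  have "conformant_manipulation 4 {..<cands_of x} (map order_of_list (vote_lists x)) (manips_of x) (pref_of x)"
    unfolding conformant_manipulation_lists[OF i(1,2)]
    by (rule exI[of _ "map (\<lambda>j. vote_lists x ! gap y j) [0..<manips_of x]"])
       (use s[unfolded cert_score_eq[OF lt]] lt in \<open>auto simp: vote_lists_def\<close>)
  with i show "x \<in> approval_conformant_manipulation 4"
    unfolding approval_conformant_manipulation_def by blast
qed

lemma bexp_tick:
  assumes "nexp f"
  shows "bexp (\<lambda>c. tick (in1 c) (f c))" "bexp (\<lambda>c. tick (in2 c) (f c))"
  unfolding tick_def by (intro bexp_in1 bexp_in2 assms)+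

lemma nexp_falses: "nexp (\<lambda>c. falses (in1 c))"
  unfolding falses_def by (intro exp_intros bexp_tick | simp only: pop_simps)+

lemma nexp_gap:
  assumes "nexp f"
  shows "nexp (\<lambda>c. gap (in1 c) (f c))" "nexp (\<lambda>c. gap (in2 c) (f c))"
  unfolding gap_def by (intro exp_intros bexp_tick nexp_pop[of f] assms | simp only: pop_simps)+

lemma nexp_cands_of: "nexp (\<lambda>c. cands_of (in1 c))"
  unfolding cands_of_def by (intro exp_intros nexp_gap)

lemma nexp_votes_of: "nexp (\<lambda>c. votes_of (in1 c))"
  unfolding votes_of_def by (intro exp_intros nexp_falses nexp_cands_of)

lemma nexp_manips_of: "nexp (\<lambda>c. manips_of (in1 c))"
  unfolding manips_of_def by (intro exp_intros nexp_gap nexp_falses)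

lemma nexp_pref_of: "nexp (\<lambda>c. pref_of (in1 c))"
  unfolding pref_of_def by (intro exp_intros nexp_gap nexp_falses)

lemma nexp_entry: "nexp f \<Longrightarrow> nexp g \<Longrightarrow> nexp (\<lambda>c. entry (in1 c) (f c) (g c))"
  unfolding entry_def by (intro exp_intros nexp_gap nexp_cands_of)

lemma nexp_cand: "nexp f \<Longrightarrow> nexp g \<Longrightarrow> nexp (\<lambda>c. cand (in1 c) (f c) (g c))"
  unfolding cand_def by (intro exp_intros nexp_entry)

lemma bexp_in_top:
  assumes "nexp f" "nexp g"
  shows "bexp (\<lambda>c. in_top (in1 c) (f c) (g c))"
  unfolding in_top_def
  by (intro exp_intros nexp_cands_of nexp_cand nexp_pop[of f] nexp_pop[of g] assms | simp only: pop_simps)+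

lemma nexp_cert_score:
  assumes "nexp f"
  shows "nexp (\<lambda>c. cert_score (in1 c) (in2 c) (f c))"
  unfolding cert_score_def
  by (intro exp_intros nexp_votes_of nexp_manips_of nexp_gap bexp_in_top nexp_pop[of f] assms | simp only: pop_simps)+

lemma bexp_verifier: "bexp (\<lambda>c. verifier (in1 c) (in2 c))"
  unfolding verifier_def instance_ok_def
  by (intro exp_intros nexp_votes_of nexp_manips_of nexp_gap nexp_cert_score nexp_pref_of nexp_cands_of
    nexp_falses nexp_entry nexp_cand bexp_tick | simp only: pop_simps)+

theorem acm_in_NP: "in_NP (approval_conformant_manipulation 4)"
  unfolding in_NP_def
proof (intro exI conjI allI)
  show "poly_time_relation verifier" by (rule poly_time_relation_bexp[OF bexp_verifier])
  show "x \<in> approval_conformant_manipulation 4 \<longleftrightarrow> (\<exists>y. length y \<le> poly [:0, 0, 1:] (length x) \<and> verifier x y)" for x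
    by (simp add: acm_iff_verifier)
qed

section \<open>From set packing to conformant manipulation\<close>

text \<open>For non-empty lists, distinctness of the concatenation makes the chosen lists pairwise
  disjoint and forbids choosing one of them twice.\<close>

definition packing :: "'a list list \<Rightarrow> nat \<Rightarrow> bool" where
  "packing L n \<longleftrightarrow> (\<exists>Ws. length Ws = n \<and> set Ws \<subseteq> set L \<and> distinct (concat Ws))"

definition occ :: "'a list list \<Rightarrow> 'a \<Rightarrow> nat" where
  "occ L b = length (filter (\<lambda>l. b \<in> set l) L)"

lemma distinct_concat_iff_occ:
  assumes "\<forall>l\<in>set Ws. distinct l"
  shows "distinct (concat Ws) \<longleftrightarrow> (\<forall>b. occ Ws b \<le> 1)"
  using assms
proof (induction Ws)
  case (Cons l Ws)
  have "occ (l # Ws) b \<le> 1 \<longleftrightarrow> occ Ws b \<le> 1 \<and> (b \<in> set l \<longrightarrow> occ Ws b = 0)" for b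
    by (auto simp: occ_def)
  then have "(\<forall>b. occ (l # Ws) b \<le> 1) \<longleftrightarrow> (\<forall>b. occ Ws b \<le> 1) \<and> (\<forall>b\<in>set l. occ Ws b = 0)"
    by blast
  also have "(\<forall>b\<in>set l. occ Ws b = 0) \<longleftrightarrow> set l \<inter> \<Union>(set ` set Ws) = {}"
    by (auto simp: occ_def filter_empty_conv)
  finally show ?case using Cons by auto
qed (simp add: occ_def)

definition ballot :: "nat \<Rightarrow> nat list \<Rightarrow> nat list" where
  "ballot m t = t @ filter (\<lambda>c. c \<notin> set t) [0..<m]"

lemma ballot:
  assumes "distinct t" "set t \<subseteq> {..<m}"
  shows "distinct (ballot m t)" "set (ballot m t) = {..<m}" "length t = 4 \<Longrightarrow> take 4 (ballot m t) = t"
  using assms by (auto simp: ballot_def)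

text \<open>
  Element \<open>b\<close> becomes candidate \<open>4 * b\<close>, and the fillers \<open>4 * b + 1\<close>, \<open>4 * b + 2\<close>, \<open>4 * b + 3\<close> only
  occur in the padding votes of \<open>b\<close>. These raise its score to that of the preferred
  candidate \<open>4 * NE\<close> after a successful manipulation, minus one.
\<close>

definition set_vote :: "nat \<Rightarrow> nat list \<Rightarrow> nat list" where
  "set_vote NE l = ballot (4 * NE + 1) (4 * NE # map ((*) 4) l)"

definition pad_vote :: "nat \<Rightarrow> nat \<Rightarrow> nat list" where
  "pad_vote NE b = ballot (4 * NE + 1) [4 * b, 4 * b + 1, 4 * b + 2, 4 * b + 3]"

definition pads :: "nat list list \<Rightarrow> nat \<Rightarrow> nat \<Rightarrow> nat" where
  "pads L n b = length L + n - 1 - occ L b"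

definition packing_votes :: "nat list list \<Rightarrow> nat \<Rightarrow> nat \<Rightarrow> nat list list" where
  "packing_votes L NE n = map (set_vote NE) L @ concat (map (\<lambda>b. replicate (pads L n b) (pad_vote NE b)) [0..<NE])"

section \<open>Scores in the constructed election\<close>

lemma top_score_append: "top_score k (us @ vs) d = top_score k us d + top_score k vs d"
  by (simp add: top_score_def)

context
  fixes L :: "nat list list" and NE n :: nat
  assumes L: "\<And>l. l \<in> set L \<Longrightarrow> length l = 3 \<and> distinct l \<and> set l \<subseteq> {..<NE}"
    and n: "1 \<le> n"
begin

lemma set_vote:
  assumes "l \<in> set L"
  shows "distinct (set_vote NE l)" "set (set_vote NE l) = {..<4 * NE + 1}"
    "take 4 (set_vote NE l) = 4 * NE # map ((*) 4) l"
proof -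
  have "distinct (4 * NE # map ((*) 4) l)" "set (4 * NE # map ((*) 4) l) \<subseteq> {..<4 * NE + 1}"
    using L[OF assms] by (auto simp: distinct_map inj_on_def)
  from ballot[OF this] show "distinct (set_vote NE l)" "set (set_vote NE l) = {..<4 * NE + 1}"
    "take 4 (set_vote NE l) = 4 * NE # map ((*) 4) l" using L[OF assms] by (auto simp: set_vote_def)
qed

lemma pad_vote:
  assumes "b < NE"
  shows "distinct (pad_vote NE b)" "set (pad_vote NE b) = {..<4 * NE + 1}"
    "take 4 (pad_vote NE b) = [4 * b, 4 * b + 1, 4 * b + 2, 4 * b + 3]"
proof -
  have "distinct [4 * b, 4 * b + 1, 4 * b + 2, 4 * b + 3]" "set [4 * b, 4 * b + 1, 4 * b + 2, 4 * b + 3] \<subseteq> {..<4 * NE + 1}"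
    using assms by auto
  from ballot[OF this] show "distinct (pad_vote NE b)" "set (pad_vote NE b) = {..<4 * NE + 1}"
    "take 4 (pad_vote NE b) = [4 * b, 4 * b + 1, 4 * b + 2, 4 * b + 3]" by (simp_all add: pad_vote_def)
qed

lemma score_sets:
  assumes "set Ws \<subseteq> set L"
  shows "top_score 4 (map (set_vote NE) Ws) (4 * NE) = length Ws"
    "b < NE \<Longrightarrow> top_score 4 (map (set_vote NE) Ws) (4 * b) = occ Ws b"
    "r \<in> {1, 2, 3} \<Longrightarrow> top_score 4 (map (set_vote NE) Ws) (4 * b + r) = 0"
proof -
  have f: "filter (\<lambda>v. d \<in> set (take 4 v)) (map (set_vote NE) Ws) =
      map (set_vote NE) (filter (\<lambda>l. d = 4 * NE \<or> d \<in> (*) 4 ` set l) Ws)" for d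
    unfolding filter_map o_def
    by (rule arg_cong[where f = "map (set_vote NE)"], rule filter_cong[OF refl])
       (use assms in \<open>simp add: set_vote subset_eq\<close>)
  show "top_score 4 (map (set_vote NE) Ws) (4 * NE) = length Ws"
    by (simp add: top_score_def f)
  show "top_score 4 (map (set_vote NE) Ws) (4 * b) = occ Ws b" if "b < NE"
    using that by (simp add: top_score_def f occ_def image_iff)
  have "4 * b + r \<noteq> 4 * c" if "r \<in> {1, 2, 3}" for c using that by (auto; presburger)
  then show "top_score 4 (map (set_vote NE) Ws) (4 * b + r) = 0" if "r \<in> {1, 2, 3}"
    using that by (auto simp: top_score_def f image_iff)
qed

lemma score_pads:
  assumes "b < NE" "r < 4"
  shows "top_score 4 (concat (map (\<lambda>b. replicate (k b) (pad_vote NE b)) [0..<NE])) (4 * b + r) = k b"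
    "top_score 4 (concat (map (\<lambda>b. replicate (k b) (pad_vote NE b)) [0..<NE])) (4 * NE) = 0"
proof -
  have mem: "4 * b + r \<in> set (take 4 (pad_vote NE c)) \<longleftrightarrow> c = b" "4 * NE \<notin> set (take 4 (pad_vote NE c))" if "c < NE" for c
  proof -
    have "4 * b + r = 4 * c \<or> 4 * b + r = 4 * c + 1 \<or> 4 * b + r = 4 * c + 2 \<or> 4 * b + r = 4 * c + 3 \<longleftrightarrow> c = b"
      using assms(2) by presburger
    then show "4 * b + r \<in> set (take 4 (pad_vote NE c)) \<longleftrightarrow> c = b" by (simp add: pad_vote(3)[OF that])
    show "4 * NE \<notin> set (take 4 (pad_vote NE c))"
      using that unfolding pad_vote(3)[OF that] set_simps insert_iff empty_iff by presburger
  qed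
  have "top_score 4 (concat (map (\<lambda>b. replicate (k b) (pad_vote NE b)) [0..<N])) (4 * b + r) = (if b < N then k b else 0)
    \<and> top_score 4 (concat (map (\<lambda>b. replicate (k b) (pad_vote NE b)) [0..<N])) (4 * NE) = 0" if "N \<le> NE" for N
    using that
  proof (induction N)
    case (Suc N)
    then show ?case using mem[of N] by (auto simp: top_score_append) (auto simp: top_score_def less_Suc_eq)
  qed (simp add: top_score_def)
  from this[of NE] assms(1) show "top_score 4 (concat (map (\<lambda>b. replicate (k b) (pad_vote NE b)) [0..<NE])) (4 * b + r) = k b"
    "top_score 4 (concat (map (\<lambda>b. replicate (k b) (pad_vote NE b)) [0..<NE])) (4 * NE) = 0" by simp_all
qed

text \<open>The subtraction in \<open>pads\<close> is never truncated, because
  \<open>occ L b\<close> is at most \<open>length L\<close> and \<open>n\<close> is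
  positive.\<close>

lemma occ_pads: "occ L b + pads L n b = length L + n - 1"
proof -
  have "occ L b \<le> length L" by (simp add: occ_def)
  then show ?thesis using n by (simp add: pads_def)
qed

lemma score_votes:
  "b < NE \<Longrightarrow> top_score 4 (packing_votes L NE n) (4 * b) = length L + n - 1"
  "b < NE \<Longrightarrow> r \<in> {1, 2, 3} \<Longrightarrow> top_score 4 (packing_votes L NE n) (4 * b + r) \<le> length L + n - 1"
  "0 < NE \<Longrightarrow> top_score 4 (packing_votes L NE n) (4 * NE) = length L"
  using score_sets[of L] score_pads[of b 0] score_pads[of b r] score_pads(2)[of 0 0] occ_pads[of b]
  by (auto simp: packing_votes_def top_score_append)

lemma votes_valid: "\<forall>v \<in> set (packing_votes L NE n). distinct v \<and> set v = {..<4 * NE + 1}"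
  using set_vote pad_vote by (auto simp: packing_votes_def)

theorem packing_iff_manipulation:
  assumes NE: "0 < NE"
  shows "conformant_manipulation 4 {..<4 * NE + 1} (map order_of_list (packing_votes L NE n)) n (4 * NE)
    \<longleftrightarrow> packing L n"
proof -
  let ?V = "packing_votes L NE n" and ?p = "4 * NE"
  have "(\<exists>ws. length ws = n \<and> set ws \<subseteq> set ?V \<and> (\<forall>d<4 * NE + 1. top_score 4 (?V @ ws) d \<le> top_score 4 (?V @ ws) ?p))
     \<longleftrightarrow> packing L n"
  proof
    assume "packing L n"
    then obtain Ws where Ws: "length Ws = n" "set Ws \<subseteq> set L" "distinct (concat Ws)" unfolding packing_def by blast
    let ?ws = "map (set_vote NE) Ws"
    have occ1: "occ Ws b \<le> 1" for b
      using distinct_concat_iff_occ[of Ws] Ws(2,3) L by blast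
    have p: "top_score 4 (?V @ ?ws) ?p = length L + n"
      using score_votes(3)[OF NE] score_sets(1)[OF Ws(2)] Ws(1) by (simp add: top_score_append)
    have "top_score 4 (?V @ ?ws) d \<le> length L + n" if d: "d < 4 * NE + 1" for d
    proof (cases "d = ?p")
      case False
      define b r where "b = d div 4" and "r = d mod 4"
      have b: "d = 4 * b + r" "r < 4" "b < NE" using d False by (auto simp: b_def r_def)
      show ?thesis
      proof (cases "r = 0")
        case True
        then show ?thesis using score_votes(1)[OF b(3)] score_sets(2)[OF Ws(2) b(3)] occ1[of b] n b(1)
          by (simp add: top_score_append)
      next
        case False
        then have "r \<in> {1, 2, 3}" using b(2) by auto
        \<comment> \<open>Fillers gain nothing from the manipulators, who copy only set votes
          here.\<close>
        from score_votes(2)[OF b(3) this] score_sets(3)[OF Ws(2) this, of b] show ?thesis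
          by (simp add: top_score_append b(1))
      qed
    qed (simp add: p)
    moreover have "set ?ws \<subseteq> set ?V" using Ws(2) by (auto simp: packing_votes_def)
    ultimately show "\<exists>ws. length ws = n \<and> set ws \<subseteq> set ?V \<and>
        (\<forall>d<4 * NE + 1. top_score 4 (?V @ ws) d \<le> top_score 4 (?V @ ws) ?p)"
      by (intro exI[of _ ?ws]) (simp add: p Ws(1))
  next
    assume "\<exists>ws. length ws = n \<and> set ws \<subseteq> set ?V \<and>
        (\<forall>d<4 * NE + 1. top_score 4 (?V @ ws) d \<le> top_score 4 (?V @ ws) ?p)"
    then obtain ws where ws: "length ws = n" "set ws \<subseteq> set ?V"
      "\<And>d. d < 4 * NE + 1 \<Longrightarrow> top_score 4 (?V @ ws) d \<le> top_score 4 (?V @ ws) ?p" by blast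
    have le: "length L + n - 1 + top_score 4 ws (4 * b) \<le> length L + top_score 4 ws ?p" if "b < NE" for b
      using ws(3)[of "4 * b"] score_votes(1)[OF that] score_votes(3)[OF NE] that by (simp add: top_score_append)
    text \<open>A manipulator who copies a padding vote costs \<open>p\<close> a point and gives one to some element.\<close>
    have "w \<notin> pad_vote NE ` {..<NE}" if "w \<in> set ws" for w
    proof
      assume "w \<in> pad_vote NE ` {..<NE}"
      then obtain b where b: "b < NE" "w = pad_vote NE b" by auto
      obtain us vs where uv: "ws = us @ w # vs" using split_list[OF \<open>w \<in> set ws\<close>] by blast
      have "4 * b \<in> set (take 4 w)" "?p \<notin> set (take 4 w)" using pad_vote(3)[OF b(1)] b by (auto; presburger)+
      then have "1 \<le> top_score 4 ws (4 * b)" "top_score 4 ws ?p \<le> length us + length vs"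
        unfolding uv top_score_def by (auto intro!: add_mono)
      \<comment> \<open>\<open>p\<close> ends with at most \<open>length L + n - 1\<close> points,
        the element \<open>b\<close> with at least \<open>length L + n\<close>.\<close>
      then show False using le[OF b(1)] ws(1) n by (simp add: uv)
    qed
    then have "ws \<in> lists (set_vote NE ` set L)" using ws(2) by (fastforce simp: packing_votes_def)
    then obtain Ws where Ws: "ws = map (set_vote NE) Ws" "set Ws \<subseteq> set L" by (auto simp: lists_image in_lists_conv_set)
    have "occ Ws b \<le> 1" for b
    proof (cases "b < NE")
      case True
      then show ?thesis using le[OF True] score_sets(1)[OF Ws(2)] score_sets(2)[OF Ws(2) True] ws(1) n
        by (simp add: Ws(1))
    next
      case False
      then have "filter (\<lambda>l. b \<in> set l) Ws = []" using Ws(2) L by (fastforce simp: filter_empty_conv)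
      then show ?thesis by (simp add: occ_def)
    qed
    then have "distinct (concat Ws)" using distinct_concat_iff_occ[of Ws] Ws(2) L by blast
    then show "packing L n" unfolding packing_def using Ws ws(1) by (auto intro!: exI[of _ Ws])
  qed
  then show ?thesis using conformant_manipulation_lists[OF votes_valid, of ?p 4 n] by simp
qed

end

section \<open>From satisfiability to set packing\<close>

text \<open>
  A formula is given by its literals: the \<open>l\<close>-th literal of clause \<open>c\<close> is \<open>lit c l\<close>, where
  \<open>2 * v\<close> and \<open>2 * v + 1\<close> are the negative and the positive literal of the variable \<open>v\<close>.
\<close>

definition satisfiable :: "(nat \<Rightarrow> nat \<Rightarrow> nat) \<Rightarrow> nat \<Rightarrow> nat \<Rightarrow> bool" where
  "satisfiable lit NC W \<longleftrightarrow> (\<exists>\<alpha>. \<forall>c<NC. \<exists>l<W. \<alpha> (lit c l div 2) = odd (lit c l))"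

text \<open>
  Variable \<open>v\<close> has a wheel of \<open>NC\<close> copies, one for each clause \<open>c\<close>, and the set \<open>wheel NC v c s\<close>
  states that copy \<open>c\<close> has the value \<open>s\<close>. Its first element forces a choice of \<open>s\<close>, the second
  one blocks the value 0 in copy \<open>c + 1\<close> if copy \<open>c\<close> has the value 1, and the third one is
  needed by clause \<open>c\<close> to use the literal that this choice falsifies.
\<close>

definition code :: "nat \<Rightarrow> nat \<Rightarrow> nat \<Rightarrow> nat \<Rightarrow> nat" where
  "code NC v c f = 4 * (v * NC + c) + f"

definition wheel :: "nat \<Rightarrow> nat \<Rightarrow> nat \<Rightarrow> nat \<Rightarrow> nat list" where
  "wheel NC v c s = [code NC v c 0, code NC v ((c + s) mod NC) 1, code NC v c (3 - s)]"

text \<open>The first two elements are private to the clause; the first forces the choice of a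
  literal and the second fills up the triple. The third belongs to copy \<open>c\<close> of the
  variable: field 2 for its negative and field 3 for its positive literal.\<close>

definition clause_set :: "nat \<Rightarrow> nat \<Rightarrow> nat \<Rightarrow> nat \<Rightarrow> nat list" where
  "clause_set NV NC c k = [4 * NV * NC + 2 * c, 4 * NV * NC + 2 * c + 1, code NC (k div 2) c (2 + k mod 2)]"

definition sat_sets :: "(nat \<Rightarrow> nat \<Rightarrow> nat) \<Rightarrow> nat \<Rightarrow> nat \<Rightarrow> nat \<Rightarrow> nat list list" where
  "sat_sets lit NV NC W =
     concat (map (\<lambda>v. concat (map (\<lambda>c. map (\<lambda>s. wheel NC v c s) [0..<2]) [0..<NC])) [0..<NV])
     @ concat (map (\<lambda>c. map (\<lambda>l. clause_set NV NC c (lit c l)) [0..<W]) [0..<NC])"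

section \<open>Coding of the elements\<close>

lemma code_inject:
  assumes "c < NC" "c' < NC" "f < 4" "f' < 4"
  shows "code NC v c f = code NC v' c' f' \<longleftrightarrow> v = v' \<and> c = c' \<and> f = f'"
proof
  assume eq: "code NC v c f = code NC v' c' f'"
  have "4 * i + f = 4 * j + f' \<Longrightarrow> f = f' \<and> i = j" for i j using assms(3,4) by presburger
  with eq have f: "f = f'" and *: "v * NC + c = v' * NC + c'" unfolding code_def by blast+
  from * have "(v * NC + c) mod NC = (v' * NC + c') mod NC" "(v * NC + c) div NC = (v' * NC + c') div NC" by simp_all
  with assms f show "v = v' \<and> c = c' \<and> f = f'" by simp
qed simp

lemma code_less:
  assumes "v < NV" "c < NC" "f < 4"
  shows "code NC v c f < 4 * NV * NC"
proof -
  have "v * NC + c < Suc v * NC" using assms(2) by simp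
  also have "\<dots> \<le> NV * NC" using assms(1) by (intro mult_right_mono) auto
  finally show ?thesis using assms(3) by (simp add: code_def)
qed

context
  fixes lit :: "nat \<Rightarrow> nat \<Rightarrow> nat" and NV NC W :: nat
  assumes lit: "\<And>c l. c < NC \<Longrightarrow> l < W \<Longrightarrow> lit c l < 2 * NV"
begin

lemma set_sat_sets:
  "set (sat_sets lit NV NC W) = {wheel NC v c s | v c s. v < NV \<and> c < NC \<and> s < 2} \<union>
     {clause_set NV NC c (lit c l) | c l. c < NC \<and> l < W}"
  unfolding sat_sets_def by (auto simp: atLeast0LessThan)+

lemma sat_sets_wf:
  assumes "l \<in> set (sat_sets lit NV NC W)"
  shows "length l = 3 \<and> distinct l \<and> set l \<subseteq> {..<4 * NV * NC + 2 * NC}"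
proof -
  from assms consider (w) v c s where "l = wheel NC v c s" "v < NV" "c < NC" "s < 2"
    | (c) c i where "l = clause_set NV NC c (lit c i)" "c < NC" "i < W" unfolding set_sat_sets by blast
  then show ?thesis
  proof cases
    case w
    have "set l \<subseteq> {..<4 * NV * NC}" using w by (auto simp: wheel_def intro!: code_less)
    moreover have "distinct l" using w by (auto simp: wheel_def code_inject)
    ultimately show ?thesis using w(1) by (auto simp: wheel_def)
  next
    case c
    have "code NC (lit c i div 2) c (2 + lit c i mod 2) < 4 * NV * NC"
      using lit[OF c(2,3)] c by (intro code_less) auto
    then show ?thesis using c by (auto simp: clause_set_def)
  qed
qed

lemma distinct_concat_map:
  assumes "distinct xs" "\<And>x. x \<in> set xs \<Longrightarrow> distinct (f x)"
    "\<And>x y. x \<in> set xs \<Longrightarrow> y \<in> set xs \<Longrightarrow> x \<noteq> y \<Longrightarrow> set (f x) \<inter> set (f y) = {}"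
  shows "distinct (concat (map f xs))"
  using assms
proof (induction xs)
  case (Cons a xs)
  have "set (f a) \<inter> set (f y) = {}" if "y \<in> set xs" for y
    using Cons.prems(1) that by (intro Cons.prems(3)) auto
  moreover have "distinct (concat (map f xs))" using Cons by (intro Cons.IH) auto
  ultimately show ?case using Cons.prems(2) by auto
qed simp

text \<open>All copies of a variable take its value, and each clause picks a literal that is true.
  Wheel triples of one variable shift their links by the same amount, so they stay disjoint, and the
  field of a true literal is the one that the wheel has left free.\<close>

lemma packing_if_satisfiable:
  assumes "satisfiable lit NC W"
  shows "packing (sat_sets lit NV NC W) (NV * NC + NC)"
proof -
  obtain \<alpha> where "\<forall>c<NC. \<exists>l<W. \<alpha> (lit c l div 2) = odd (lit c l)"
    using assms unfolding satisfiable_def by blast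
  then obtain pick where pick: "\<And>c. c < NC \<Longrightarrow> pick c < W \<and> \<alpha> (lit c (pick c) div 2) = odd (lit c (pick c))"
    by metis
  define k where "k c = lit c (pick c)" for c
  have k: "k c < 2 * NV" "\<alpha> (k c div 2) = odd (k c)" if "c < NC" for c
    using pick[OF that] lit[OF that] by (simp_all add: k_def)
  define F where "F t = (case t of Inl (v, c) \<Rightarrow> wheel NC v c (of_bool (\<alpha> v)) | Inr c \<Rightarrow> clause_set NV NC c (k c))" for t
  define tags where "tags = map Inl (List.product [0..<NV] [0..<NC]) @ map Inr [0..<NC]"
  have tags: "set tags = Inl ` ({..<NV} \<times> {..<NC}) \<union> Inr ` {..<NC}"
    by (auto simp: tags_def atLeast0LessThan)
  have sub: "set (map F tags) \<subseteq> set (sat_sets lit NV NC W)"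
    unfolding set_map tags set_sat_sets using pick by (fastforce simp: F_def k_def)
  have "distinct (concat (map F tags))"
  proof (rule distinct_concat_map)
    show "distinct tags" by (auto simp: tags_def distinct_map distinct_product)
    show "distinct (F t)" if "t \<in> set tags" for t
    proof -
      have "F t \<in> set (sat_sets lit NV NC W)" using sub that by auto
      then show ?thesis using sat_sets_wf by blast
    qed
    have WW: "set (F (Inl (v, c))) \<inter> set (F (Inl (v', c'))) = {}"
      if "v < NV" "c < NC" "v' < NV" "c' < NC" "(v, c) \<noteq> (v', c')" for v c v' c'
    proof -
      have "(c + of_bool s) mod NC = (c' + of_bool s) mod NC \<longleftrightarrow> c = c'" for s
        using that by (cases s) (auto simp: mod_Suc)
      then show ?thesis using that by (auto simp: F_def wheel_def code_inject)
    qed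
    have WC: "set (F (Inl (v, c))) \<inter> set (F (Inr c')) = {}" if "v < NV" "c < NC" "c' < NC" for v c c'
    proof -
      have "set (F (Inl (v, c))) \<subseteq> {..<4 * NV * NC}" using that by (auto simp: F_def wheel_def intro!: code_less)
      moreover have "code NC (k c' div 2) c' (2 + k c' mod 2) \<notin> set (F (Inl (v, c)))"
        using that k(2)[OF that(3)] by (auto simp: F_def wheel_def code_inject odd_iff_mod_2_eq_one)
      ultimately show ?thesis by (auto simp: F_def clause_set_def)
    qed
    have CC: "set (F (Inr c)) \<inter> set (F (Inr c')) = {}" if "c < NC" "c' < NC" "c \<noteq> c'" for c c'
    proof -
      have "code NC (k d div 2) d (2 + k d mod 2) < 4 * NV * NC" if "d < NC" for d
        using k(1)[OF that] that by (intro code_less) auto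
      from this[OF that(1)] this[OF that(2)] show ?thesis
        using that by (auto simp: F_def clause_set_def code_inject; presburger)
    qed
    fix t t' assume "t \<in> set tags" "t' \<in> set tags" "t \<noteq> t'"
    then show "set (F t) \<inter> set (F t') = {}"
      unfolding tags disjoint_iff
      using WW[unfolded disjoint_iff] WC[unfolded disjoint_iff] CC[unfolded disjoint_iff] by fast
  qed
  moreover have "length (map F tags) = NV * NC + NC" by (simp add: tags_def)
  ultimately show ?thesis unfolding packing_def using sub by blast
qed

lemma distinct_concat_share:
  assumes "distinct (concat Ws)" "l \<in> set Ws" "l' \<in> set Ws" "b \<in> set l" "b \<in> set l'"
  shows "l = l'"
  using assms by (induction Ws) auto

text \<open>Counting drives the proof: the first elements of disjoint triples are distinct and lie
  in a set no larger than the number of triples, so all of them occur. Hence every copy has a value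
  and every clause a literal.\<close>

lemma satisfiable_if_packing:
  assumes "packing (sat_sets lit NV NC W) (NV * NC + NC)"
  shows "satisfiable lit NC W"
proof -
  obtain Ws where Ws: "length Ws = NV * NC + NC" "set Ws \<subseteq> set (sat_sets lit NV NC W)" "distinct (concat Ws)"
    using assms unfolding packing_def by blast
  note share = distinct_concat_share[OF Ws(3)]
  define E where "E = (\<lambda>(v, c). code NC v c 0) ` ({..<NV} \<times> {..<NC}) \<union> (\<lambda>c. 4 * NV * NC + 2 * c) ` {..<NC}"
  have "card E \<le> card ({..<NV} \<times> {..<NC}) + card {..<NC}"
    unfolding E_def by (rule order_trans[OF card_Un_le]) (intro add_mono card_image_le; simp)
  then have cardE: "card E \<le> NV * NC + NC" "finite E" by (auto simp: card_cartesian_product E_def)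
  have hd: "hd ` set Ws \<subseteq> E"
    using Ws(2) unfolding set_sat_sets E_def by (fastforce simp: wheel_def clause_set_def)
  have ne: "l \<noteq> []" if "l \<in> set Ws" for l using Ws(2) that sat_sets_wf[of l] by auto
  have "distinct (map hd Ws)"
    using Ws(3) ne by (induction Ws) (auto, metis disjoint_iff hd_in_set UN_I)
  then have "card (hd ` set Ws) = NV * NC + NC" using Ws(1) distinct_card by fastforce
  then have E: "hd ` set Ws = E" using hd cardE by (metis card_seteq)
  have W: "wheel NC v c 0 \<in> set Ws \<or> wheel NC v c 1 \<in> set Ws" if "v < NV" "c < NC" for v c
  proof -
    have "code NC v c 0 \<in> hd ` set Ws" unfolding E E_def using that by auto
    then obtain l where l: "l \<in> set Ws" "hd l = code NC v c 0" by auto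
    then consider (w) v' c' s where "l = wheel NC v' c' s" "v' < NV" "c' < NC" "s < 2"
      | (c) c' i where "l = clause_set NV NC c' (lit c' i)" using Ws(2) unfolding set_sat_sets by blast
    then show ?thesis
    proof cases
      case w
      then have "v = v'" "c = c'" using l(2) that by (auto simp: wheel_def code_inject)
      moreover have "s = 0 \<or> s = 1" using w by auto
      ultimately show ?thesis using w l by auto
    next
      case c
      then show ?thesis using l(2) code_less[OF that, of 0] by (simp add: clause_set_def)
    qed
  qed
  have excl: "wheel NC v ((c + 1) mod NC) 0 \<notin> set Ws" if "v < NV" "c < NC" "wheel NC v c 1 \<in> set Ws" for v c
  proof
    assume "wheel NC v ((c + 1) mod NC) 0 \<in> set Ws"
    then have "wheel NC v c 1 = wheel NC v ((c + 1) mod NC) 0"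
      by (rule share[OF that(3), of _ "code NC v ((c + 1) mod NC) 1"]) (simp_all add: wheel_def)
    then show False using that by (simp add: wheel_def code_inject)
  qed
  \<comment> \<open>The value 1 in one copy blocks 0 in the next one, which must therefore have 1 as
    well.\<close>
  have rot: "wheel NC v ((c + i) mod NC) 1 \<in> set Ws" if "v < NV" "c < NC" "wheel NC v c 1 \<in> set Ws" for v c i
  proof (induction i)
    case (Suc i)
    have lt: "(c + i) mod NC < NC" "((c + i) mod NC + 1) mod NC < NC" using that(2) by simp_all
    have "((c + i) mod NC + 1) mod NC = (c + Suc i) mod NC" by (simp add: mod_Suc_eq)
    then show ?case using W[OF that(1) lt(2)] excl[OF that(1) lt(1) Suc.IH] by auto
  qed (use that in simp)
  \<comment> \<open>Copy 0 may be taken as the value of the variable: as the wheel is closed, a 1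
    anywhere reaches all copies.\<close>
  define \<alpha> where "\<alpha> v \<longleftrightarrow> wheel NC v 0 1 \<in> set Ws" for v
  have \<alpha>: "wheel NC v c (of_bool (\<alpha> v)) \<in> set Ws" if "v < NV" "c < NC" for v c
  proof (cases "\<alpha> v")
    case True
    then show ?thesis using rot[of v 0 c] that by (simp add: \<alpha>_def)
  next
    case False
    \<comment> \<open>After \<open>NC - c\<close> steps from copy \<open>c\<close> the wheel is back
      at copy 0.\<close>
    then have "wheel NC v c 1 \<notin> set Ws" using rot[of v c "NC - c"] that by (auto simp: \<alpha>_def)
    then show ?thesis using W[OF that] False by simp
  qed
  have "\<exists>l<W. \<alpha> (lit c l div 2) = odd (lit c l)" if c: "c < NC" for c
  proof -
    have "4 * NV * NC + 2 * c \<in> hd ` set Ws" unfolding E E_def using c by auto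
    then obtain l where l: "l \<in> set Ws" "hd l = 4 * NV * NC + 2 * c" by auto
    then consider (w) v' c' s where "l = wheel NC v' c' s" "v' < NV" "c' < NC" "s < 2"
      | (c) c' i where "l = clause_set NV NC c' (lit c' i)" "i < W" using Ws(2) unfolding set_sat_sets by blast
    then show ?thesis
    proof cases
      case w
      then show ?thesis using l(2) code_less[of v' NV c' NC 0] by (simp add: wheel_def)
    next
      case (c c' i)
      then have [simp]: "c' = c" using l(2) by (simp add: clause_set_def)
      let ?k = "lit c i"
      let ?w = "wheel NC (?k div 2) c (of_bool (\<alpha> (?k div 2)))"
      have v: "?k div 2 < NV" using lit[OF \<open>c < NC\<close> c(2)] by auto
      have "\<alpha> (?k div 2) = odd ?k"
      proof (rule ccontr)
        assume "\<alpha> (?k div 2) \<noteq> odd ?k"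
        \<comment> \<open>The wheel triple of a falsifying value contains the element needed by the
          clause triple. Disjointness would make the two equal, but their first elements lie in
          different ranges.\<close>
        then have "3 - of_bool (\<alpha> (?k div 2)) = 2 + ?k mod 2" by (auto simp: odd_iff_mod_2_eq_one)
        then have "?w = l"
          by (intro share[OF \<alpha>[OF v \<open>c < NC\<close>] l(1), of "code NC (?k div 2) c (2 + ?k mod 2)"])
            (simp_all add: wheel_def c(1) clause_set_def)
        then show False using code_less[OF v \<open>c < NC\<close>, of 0] l(2) by (auto simp: wheel_def)
      qed
      with c show ?thesis by blast
    qed
  qed
  then show ?thesis unfolding satisfiable_def by blast
qed

end

section \<open>From Turing machines to satisfiability\<close>

text \<open>
  Cells are addressed relative to the head, so that a move shifts a whole tape and every clause
  concerns the cell under the head and at most one other cell. The variable \<open>var M h t i a\<close>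
  says at time \<open>t\<close>, for \<open>a = sym_kind M k s\<close>, that the cell \<open>i - (h + 1)\<close> to the right of
  the head of tape \<open>k\<close> holds \<open>s\<close>, and for \<open>a = state_kind M q\<close>, that the state is \<open>q\<close>.
\<close>

definition sym_kind :: "machine \<Rightarrow> nat \<Rightarrow> nat \<Rightarrow> nat" where
  "sym_kind M k s = k * nsyms M + s"

definition state_kind :: "machine \<Rightarrow> nat \<Rightarrow> nat" where
  "state_kind M q = ntapes M * nsyms M + q"

definition kinds :: "machine \<Rightarrow> nat" where
  "kinds M = ntapes M * nsyms M + nstates M"

text \<open>A layer has \<open>2 * h + 3\<close> positions, the head being at \<open>h + 1\<close>.
  Clauses are centred at \<open>j + 1\<close> for \<open>j\<close> at most \<open>2 * h\<close>,
  which leaves a margin of one on each side for the shift caused by a move.\<close>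

definition var :: "machine \<Rightarrow> nat \<Rightarrow> nat \<Rightarrow> nat \<Rightarrow> nat \<Rightarrow> nat" where
  "var M h t i a = (t * (2 * h + 3) + i) * kinds M + a"

text \<open>Halting becomes a transition that changes nothing, so the clauses treat halted
  configurations like all others.\<close>

definition effect :: "machine \<Rightarrow> nat \<Rightarrow> nat list \<Rightarrow> nat \<times> (nat \<times> move) list" where
  "effect M q ss = (case trans_fun M q ss of None \<Rightarrow> (q, map (\<lambda>s. (s, Stay)) ss) | Some r \<Rightarrow> r)"

text \<open>A cell at position \<open>j + 1\<close> is found at \<open>j + offset d\<close> after
  the head has made the move \<open>d\<close>: the tape shifts against the head.\<close>

fun offset :: "move \<Rightarrow> nat" where
  "offset MoveLeft = 2"
| "offset Stay = 1"
| "offset MoveRight = 0"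

text \<open>
  A literal schema consists of the sign, the time offset, whether it refers to the generic cell
  (or else to the cell under the head), the offset of the position, and the kind. The flag of
  a clause schema exempts the cell under the head.
\<close>

type_synonym lit_schema = "nat \<times> nat \<times> bool \<times> nat \<times> nat"

definition body :: "machine \<Rightarrow> nat \<Rightarrow> nat list \<Rightarrow> lit_schema list" where
  "body M q ss = (0, 0, False, 1, state_kind M q) #
     map (\<lambda>k. (0, 0, False, 1, sym_kind M k (ss ! k))) [0..<ntapes M]"

text \<open>Every rule is an implication from facts to a fact, written as a clause. A satisfying
  assignment therefore makes all facts of the run true within the window. It may make further facts
  true, which only triggers more implications: acceptance is stated by excluding the rejecting
  symbol.\<close>

definition rule_schemas :: "machine \<Rightarrow> nat \<Rightarrow> nat list \<Rightarrow> (bool \<times> lit_schema list) list" where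
  "rule_schemas M q ss = (let (q', as) = effect M q ss in
     (False, body M q ss @ [(1, 1, False, 1, state_kind M q')])
     # map (\<lambda>k. (False, body M q ss @ [(1, 1, False, offset (snd (as ! k)), sym_kind M k (fst (as ! k)))])) [0..<ntapes M]
     @ concat (map (\<lambda>k. map (\<lambda>s. (True, body M q ss @ [(0, 0, True, 1, sym_kind M k s),
          (1, 1, True, offset (snd (as ! k)), sym_kind M k s)])) [0..<nsyms M]) [0..<ntapes M]))"

definition schemas :: "machine \<Rightarrow> (bool \<times> lit_schema list) list" where
  "schemas M = concat (map (\<lambda>q. concat (map (rule_schemas M q) (List.n_lists (ntapes M) [0..<nsyms M]))) [0..<nstates M])"

fun schema_lit :: "machine \<Rightarrow> nat \<Rightarrow> nat \<Rightarrow> nat \<Rightarrow> lit_schema \<Rightarrow> nat" where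
  "schema_lit M h t j (sg, dt, md, sft, a) = 2 * var M h (t + dt) ((if md then j else h) + sft) a + sg"

text \<open>
  The clauses on the initial configuration guess the certificate (on the second tape) as a word of
  length at most \<open>p\<close>; the one with \<open>r = 1\<close> excludes the rejecting output.
\<close>

definition init_lit :: "machine \<Rightarrow> bool list \<Rightarrow> nat \<Rightarrow> nat \<Rightarrow> nat \<Rightarrow> nat \<Rightarrow> nat \<Rightarrow> nat \<Rightarrow> nat" where
  "init_lit M x T p h j r l =
     (if r = 0 then 2 * var M h 0 (h + 1) (state_kind M 0) + 1
      else if r = 1 then 2 * var M h T (h + 1) (sym_kind M 0 1)
      else if r = 2 then 2 * var M h 0 (j + 1) (sym_kind M 0 (if h \<le> j \<and> j - h < length x then if tick x (j - h) then 2 else 1 else 0)) + 1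
      else if r = 3 then 2 * var M h 0 (j + 1) (sym_kind M 1 (if h \<le> j \<and> j < h + p then if l = 0 then 1 else if l = 1 then 2 else 0 else 0)) + 1
      else if r = 4 then (if l = 0 then 2 * var M h 0 (j + 1) (sym_kind M 1 0)
         else 2 * var M h 0 (j + 1 + (if h \<le> j then 1 else 0)) (sym_kind M 1 0) + 1)
      else 2 * var M h 0 (j + 1) (sym_kind M (r - 3) 0) + 1)"

text \<open>The initial clauses are numbered by \<open>r\<close> below \<open>ntapes M + 3\<close>:
  the values 0 to 4 have individual meanings, and from 5 on \<open>r\<close> blanks tape
  \<open>r - 3\<close>, that is, the tapes from 2 on.\<close>

definition schema_count :: "machine \<Rightarrow> nat" where
  "schema_count M = length (schemas M) + ntapes M + 3"

text \<open>Short clauses are brought to the common width by repeating their literals cyclically. An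
  exempted clause gets the literals 0 and 1 of variable 0, of which one is true.\<close>

definition tableau_lit :: "machine \<Rightarrow> bool list \<Rightarrow> nat \<Rightarrow> nat \<Rightarrow> nat \<Rightarrow> nat \<Rightarrow> nat \<Rightarrow> nat \<Rightarrow> nat \<Rightarrow> nat" where
  "tableau_lit M x T p h t j z l =
     (if z < length (schemas M) then
        (if fst (schemas M ! z) \<and> j = h then l mod 2
         else schema_lit M h t j (snd (schemas M ! z) ! (l mod length (snd (schemas M ! z)))))
      else init_lit M x T p h j (z - length (schemas M)) l)"

text \<open>A clause number is read in mixed radix as time, position and schema. The half-width
  \<open>T + p\<close> suffices for both needs: the trusted part of the window shrinks by one cell
  per step for \<open>T\<close> steps, and the certificate with a blank behind it must fit.\<close>

definition lit_of :: "machine \<Rightarrow> bool list \<Rightarrow> nat \<Rightarrow> nat \<Rightarrow> nat \<Rightarrow> nat \<Rightarrow> nat" where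
  "lit_of M x T p c l =
     tableau_lit M x T p (T + p) (c div schema_count M div (2 * (T + p) + 1))
       (c div schema_count M mod (2 * (T + p) + 1)) (c mod schema_count M) l"

definition clause_count :: "machine \<Rightarrow> nat \<Rightarrow> nat \<Rightarrow> nat" where
  "clause_count M T p = (T + 1) * (2 * (T + p) + 1) * schema_count M"

text \<open>There are \<open>T + 2\<close> layers, since the transition clauses at time
  \<open>T\<close> mention time \<open>T + 1\<close>.\<close>

definition var_count :: "machine \<Rightarrow> nat \<Rightarrow> nat \<Rightarrow> nat" where
  "var_count M T p = (T + 2) * (2 * (T + p) + 3) * kinds M"

lemma mixed_radix_less:
  assumes "t < A" "j < B" "z < (C :: nat)"
  shows "(t * B + j) * C + z < A * B * C"
proof -
  have "t * B + j < Suc t * B" using assms by simp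
  also have "\<dots> \<le> A * B" using assms by (intro mult_right_mono) auto
  finally have "Suc (t * B + j) * C \<le> A * B * C" by (intro mult_right_mono) auto
  moreover have "(t * B + j) * C + z < Suc (t * B + j) * C" using assms by simp
  ultimately show ?thesis by linarith
qed

lemma all_mixed_radix:
  assumes "0 < B" "0 < (C :: nat)"
  shows "(\<forall>c<A * B * C. Q (c div C div B) (c div C mod B) (c mod C)) \<longleftrightarrow> (\<forall>t<A. \<forall>j<B. \<forall>z<C. Q t j z)"
proof safe
  fix t j z assume *: "\<forall>c<A * B * C. Q (c div C div B) (c div C mod B) (c mod C)" "t < A" "j < B" "z < C"
  then have "Q (((t * B + j) * C + z) div C div B) (((t * B + j) * C + z) div C mod B) (((t * B + j) * C + z) mod C)"
    using mixed_radix_less[OF *(2-4)] by blast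
  then show "Q t j z" using * by simp
next
  fix c assume *: "\<forall>t<A. \<forall>j<B. \<forall>z<C. Q t j z" "c < A * B * C"
  then have "c div C < A * B" using assms by (simp add: less_mult_imp_div_less)
  then have "c div C div B < A" by (rule less_mult_imp_div_less)
  then show "Q (c div C div B) (c div C mod B) (c mod C)" using * assms by simp
qed

subsection \<open>Configurations\<close>

definition cell :: "config \<Rightarrow> nat \<Rightarrow> int \<Rightarrow> nat" where
  "cell c k r = fst (snd c ! k) (snd (snd c ! k) + r)"

fun delta :: "move \<Rightarrow> int" where
  "delta MoveLeft = -1"
| "delta Stay = 0"
| "delta MoveRight = 1"

definition wf_config :: "machine \<Rightarrow> config \<Rightarrow> bool" where
  "wf_config M c \<longleftrightarrow> fst c < nstates M \<and> length (snd c) = ntapes M \<and> (\<forall>k<ntapes M. \<forall>i. fst (snd c ! k) i < nsyms M)"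

lemma scanned_eq: "scanned T = fst T (snd T)"
  by (cases T) simp

lemma scanned_cell: "length (snd c) = n \<Longrightarrow> map scanned (snd c) = map (\<lambda>k. cell c k 0) [0..<n]"
  by (rule nth_equalityI) (auto simp: cell_def scanned_eq)

lemma shift_delta: "shift d i = i + delta d"
  by (cases d) auto

lemma effect_wf:
  assumes "machine_wf M" "q < nstates M" "length ss = ntapes M" "set ss \<subseteq> {..<nsyms M}"
  shows "fst (effect M q ss) < nstates M" "length (snd (effect M q ss)) = ntapes M"
    "\<And>k. k < ntapes M \<Longrightarrow> fst (snd (effect M q ss) ! k) < nsyms M"
proof -
  have *: "fst (effect M q ss) < nstates M \<and> length (snd (effect M q ss)) = ntapes M
     \<and> fst ` set (snd (effect M q ss)) \<subseteq> {..<nsyms M}"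
  proof (cases "trans_fun M q ss")
    case None
    then show ?thesis using assms by (auto simp: effect_def)
  next
    case (Some r)
    then show ?thesis using assms unfolding machine_wf_def effect_def by (cases r) simp
  qed
  then show "fst (effect M q ss) < nstates M" "length (snd (effect M q ss)) = ntapes M" by auto
  show "fst (snd (effect M q ss) ! k) < nsyms M" if "k < ntapes M" for k
  proof -
    have "fst (snd (effect M q ss) ! k) \<in> fst ` set (snd (effect M q ss))" using * that by simp
    then show ?thesis using * by blast
  qed
qed

text \<open>Seen from the head, a move shifts the tape: the new cell \<open>r\<close> is the old
  cell \<open>r + delta d\<close>, and only the old cell 0 has been overwritten.\<close>

lemma step_effect:
  assumes M: "machine_wf M" and c: "wf_config M c"
    and e: "effect M (fst c) (map (\<lambda>k. cell c k 0) [0..<ntapes M]) = (q', as)"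
  shows "fst (step M c) = q'" "\<And>k r. k < ntapes M \<Longrightarrow>
      cell (step M c) k r = (if r + delta (snd (as ! k)) = 0 then fst (as ! k) else cell c k (r + delta (snd (as ! k))))"
    "wf_config M (step M c)"
proof -
  let ?ss = "map (\<lambda>k. cell c k 0) [0..<ntapes M]"
  have len: "length (snd c) = ntapes M" and fc: "fst c < nstates M"
    and sy: "\<And>k i. k < ntapes M \<Longrightarrow> fst (snd c ! k) i < nsyms M" using c by (auto simp: wf_config_def)
  have ss: "set ?ss \<subseteq> {..<nsyms M}" using sy by (auto simp: cell_def)
  note wf = effect_wf[OF M fc _ ss, unfolded e, simplified]
  have "map2 act (map (\<lambda>s. (s, Stay)) (map scanned tps)) tps = tps" for tps
    by (induction tps) auto
  moreover have "effect M (fst c) (map scanned (snd c)) = (q', as)" using e scanned_cell[OF len] by simp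
  ultimately have st: "step M c = (q', map2 act as (snd c))"
    by (cases c) (auto simp: step_def effect_def split: option.splits)
  show "fst (step M c) = q'" by (simp add: st)
  have nth: "snd (step M c) ! k = act (as ! k) (snd c ! k)" if "k < ntapes M" for k
    using that wf(2) len by (simp add: st)
  have act: "act a (f, h) = (f(h := fst a), h + delta (snd a))" for a f h
    by (cases a) (simp add: shift_delta)
  show "cell (step M c) k r = (if r + delta (snd (as ! k)) = 0 then fst (as ! k) else cell c k (r + delta (snd (as ! k))))"
    if "k < ntapes M" for k r
    by (cases "snd c ! k") (auto simp: cell_def nth[OF that] act algebra_simps)
  have "fst (snd (step M c) ! k) i < nsyms M" if "k < ntapes M" for k i
    using sy[OF that] wf(3)[OF that] by (cases "snd c ! k") (auto simp: nth[OF that] act)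
  then show "wf_config M (step M c)" using wf(1,2) len by (simp add: wf_config_def st)
qed

lemma wf_init:
  assumes "machine_wf M" "length xs \<le> ntapes M"
  shows "wf_config M (init_config M xs)"
proof -
  have "bit_symbol b < nsyms M" for b using assms by (cases b) (auto simp: machine_wf_def)
  then show ?thesis using assms
    by (auto simp: wf_config_def init_config_def input_tape_def machine_wf_def nth_append)
qed

lemma wf_steps:
  assumes "machine_wf M" "length xs \<le> ntapes M"
  shows "wf_config M ((step M ^^ t) (init_config M xs))"
proof (induction t)
  case 0
  then show ?case using wf_init[OF assms] by simp
next
  case (Suc t)
  then show ?case using step_effect(3)[OF assms(1) Suc] by (simp add: prod_eq_iff)
qed

lemma computes_within_mono:
  assumes "computes_within M xs t y" "t \<le> u"
  shows "computes_within M xs u y"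
proof -
  have "(step M ^^ u) (init_config M xs) = (step M ^^ (u - t)) ((step M ^^ t) (init_config M xs))"
    using assms(2) by (simp flip: funpow_add[THEN fun_cong, unfolded o_apply])
  then show ?thesis using assms(1) halted_steps[of M "(step M ^^ t) (init_config M xs)" "u - t"]
    by (simp add: computes_within_def Let_def)
qed

subsection \<open>Clauses\<close>

lemma set_schemas: "S \<in> set (schemas M) \<longleftrightarrow> (\<exists>q<nstates M. \<exists>ss. length ss = ntapes M \<and> set ss \<subseteq> {..<nsyms M}
    \<and> S \<in> set (rule_schemas M q ss))"
  unfolding schemas_def by (auto simp: set_n_lists atLeast0LessThan)

lemma in_schemas:
  assumes "q < nstates M" "length ss = ntapes M" "set ss \<subseteq> {..<nsyms M}" "effect M q ss = (q', as)"
  shows "(False, body M q ss @ [(1, 1, False, 1, state_kind M q')]) \<in> set (schemas M)"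
    "k < ntapes M \<Longrightarrow> (False, body M q ss @ [(1, 1, False, offset (snd (as ! k)), sym_kind M k (fst (as ! k)))]) \<in> set (schemas M)"
    "k < ntapes M \<Longrightarrow> s < nsyms M \<Longrightarrow> (True, body M q ss @ [(0, 0, True, 1, sym_kind M k s),
       (1, 1, True, offset (snd (as ! k)), sym_kind M k s)]) \<in> set (schemas M)"
  unfolding set_schemas using assms by - (rule exI[of _ q], simp, rule exI[of _ ss], force simp: rule_schemas_def)+

lemma schemasE:
  assumes "S \<in> set (schemas M)"
  obtains q ss q' as R where "q < nstates M" "length ss = ntapes M" "set ss \<subseteq> {..<nsyms M}" "effect M q ss = (q', as)"
    "S = (fst S, body M q ss @ R)"
    "(\<not> fst S \<and> R = [(1, 1, False, 1, state_kind M q')])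
     \<or> (\<exists>k<ntapes M. \<not> fst S \<and> R = [(1, 1, False, offset (snd (as ! k)), sym_kind M k (fst (as ! k)))])
     \<or> (\<exists>k<ntapes M. \<exists>s<nsyms M. fst S \<and> R = [(0, 0, True, 1, sym_kind M k s), (1, 1, True, offset (snd (as ! k)), sym_kind M k s)])"
proof -
  obtain q ss where q: "q < nstates M" "length ss = ntapes M" "set ss \<subseteq> {..<nsyms M}" "S \<in> set (rule_schemas M q ss)"
    using assms unfolding set_schemas by blast
  obtain q' as where e: "effect M q ss = (q', as)" by fastforce
  show thesis
    by (rule that[OF q(1-3) e, of "drop (length (body M q ss)) (snd S)"])
      (use q(4) in \<open>auto simp: rule_schemas_def e\<close>, blast+)
qed

definition lit_true :: "(nat \<Rightarrow> bool) \<Rightarrow> nat \<Rightarrow> bool" where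
  "lit_true \<alpha> k \<longleftrightarrow> \<alpha> (k div 2) = odd k"

lemma lit_true_simps [simp]:
  "lit_true \<alpha> (2 * v) \<longleftrightarrow> \<not> \<alpha> v" "lit_true \<alpha> (Suc (2 * v)) \<longleftrightarrow> \<alpha> v" "lit_true \<alpha> (2 * v + 1) \<longleftrightarrow> \<alpha> v"
  by (simp_all add: lit_true_def)

lemma length_schema: "S \<in> set (schemas M) \<Longrightarrow> snd S \<noteq> [] \<and> length (snd S) \<le> ntapes M + 3"
  by (elim schemasE) (auto simp: body_def)

lemma schema_clause:
  assumes "S = schemas M ! z" "z < length (schemas M)"
  shows "(\<exists>l<ntapes M + 3. lit_true \<alpha> (tableau_lit M x T p h t j z l)) \<longleftrightarrow>
     (fst S \<and> j = h) \<or> (\<exists>s\<in>set (snd S). lit_true \<alpha> (schema_lit M h t j s))"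
proof -
  have "S \<in> set (schemas M)" using assms by simp
  then have len: "0 < length (snd S)" "length (snd S) \<le> ntapes M + 3" using length_schema by auto
  show ?thesis
  proof (cases "fst S \<and> j = h")
    case True
    have "lit_true \<alpha> ((if \<alpha> 0 then 1 else 0) mod 2)" by (simp add: lit_true_def)
    then show ?thesis using True assms
      by (auto simp: tableau_lit_def intro!: exI[of _ "if \<alpha> 0 then 1 else 0"])
  next
    case False
    have "(\<exists>l<ntapes M + 3. lit_true \<alpha> (schema_lit M h t j (snd S ! (l mod length (snd S))))) \<longleftrightarrow>
      (\<exists>i<length (snd S). lit_true \<alpha> (schema_lit M h t j (snd S ! i)))"
    proof
      assume "\<exists>l<ntapes M + 3. lit_true \<alpha> (schema_lit M h t j (snd S ! (l mod length (snd S))))"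
      then show "\<exists>i<length (snd S). lit_true \<alpha> (schema_lit M h t j (snd S ! i))"
        using len(1) by (meson mod_less_divisor)
    next
      assume "\<exists>i<length (snd S). lit_true \<alpha> (schema_lit M h t j (snd S ! i))"
      then obtain i where "i < length (snd S)" "lit_true \<alpha> (schema_lit M h t j (snd S ! i))" by blast
      then show "\<exists>l<ntapes M + 3. lit_true \<alpha> (schema_lit M h t j (snd S ! (l mod length (snd S))))"
        using len by (intro exI[of _ i]) simp
    qed
    moreover have "tableau_lit M x T p h t j z l = schema_lit M h t j (snd S ! (l mod length (snd S)))" for l
      using False assms by (auto simp: tableau_lit_def)
    moreover have "(\<exists>s\<in>set (snd S). lit_true \<alpha> (schema_lit M h t j s)) \<longleftrightarrow>
        (\<exists>i<length (snd S). lit_true \<alpha> (schema_lit M h t j (snd S ! i)))"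
      by (metis in_set_conv_nth)
    ultimately show ?thesis using False by auto
  qed
qed

lemma body_true:
  "(\<forall>s\<in>set (body M q ss). \<not> lit_true \<alpha> (schema_lit M h t j s)) \<longleftrightarrow>
     \<alpha> (var M h t (h + 1) (state_kind M q)) \<and> (\<forall>k<ntapes M. \<alpha> (var M h t (h + 1) (sym_kind M k (ss ! k))))"
  by (auto simp: body_def)

lemma fst_input_tape: "fst (input_tape w) r = (if 0 \<le> r then sym_at w (nat r) else 0)"
  by (auto simp: input_tape_def sym_at_def nat_less_iff)

context
  fixes M :: machine and x :: "bool list" and T p h :: nat
  assumes M: "machine_wf M" and K: "2 \<le> ntapes M" and h: "h = T + p"
begin

definition cfg :: "bool list \<Rightarrow> nat \<Rightarrow> config" where
  "cfg y t = (step M ^^ t) (init_config M [x, y])"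

lemma wf_cfg: "wf_config M (cfg y t)"
  unfolding cfg_def by (rule wf_steps[OF M]) (use K in simp)

lemma cfg_Suc: "cfg y (Suc t) = step M (cfg y t)"
  by (simp add: cfg_def)

lemma cell_init:
  assumes "k < ntapes M"
  shows "cell (cfg y 0) k r = (if r < 0 then 0 else sym_at (if k = 0 then x else if k = 1 then y else []) (nat r))"
proof -
  have "snd (cfg y 0) ! k = input_tape (if k = 0 then x else if k = 1 then y else [])"
    using assms by (auto simp: cfg_def init_config_def nth_append nth_Cons')
  moreover have "snd (input_tape w) = 0" for w by (simp add: input_tape_def)
  ultimately show ?thesis by (simp add: cell_def fst_input_tape)
qed

lemma state_init: "fst (cfg y 0) = 0"
  by (simp add: cfg_def init_config_def)

lemma config_bounds:
  "fst (cfg y t) < nstates M" "k < ntapes M \<Longrightarrow> cell (cfg y t) k r < nsyms M"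
  using wf_cfg[of y t] by (auto simp: wf_config_def cell_def)

lemma verifier_output:
  assumes "computes_within M [x, y] T [b]"
  shows "cell (cfg y T) 0 0 = bit_symbol b"
proof -
  have "snd (cfg y T) \<noteq> []" using wf_cfg[of y T] K by (auto simp: wf_config_def)
  then show ?thesis using assms
    by (cases "snd (cfg y T)") (auto simp: computes_within_def has_output_def cfg_def cell_def Let_def split: prod.splits)
qed

lemma offset_delta: "int (offset d) = 1 - delta d"
  by (cases d) auto

text \<open>The assignment is only shown to contain the facts of the run on the certificate read off
  from it. At time \<open>T\<close> this includes the output symbol, which cannot be the excluded
  one.\<close>

lemma accepting_if_tableau:
  assumes sat: "\<And>t j z. t \<le> T \<Longrightarrow> j < 2 * h + 1 \<Longrightarrow> z < schema_count M \<Longrightarrow>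
      \<exists>l<ntapes M + 3. lit_true \<alpha> (tableau_lit M x T p h t j z l)"
    and R: "\<And>y. length y \<le> p \<Longrightarrow> computes_within M [x, y] T [R y]"
  shows "\<exists>y. length y \<le> p \<and> R y"
proof -
  let ?A = "\<lambda>t i a. \<alpha> (var M h t i a)"
  have K0 [simp]: "0 < ntapes M" using K by simp
  have init: "\<exists>l<ntapes M + 3. lit_true \<alpha> (init_lit M x T p h j r l)" if "j < 2 * h + 1" "r < ntapes M + 3" for j r
    using sat[of 0 j "length (schemas M) + r"] that by (simp add: tableau_lit_def schema_count_def)
  \<comment> \<open>The certificate ends at the first cell marked blank, or after \<open>p\<close>
    cells. Before that cell the clauses with \<open>r = 3\<close> leave only the two bits; behind it
    the clauses with \<open>r = 4\<close> propagate the blank.\<close>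
  define good where "good i \<longleftrightarrow> i = p \<or> ?A 0 (h + 1 + i) (sym_kind M 1 0)" for i
  define len where "len = (LEAST i. good i)"
  have len: "good len" "len \<le> p" unfolding len_def by (rule LeastI[of _ p], simp add: good_def) (rule Least_le, simp add: good_def)
  have nlen: "\<not> good i" if "i < len" for i using that unfolding len_def by (rule not_less_Least)
  define y where "y = map (\<lambda>i. ?A 0 (h + 1 + i) (sym_kind M 1 2)) [0..<len]"
  have y: "length y = len" "\<And>i. i < len \<Longrightarrow> y ! i = ?A 0 (h + 1 + i) (sym_kind M 1 2)" by (simp_all add: y_def)
  have blank: "?A 0 (h + 1 + i) (sym_kind M 1 0)" if "len \<le> i" "i \<le> h" for i
    using that(1,2)
  proof (induction i rule: dec_induct)
    case base
    show ?case
    proof (cases "len = p")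
      case True
      then show ?thesis using init[of "h + p" 3] h K base by (simp add: init_lit_def add.commute add.left_commute)
    next
      case False
      then show ?thesis using len(1) by (simp add: good_def)
    qed
  next
    case (step i)
    then show ?case using init[of "h + i" 4] K by (auto simp: init_lit_def add.commute add.left_commute split: if_splits)
  qed
  \<comment> \<open>Cells at the border of the window have unknown neighbours, so the invariant
    gives up one cell on each side per step. At time \<open>T\<close> the cell under the head is
    still covered since \<open>T\<close> is at most \<open>h\<close>.\<close>
  have inv: "?A t (h + 1) (state_kind M (fst (cfg y t))) \<and>
     (\<forall>k<ntapes M. \<forall>j. t \<le> j \<and> j + t \<le> 2 * h \<longrightarrow> ?A t (j + 1) (sym_kind M k (cell (cfg y t) k (int j - int h))))"
    if "t \<le> T" for t
    using that
  proof (induction t)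
    case 0
    have "?A 0 (j + 1) (sym_kind M k (cell (cfg y 0) k (int j - int h)))" if k: "k < ntapes M" and j: "j \<le> 2 * h" for k j
    proof -
      have j': "j < 2 * h + 1" using j by simp
      consider "k = 0" | "k = 1" "h \<le> j" "j < h + len" | "k = 1" "h \<le> j" "h + len \<le> j" | "k = 1" "j < h" | "2 \<le> k" by linarith
      then show ?thesis
      proof cases
        case 1
        have "cell (cfg y 0) 0 (int j - int h) = (if h \<le> j \<and> j - h < length x then if tick x (j - h) then 2 else 1 else 0)"
          using cell_init[of 0 y "int j - int h"] K
          by (auto simp: sym_at_def tick_def nat_diff_distrib' elim: bit_symbol.elims)
        then show ?thesis using init[OF j', of 2] 1 by (auto simp: init_lit_def)
      next
        case 2
        define i where "i = j - h"
        have i: "j = h + i" "i < len" using 2 by (auto simp: i_def)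
        have c: "cell (cfg y 0) 1 (int j - int h) = (if y ! i then 2 else 1)"
          using cell_init[of 1 y "int j - int h"] K i by (auto simp: sym_at_def y(1) elim: bit_symbol.elims)
        from init[OF j', of 3] obtain l where "lit_true \<alpha> (init_lit M x T p h j 3 l)" by auto
        then have "?A 0 (j + 1) (sym_kind M 1 1) \<or> ?A 0 (j + 1) (sym_kind M 1 2) \<or> ?A 0 (j + 1) (sym_kind M 1 0)"
          using i len(2) by (auto simp: init_lit_def split: if_splits)
        moreover have "\<not> ?A 0 (j + 1) (sym_kind M 1 0)" using nlen[OF i(2)] by (simp add: good_def i(1))
        ultimately show ?thesis using c y(2)[OF i(2)] 2 i(1) by auto
      next
        case 3
        then have "cell (cfg y 0) 1 (int j - int h) = 0"
          using cell_init[of 1 y "int j - int h"] K by (auto simp: sym_at_def y(1) nat_diff_distrib')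
        then show ?thesis using blank[of "j - h"] 3 j by simp
      next
        case 4
        then have "cell (cfg y 0) 1 (int j - int h) = 0"
          using cell_init[of 1 y "int j - int h"] K by simp
        then show ?thesis using init[OF j', of 3] 4 by (auto simp: init_lit_def)
      next
        case 5
        then have "cell (cfg y 0) k (int j - int h) = 0"
          using cell_init[OF k, of y "int j - int h"] by (simp add: sym_at_def)
        then show ?thesis using init[OF j', of "k + 3"] 5 k by (auto simp: init_lit_def)
      qed
    qed
    moreover have "?A 0 (h + 1) (state_kind M (fst (cfg y 0)))"
      using init[of 0 0] by (auto simp: init_lit_def state_init)
    ultimately show ?case by simp
  next
    case (Suc t)
    then have IH: "?A t (h + 1) (state_kind M (fst (cfg y t)))"
      "\<And>k j. k < ntapes M \<Longrightarrow> t \<le> j \<Longrightarrow> j + t \<le> 2 * h \<Longrightarrow> ?A t (j + 1) (sym_kind M k (cell (cfg y t) k (int j - int h)))"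
      and t: "t \<le> T" by auto
    let ?c = "cfg y t"
    let ?ss = "map (\<lambda>k. cell ?c k 0) [0..<ntapes M]"
    obtain q' as where e: "effect M (fst ?c) ?ss = (q', as)" by fastforce
    have ss: "set ?ss \<subseteq> {..<nsyms M}" "length ?ss = ntapes M" using config_bounds(2) by auto
    note st = step_effect[OF M wf_cfg e, folded cfg_Suc]
    note sch = in_schemas[OF config_bounds(1) ss(2,1) e]
    have body: "\<forall>s\<in>set (body M (fst ?c) ?ss). \<not> lit_true \<alpha> (schema_lit M h t j s)" for j
      unfolding body_true using IH(1) IH(2)[of _ h] t h by simp
    have clause: "(fst S \<and> j = h) \<or> (\<exists>s\<in>set (snd S). lit_true \<alpha> (schema_lit M h t j s))"
      if S: "S \<in> set (schemas M)" "j < 2 * h + 1" for S j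
    proof -
      obtain z where "z < length (schemas M)" "S = schemas M ! z" using S(1) by (auto simp: in_set_conv_nth)
      with sat[of t j z] schema_clause[of S M z] S(2) t show ?thesis by (simp add: schema_count_def)
    qed
    have "?A (Suc t) (j + 1) (sym_kind M k (cell (cfg y (Suc t)) k (int j - int h)))"
      if k: "k < ntapes M" and j: "Suc t \<le> j" "j + Suc t \<le> 2 * h" for k j
    proof -
      define d where "d = snd (as ! k)"
      \<comment> \<open>Where the cell stood relative to the head before the move.\<close>
      define i where "i = nat (int j + delta d)"
      have i: "int i = int j + delta d" "t \<le> i" "i + t \<le> 2 * h" using j by (cases d; simp add: i_def)+
      have io: "i + offset d = j + 1" using offset_delta[of d] i(1) by linarith
      have cl: "cell (cfg y (Suc t)) k (int j - int h) = (if i = h then fst (as ! k) else cell ?c k (int i - int h))"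
        unfolding st(2)[OF k] using i(1) by (auto simp: d_def[symmetric] algebra_simps)
      show ?thesis
      proof (cases "i = h")
        case True
        then show ?thesis using clause[OF sch(2)[OF k], of 0] body[of 0] io cl by (auto simp: d_def[symmetric])
      next
        case False
        then show ?thesis
          using clause[OF sch(3)[OF k config_bounds(2)[OF k, of y t "int i - int h"]], of i] body[of i] io cl IH(2)[OF k i(2,3)] i(3)
          by (auto simp: d_def[symmetric])
      qed
    qed
    moreover have "?A (Suc t) (h + 1) (state_kind M (fst (cfg y (Suc t))))"
      using clause[OF sch(1), of 0] body[of 0] st(1) by auto
    ultimately show ?case by simp
  qed
  have "length y \<le> p" using len(2) y(1) by simp
  moreover have "\<not> ?A T (h + 1) (sym_kind M 0 1)"
    using init[of 0 1] by (auto simp: init_lit_def)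
  then have "cell (cfg y T) 0 0 \<noteq> 1" using conjunct2[OF inv[OF order_refl], rule_format, of 0 h] h by auto
  then have "R y" using verifier_output[OF R[OF \<open>length y \<le> p\<close>]] by (cases "R y") auto
  ultimately show ?thesis by blast
qed

lemma sym_kind_less: "k < ntapes M \<Longrightarrow> s < nsyms M \<Longrightarrow> sym_kind M k s < ntapes M * nsyms M"
  using mixed_radix_less[of k "ntapes M" 0 1 s "nsyms M"] by (simp add: sym_kind_def)

lemma kind_less:
  "k < ntapes M \<Longrightarrow> s < nsyms M \<Longrightarrow> sym_kind M k s < kinds M"
  "q < nstates M \<Longrightarrow> state_kind M q < kinds M"
  using sym_kind_less[of k s] by (auto simp: kinds_def state_kind_def)

text \<open>The assignment is the run itself: a variable number is decoded into time, position and
  kind, and the fact is looked up in the configuration. State facts ignore the position.\<close>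

lemma tableau_if_accepting:
  assumes y: "length y \<le> p" and acc: "computes_within M [x, y] T [True]"
  shows "\<exists>\<alpha>. \<forall>t\<le>T. \<forall>j<2 * h + 1. \<forall>z<schema_count M. \<exists>l<ntapes M + 3. lit_true \<alpha> (tableau_lit M x T p h t j z l)"
proof -
  define hold where "hold t i a = (if a < ntapes M * nsyms M
      then cell (cfg y t) (a div nsyms M) (int i - int h - 1) = a mod nsyms M
      else fst (cfg y t) = a - ntapes M * nsyms M)" for t i a
  define \<alpha> where "\<alpha> v = hold (v div kinds M div (2 * h + 3)) (v div kinds M mod (2 * h + 3)) (v mod kinds M)" for v
  have \<alpha>: "\<alpha> (var M h t i a) = hold t i a" if "i < 2 * h + 3" "a < kinds M" for t i a
    using that by (simp add: \<alpha>_def var_def)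
  have \<alpha>_sym: "\<alpha> (var M h t i (sym_kind M k s)) \<longleftrightarrow> cell (cfg y t) k (int i - int h - 1) = s"
    if "i < 2 * h + 3" "k < ntapes M" "s < nsyms M" for t i k s
  proof -
    have "sym_kind M k s div nsyms M = k" "sym_kind M k s mod nsyms M = s" using that by (simp_all add: sym_kind_def)
    then show ?thesis using that by (simp add: \<alpha> kind_less hold_def sym_kind_less)
  qed
  have \<alpha>_state: "\<alpha> (var M h t i (state_kind M q)) \<longleftrightarrow> fst (cfg y t) = q" if "i < 2 * h + 3" "q < nstates M" for t i q
    using that by (simp add: \<alpha> kind_less hold_def) (simp add: state_kind_def)
  have sy3: "s < nsyms M" if "s < 3" for s using M that by (simp add: machine_wf_def)
  have st1: "0 < nstates M" using M by (simp add: machine_wf_def)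
  have K0 [simp]: "0 < ntapes M" "Suc 0 < ntapes M" using K by simp_all
  have "\<exists>l<ntapes M + 3. lit_true \<alpha> (tableau_lit M x T p h t j z l)"
    if "t \<le> T" and j: "j < 2 * h + 1" and "z < schema_count M" for t j z
  proof (cases "z < length (schemas M)")
    case z: True
    let ?S = "schemas M ! z"
    have "?S \<in> set (schemas M)" using z by simp
    then obtain q ss q' as R where q: "q < nstates M" and ss: "length ss = ntapes M" "set ss \<subseteq> {..<nsyms M}"
      and e: "effect M q ss = (q', as)" and S: "?S = (fst ?S, body M q ss @ R)"
      and R: "(\<not> fst ?S \<and> R = [(1, 1, False, 1, state_kind M q')])
     \<or> (\<exists>k<ntapes M. \<not> fst ?S \<and> R = [(1, 1, False, offset (snd (as ! k)), sym_kind M k (fst (as ! k)))])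
     \<or> (\<exists>k<ntapes M. \<exists>s<nsyms M. fst ?S \<and> R = [(0, 0, True, 1, sym_kind M k s), (1, 1, True, offset (snd (as ! k)), sym_kind M k s)])"
      by (rule schemasE)
    have set_S: "set (snd ?S) = set (body M q ss) \<union> set R" by (subst S) simp
    note wf = effect_wf[OF M q ss, unfolded e, simplified]
    have "\<exists>s\<in>set R. lit_true \<alpha> (schema_lit M h t j s)"
      if b: "\<forall>s\<in>set (body M q ss). \<not> lit_true \<alpha> (schema_lit M h t j s)" and nc: "\<not> (fst ?S \<and> j = h)"
    proof -
      have ss': "ss ! k < nsyms M" if "k < ntapes M" for k using subsetD[OF ss(2) nth_mem[of k ss]] ss(1) that by simp
      from b have "fst (cfg y t) = q" "\<And>k. k < ntapes M \<Longrightarrow> cell (cfg y t) k 0 = ss ! k"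
        unfolding body_true using \<alpha>_state[OF _ q] \<alpha>_sym[OF _ _ ss'] by auto
      then have "effect M (fst (cfg y t)) (map (\<lambda>k. cell (cfg y t) k 0) [0..<ntapes M]) = (q', as)"
        using e ss(1) by (metis (no_types, lifting) nth_map_upt add_0 diff_zero length_map length_upt nth_equalityI)
      note st = step_effect[OF M wf_cfg this, folded cfg_Suc]
      have off: "offset d \<le> 2" "int (h + offset d) - int h - 1 + delta d = 0"
          "int (j + offset d) - int h - 1 + delta d = int j - int h" for d
        by (cases d; simp)+
      from R consider (a) "R = [(1, 1, False, 1, state_kind M q')]"
        | (b) k where "k < ntapes M" "R = [(1, 1, False, offset (snd (as ! k)), sym_kind M k (fst (as ! k)))]"
        | (c) k s where "k < ntapes M" "s < nsyms M" "j \<noteq> h"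
            "R = [(0, 0, True, 1, sym_kind M k s), (1, 1, True, offset (snd (as ! k)), sym_kind M k s)]"
        using nc by blast
      then show ?thesis
      proof cases
        case a
        then show ?thesis using \<alpha>_state[OF _ wf(1), of "h + 1" "Suc t"] st(1) by simp
      next
        case b
        then show ?thesis
          using \<alpha>_sym[OF _ b(1) wf(3)[OF b(1)], of "h + offset (snd (as ! k))" "Suc t"] st(2)[OF b(1)] off(1)[of "snd (as ! k)"]
          by (simp only: off(2)) simp
      next
        case c
        have "cell (cfg y (Suc t)) k (int (j + offset (snd (as ! k))) - int h - 1) = cell (cfg y t) k (int j - int h)"
          unfolding st(2)[OF c(1)] off(3) using c(3) by simp
        moreover have "j + offset (snd (as ! k)) < 2 * h + 3" using j off(1)[of "snd (as ! k)"] by linarith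
        ultimately show ?thesis
          using \<alpha>_sym[OF _ c(1,2), of "j + offset (snd (as ! k))" "Suc t"] \<alpha>_sym[OF _ c(1,2), of "j + 1" t] j c(4) by auto
      qed
    qed
    then show ?thesis unfolding schema_clause[OF refl z] set_S by blast
  next
    case False
    define r where "r = z - length (schemas M)"
    have r: "r < ntapes M + 3" using that False by (simp add: r_def schema_count_def)
    have wit: "\<exists>l<ntapes M + 3. lit_true \<alpha> (tableau_lit M x T p h t j z l)"
      if "l < 3" "lit_true \<alpha> (init_lit M x T p h j r l)" for l
      using that False K by (intro exI[of _ l]) (simp add: tableau_lit_def r_def)
    have c1: "cell (cfg y 0) (Suc 0) (int j - int h) = (if h \<le> j then sym_at y (j - h) else 0)" for j
      using cell_init[of 1 y "int j - int h"] by (simp add: nat_diff_distrib')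
    have s1: "sym_at y i \<in> {1, 2}" if "i < length y" for i using that by (cases "y ! i") (auto simp: sym_at_def)
    consider "r = 0" | "r = 1" | "r = 2" | "r = 3" | "r = 4" | "5 \<le> r" by linarith
    then show ?thesis
    proof cases
      case 1
      then show ?thesis using \<alpha>_state[of "h + 1" 0 0] st1 by (intro wit[of 0]) (auto simp: init_lit_def state_init)
    next
      case 2
      then show ?thesis using \<alpha>_sym[of "h + 1" 0 1 T] sy3[of 1] verifier_output[OF acc]
        by (intro wit[of 0]) (auto simp: init_lit_def)
    next
      case 3
      have "cell (cfg y 0) 0 (int j - int h) = (if h \<le> j \<and> j - h < length x then if tick x (j - h) then 2 else 1 else 0)"
        using cell_init[of 0 y "int j - int h"]
        by (auto simp: sym_at_def tick_def nat_diff_distrib' elim: bit_symbol.elims)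
      then show ?thesis using 3 \<alpha>_sym[of "j + 1" 0 _ 0] sy3 j by (intro wit[of 0]) (auto simp: init_lit_def)
    next
      case 4
      define s where "s = cell (cfg y 0) 1 (int j - int h)"
      show ?thesis
      proof (cases "h \<le> j \<and> j < h + p")
        case True
        have "s \<in> {0, 1, 2}" using s1[of "j - h"] True by (auto simp: s_def c1 sym_at_def)
        \<comment> \<open>The literals 0, 1 and 2 of this clause stand for the symbols 1, 2 and
          0.\<close>
        then show ?thesis using True 4 \<alpha>_sym[of "j + 1" 1 s 0] sy3[of s] j
          by (intro wit[of "if s = 0 then 2 else s - 1"]) (auto simp: init_lit_def s_def)
      next
        case False
        then have "s = 0" using y by (auto simp: s_def c1 sym_at_def)
        then show ?thesis using False 4 \<alpha>_sym[of "j + 1" 1 0 0] sy3[of 0] j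
          by (intro wit[of 0]) (auto simp: init_lit_def s_def)
      qed
    next
      case 5
      have z0: "0 < nsyms M" using sy3[of 0] by simp
      show ?thesis
      proof (cases "cell (cfg y 0) 1 (int j - int h) = 0")
        case True
        \<comment> \<open>On the certificate side a blank is followed by a blank. Left of the head
          the two literals of the clause are complementary.\<close>
        have "\<alpha> (var M h 0 (j + 1 + (if h \<le> j then 1 else 0)) (sym_kind M 1 0))"
        proof (cases "h \<le> j")
          case hj: True
          have "length y \<le> j - h" using True s1[of "j - h"] hj by (auto simp: c1 not_less[symmetric])
          then have "cell (cfg y 0) 1 (int (Suc j) - int h) = 0" unfolding One_nat_def c1 using hj by (simp add: sym_at_def)
          moreover have eq: "int (j + 1 + 1) - int h - 1 = int (Suc j) - int h" by simp
          ultimately show ?thesis using \<alpha>_sym[of "j + 1 + 1" 1 0 0] z0 j hj unfolding eq by simp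
        next
          case False
          then show ?thesis using \<alpha>_sym[of "j + 1" 1 0 0] z0 j True by simp
        qed
        then show ?thesis using 5 by (intro wit[of 1]) (simp_all add: init_lit_def)
      next
        case False
        then show ?thesis using 5 \<alpha>_sym[of "j + 1" 1 0 0] z0 j
          by (intro wit[of 0]) (auto simp: init_lit_def)
      qed
    next
      case 6
      have "r - 3 < ntapes M" "r - 3 \<noteq> 0" "r - 3 \<noteq> 1" using r 6 by auto
      then have "cell (cfg y 0) (r - 3) (int j - int h) = 0"
        using cell_init[of "r - 3" y "int j - int h"] by (simp add: sym_at_def)
      then show ?thesis using 6 r \<alpha>_sym[of "j + 1" "r - 3" 0 0] sy3[of 0] j
        by (intro wit[of 0]) (auto simp: init_lit_def)
    qed
  qed
  then show ?thesis by blast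
qed

lemma schema_lits:
  assumes "S \<in> set (schemas M)" "(sg, dt, md, sft, a) \<in> set (snd S)"
  shows "sg \<le> 1" "dt \<le> 1" "sft \<le> 2" "a < kinds M"
proof -
  from assms(1) obtain q ss q' as R where q: "q < nstates M" and ss: "length ss = ntapes M" "set ss \<subseteq> {..<nsyms M}"
    and e: "effect M q ss = (q', as)" and S: "S = (fst S, body M q ss @ R)"
    and R: "(\<not> fst S \<and> R = [(1, 1, False, 1, state_kind M q')])
     \<or> (\<exists>k<ntapes M. \<not> fst S \<and> R = [(1, 1, False, offset (snd (as ! k)), sym_kind M k (fst (as ! k)))])
     \<or> (\<exists>k<ntapes M. \<exists>s<nsyms M. fst S \<and> R = [(0, 0, True, 1, sym_kind M k s), (1, 1, True, offset (snd (as ! k)), sym_kind M k s)])"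
    by (rule schemasE)
  note wf = effect_wf[OF M q ss, unfolded e, simplified]
  have off: "offset d \<le> 2" for d by (cases d) auto
  have ss': "ss ! k < nsyms M" if "k < ntapes M" for k using subsetD[OF ss(2) nth_mem[of k ss]] ss(1) that by simp
  have "(sg, dt, md, sft, a) \<in> set (body M q ss) \<union> set R" using assms(2) by (subst (asm) S) simp
  then have "sg \<le> 1 \<and> dt \<le> 1 \<and> sft \<le> 2 \<and> a < kinds M"
    using R wf ss' q off by (auto simp: body_def kind_less)
  then show "sg \<le> 1" "dt \<le> 1" "sft \<le> 2" "a < kinds M" by auto
qed

lemma var_less: "t \<le> Suc T \<Longrightarrow> i < 2 * h + 3 \<Longrightarrow> a < kinds M \<Longrightarrow> var M h t i a < var_count M T p"
  using mixed_radix_less[of t "T + 2" i "2 * h + 3" a "kinds M"] by (simp add: var_def var_count_def h)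

lemma tableau_lit_less:
  assumes "t \<le> T" "j < 2 * h + 1" "z < schema_count M"
  shows "tableau_lit M x T p h t j z l < 2 * var_count M T p"
proof -
  have lt: "2 * var M h t i a + sg < 2 * var_count M T p" if "t \<le> Suc T" "i < 2 * h + 3" "a < kinds M" "sg \<le> 1" for t i a sg
    using var_less[OF that(1-3)] that(4) by linarith
  have sy3: "s < nsyms M" if "s < 3" for s using M that by (simp add: machine_wf_def)
  have st1: "0 < nstates M" using M by (simp add: machine_wf_def)
  show ?thesis
  proof (cases "z < length (schemas M)")
    case True
    let ?S = "schemas M ! z"
    have S: "?S \<in> set (schemas M)" using True by simp
    obtain sg dt md sft a where l: "snd ?S ! (l mod length (snd ?S)) = (sg, dt, md, sft, a)" by (metis prod_cases5)
    have "(sg, dt, md, sft, a) \<in> set (snd ?S)" using length_schema[OF S] unfolding l[symmetric] by (intro nth_mem) simp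
    note b = schema_lits[OF S this]
    have "schema_lit M h t j (sg, dt, md, sft, a) < 2 * var_count M T p"
      unfolding schema_lit.simps by (rule lt) (use b assms in auto)
    moreover have "l mod 2 < 2 * var_count M T p"
      using lt[of 0 0 "state_kind M 0" 1] kind_less(2)[OF st1] by simp
    ultimately show ?thesis using True by (simp add: tableau_lit_def l)
  next
    case False
    define r where "r = z - length (schemas M)"
    have r: "r < ntapes M + 3" using assms(3) False by (simp add: r_def schema_count_def)
    have K0: "0 < ntapes M" "1 < ntapes M" using K by simp_all
    have "init_lit M x T p h j r l < 2 * var_count M T p"
      unfolding init_lit_def
      using lt[of _ _ _ 0, simplified] lt[of _ _ _ 1, simplified] assms(2) sy3 st1 r K0 kind_less by auto
    then show ?thesis using False by (simp add: tableau_lit_def r_def)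
  qed
qed

lemma schema_count_pos: "0 < schema_count M"
  by (simp add: schema_count_def)

lemma lit_of_less:
  assumes "c < clause_count M T p"
  shows "lit_of M x T p c l < 2 * var_count M T p"
proof -
  have "\<forall>c<clause_count M T p. lit_of M x T p c l < 2 * var_count M T p"
    unfolding clause_count_def lit_of_def
    by (subst all_mixed_radix[where Q = "\<lambda>t j z. tableau_lit M x T p (T + p) t j z l < 2 * var_count M T p"])
      (use tableau_lit_less[unfolded h] schema_count_pos in \<open>auto simp: less_Suc_eq_le\<close>)
  then show ?thesis using assms by blast
qed

theorem satisfiable_tableau:
  assumes R: "\<And>y. length y \<le> p \<Longrightarrow> computes_within M [x, y] T [R y]"
  shows "satisfiable (lit_of M x T p) (clause_count M T p) (ntapes M + 3) \<longleftrightarrow> (\<exists>y. length y \<le> p \<and> R y)"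
proof -
  have "satisfiable (lit_of M x T p) (clause_count M T p) (ntapes M + 3) \<longleftrightarrow>
     (\<exists>\<alpha>. \<forall>t<T + 1. \<forall>j<2 * h + 1. \<forall>z<schema_count M. \<exists>l<ntapes M + 3. lit_true \<alpha> (tableau_lit M x T p h t j z l))"
    unfolding satisfiable_def clause_count_def lit_of_def lit_true_def[symmetric] h
    by (subst all_mixed_radix[where Q = "\<lambda>t j z. \<exists>l<ntapes M + 3. lit_true _ (tableau_lit M x T p (T + p) t j z l)"])
      (use schema_count_pos in auto)
  also have "\<dots> \<longleftrightarrow> (\<exists>y. length y \<le> p \<and> R y)"
  proof
    assume "\<exists>y. length y \<le> p \<and> R y"
    then obtain y where "length y \<le> p" "computes_within M [x, y] T [True]" using R by metis
    from tableau_if_accepting[OF this]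
    show "\<exists>\<alpha>. \<forall>t<T + 1. \<forall>j<2 * h + 1. \<forall>z<schema_count M. \<exists>l<ntapes M + 3. lit_true \<alpha> (tableau_lit M x T p h t j z l)"
      by (simp add: less_Suc_eq_le)
  next
    assume "\<exists>\<alpha>. \<forall>t<T + 1. \<forall>j<2 * h + 1. \<forall>z<schema_count M. \<exists>l<ntapes M + 3. lit_true \<alpha> (tableau_lit M x T p h t j z l)"
    then obtain \<alpha> where \<alpha>: "\<forall>t<T + 1. \<forall>j<2 * h + 1. \<forall>z<schema_count M. \<exists>l<ntapes M + 3.
       lit_true \<alpha> (tableau_lit M x T p h t j z l)" by blast
    show "\<exists>y. length y \<le> p \<and> R y"
      by (rule accepting_if_tableau[OF _ R, of \<alpha>]) (use \<alpha> in \<open>simp_all add: less_Suc_eq_le\<close>)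
  qed
  finally show ?thesis .
qed

end

section \<open>The reduction\<close>

lemma concat_map_concat: "concat (map g (concat xss)) = concat (map (\<lambda>xs. concat (map g xs)) xss)"
  by (induction xss) auto

lemma occ_concat_map: "occ (concat (map f [0..<n])) b = (\<Sum>i<n. occ (f i) b)"
  by (induction n) (auto simp: occ_def)

lemma occ_map: "occ (map f [0..<n]) b = (\<Sum>i<n. if b \<in> set (f i) then 1 else 0)"
  by (induction n) (auto simp: occ_def)

lemma occ_append: "occ (L @ L') b = occ L b + occ L' b"
  by (simp add: occ_def)

definition encode_vote :: "nat list \<Rightarrow> bool list" where
  "encode_vote v = True # encode_list encode_nat v"

text \<open>The filter becomes a test inside a loop over all candidates, a form that the loop
  language can print.\<close>

lemma encode_ballot:
  "encode_vote (ballot m t) = True # concat (map (\<lambda>a. True # encode_nat a) t)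
     @ concat (map (\<lambda>a. if a \<in> set t then [] else True # encode_nat a) [0..<m]) @ [False]"
proof -
  have "concat (map (\<lambda>a. True # encode_nat a) (filter (\<lambda>a. a \<notin> set t) us)) =
      concat (map (\<lambda>a. if a \<in> set t then [] else True # encode_nat a) us)" for us
    by (induction us) auto
  then show ?thesis by (simp add: encode_vote_def encode_list_def ballot_def)
qed

lemma encode_packing_votes:
  "encode_list (encode_list encode_nat) (packing_votes (sat_sets lit NV NC W) NE n) =
     concat (map (\<lambda>v. concat (map (\<lambda>c. concat (map (\<lambda>s. encode_vote (set_vote NE (wheel NC v c s))) [0..<2])) [0..<NC])) [0..<NV])
     @ concat (map (\<lambda>c. concat (map (\<lambda>l. encode_vote (set_vote NE (clause_set NV NC c (lit c l)))) [0..<W])) [0..<NC])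
     @ concat (map (\<lambda>b. concat (map (\<lambda>_. encode_vote (pad_vote NE b)) [0..<pads (sat_sets lit NV NC W) n b])) [0..<NE])
     @ [False]"
proof -
  have "encode_list (encode_list encode_nat) vs = concat (map encode_vote vs) @ [False]" for vs
    by (simp add: encode_list_def[of "encode_list encode_nat"] encode_vote_def[abs_def])
  moreover have "replicate k v = map (\<lambda>_. v) [0..<k]" for k and v :: "nat list"
    by (simp add: map_replicate_const)
  ultimately show ?thesis
    by (simp add: packing_votes_def sat_sets_def concat_map_concat o_def del: upt_rec_numeral)
qed

lemma occ_sat_sets:
  "occ (sat_sets lit NV NC W) b =
     (\<Sum>v<NV. \<Sum>c<NC. \<Sum>s<2. if b \<in> set (wheel NC v c s) then 1 else 0)
     + (\<Sum>c<NC. \<Sum>l<W. if b \<in> set (clause_set NV NC c (lit c l)) then 1 else 0)"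
  unfolding sat_sets_def occ_append occ_concat_map occ_map ..

lemma length_sat_sets: "length (sat_sets lit NV NC W) = NV * NC * 2 + NC * W"
  by (simp add: sat_sets_def length_concat o_def sum_list_triv)

section \<open>The reduction in terms of bounded loops\<close>

lemma lexp_encode_ballot:
  assumes "nexp m" "nexp a" "nexp b" "nexp d" "nexp e"
  shows "lexp (\<lambda>c. encode_vote (ballot (m c) [a c, b c, d c, e c]))"
  unfolding encode_ballot list.map concat.simps list.set insert_iff empty_iff
  by (intro exp_intros assms nexp_pop[of a] nexp_pop[of b] nexp_pop[of d] nexp_pop[of e] | simp only: pop_simps)+

lemma nexp_schema_lit:
  assumes "nexp h" "nexp t" "nexp j"
  shows "nexp (\<lambda>c. schema_lit M (h c) (t c) (j c) s)"
  by (cases s) (simp only: schema_lit.simps var_def, intro exp_intros assms)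

lemma nexp_init_lit:
  assumes "nexp T" "nexp p" "nexp h" "nexp j" "nexp r" "nexp l"
  shows "nexp (\<lambda>c. init_lit M (in1 c) (T c) (p c) (h c) (j c) (r c) (l c))"
  unfolding init_lit_def var_def sym_kind_def state_kind_def by (intro exp_intros bexp_tick assms)

text \<open>The machine is fixed, so its schemas and the literals of each schema are looked up in
  two nested finite tables.\<close>

lemma nexp_tableau_lit:
  assumes "nexp T" "nexp p" "nexp h" "nexp t" "nexp j" "nexp z" "nexp l"
  shows "nexp (\<lambda>c. tableau_lit M (in1 c) (T c) (p c) (h c) (t c) (j c) (z c) (l c))"
proof -
  let ?n = "length (schemas M)"
  let ?m = "\<lambda>i. length (snd (schemas M ! i))"
  define F where "F i c = (if fst (schemas M ! i) \<and> j c = h c then l c mod 2 else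
    if l c mod ?m i < ?m i then schema_lit M (h c) (t c) (j c) (snd (schemas M ! i) ! (l c mod ?m i)) else 0)" for i c
  have "nexp (\<lambda>c. F i c)" for i
    unfolding F_def by (intro nexp_if nexp_table nexp_schema_lit exp_intros assms)
  then have "nexp (\<lambda>c. if z c < ?n then if z c < ?n then F (z c) c else 0
      else init_lit M (in1 c) (T c) (p c) (h c) (j c) (z c - ?n) (l c))"
    by (intro nexp_if nexp_table nexp_init_lit exp_intros assms)
  moreover have "l c mod ?m (z c) < ?m (z c)" if "z c < ?n" for c
    using length_schema[of "schemas M ! z c" M] that by simp
  then have "(\<lambda>c. if z c < ?n then if z c < ?n then F (z c) c else 0
      else init_lit M (in1 c) (T c) (p c) (h c) (j c) (z c - ?n) (l c)) =
    (\<lambda>c. tableau_lit M (in1 c) (T c) (p c) (h c) (t c) (j c) (z c) (l c))"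
    by (auto simp: fun_eq_iff tableau_lit_def F_def)
  ultimately show ?thesis by simp
qed

context
  fixes M :: machine and pc q :: "nat poly"
begin

definition cert_bound :: "bool list \<Rightarrow> nat" where
  "cert_bound x = poly pc (length x)"

definition time_limit :: "bool list \<Rightarrow> nat" where
  "time_limit x = poly q (length x + cert_bound x)"

definition num_vars :: "bool list \<Rightarrow> nat" where
  "num_vars x = var_count M (time_limit x) (cert_bound x)"

definition num_clauses :: "bool list \<Rightarrow> nat" where
  "num_clauses x = clause_count M (time_limit x) (cert_bound x)"

definition num_elems :: "bool list \<Rightarrow> nat" where
  "num_elems x = 4 * num_vars x * num_clauses x + 2 * num_clauses x"

definition num_manips :: "bool list \<Rightarrow> nat" where
  "num_manips x = num_vars x * num_clauses x + num_clauses x"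

definition literal :: "bool list \<Rightarrow> nat \<Rightarrow> nat \<Rightarrow> nat" where
  "literal x = lit_of M x (time_limit x) (cert_bound x)"

definition sets_of :: "bool list \<Rightarrow> nat list list" where
  "sets_of x = sat_sets (literal x) (num_vars x) (num_clauses x) (ntapes M + 3)"

definition reduction :: "bool list \<Rightarrow> bool list" where
  "reduction x = encode_instance (4 * num_elems x + 1) (packing_votes (sets_of x) (num_elems x) (num_manips x)) (num_manips x) (4 * num_elems x)"

lemma nexp_cert_bound: "nexp (\<lambda>c. cert_bound (in1 c))" "nexp (\<lambda>c. time_limit (in1 c))"
  unfolding time_limit_def cert_bound_def by (intro exp_intros)+

lemma nexp_counts: "nexp (\<lambda>c. num_vars (in1 c))" "nexp (\<lambda>c. num_clauses (in1 c))"
  unfolding num_vars_def num_clauses_def var_count_def clause_count_def by (intro exp_intros nexp_cert_bound)+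

lemma nexp_num_elems: "nexp (\<lambda>c. num_elems (in1 c))" "nexp (\<lambda>c. num_manips (in1 c))"
  unfolding num_elems_def num_manips_def by (intro exp_intros nexp_counts)+

lemma nexp_literal:
  assumes "nexp i" "nexp l"
  shows "nexp (\<lambda>c. literal (in1 c) (i c) (l c))"
  unfolding literal_def lit_of_def by (intro nexp_tableau_lit exp_intros nexp_cert_bound assms)

lemma nexp_pads:
  assumes "nexp b"
  shows "nexp (\<lambda>c. pads (sets_of (in1 c)) (num_manips (in1 c)) (b c))"
proof -
  note b = assms nexp_pop[OF assms] nexp_pop[OF nexp_pop[OF assms]] nexp_pop[OF nexp_pop[OF nexp_pop[OF assms]]]
  show ?thesis
    unfolding pads_def sets_of_def length_sat_sets occ_sat_sets wheel_def clause_set_def code_def list.set insert_iff empty_iff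
    by (intro exp_intros nexp_counts nexp_num_elems nexp_literal b | simp only: pop_simps)+
qed

lemma lexp_reduction: "lexp (\<lambda>c. reduction (in1 c))"
  unfolding reduction_def encode_instance_def sets_of_def encode_packing_votes
  unfolding sets_of_def[symmetric] set_vote_def pad_vote_def wheel_def clause_set_def code_def list.map
  by (intro exp_intros lexp_encode_ballot nexp_counts nexp_num_elems nexp_literal nexp_pads | simp only: pop_simps)+

lemma reduction_correct:
  assumes M: "machine_wf M" "2 \<le> ntapes M"
    and R: "\<And>x y. computes_within M [x, y] (poly q (length x + length y)) [R x y]"
  shows "reduction x \<in> approval_conformant_manipulation 4 \<longleftrightarrow> (\<exists>y. length y \<le> poly pc (length x) \<and> R x y)"
proof -
  have "0 < num_clauses x" by (simp add: num_clauses_def clause_count_def schema_count_def)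
  then have pos: "0 < num_elems x" "1 \<le> num_manips x" by (simp_all add: num_elems_def num_manips_def)
  have lit: "literal x c l < 2 * num_vars x" if "c < num_clauses x" "l < ntapes M + 3" for c l
    using lit_of_less[OF M refl] that unfolding literal_def num_vars_def num_clauses_def by blast
  have L: "length l = 3 \<and> distinct l \<and> set l \<subseteq> {..<num_elems x}" if "l \<in> set (sets_of x)" for l
    using sat_sets_wf[of "num_clauses x" "ntapes M + 3" "literal x", OF lit] that unfolding sets_of_def num_elems_def by blast
  \<comment> \<open>The running time of the verifier depends on the length of the certificate; its
    polynomial, evaluated at the largest length, gives one limit for all certificates.\<close>
  have comp: "computes_within M [x, y] (time_limit x) [R x y]" if "length y \<le> cert_bound x" for y
    using computes_within_mono[OF R[of x y]] that poly_nat_mono[of "length x + length y" "length x + cert_bound x" q]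
    by (simp add: time_limit_def)
  let ?V = "packing_votes (sets_of x) (num_elems x) (num_manips x)"
  have "reduction x \<in> approval_conformant_manipulation 4 \<longleftrightarrow>
      conformant_manipulation 4 {..<4 * num_elems x + 1} (map order_of_list ?V) (num_manips x) (4 * num_elems x)"
    using votes_valid[OF L pos(2)]
    by (auto simp: reduction_def approval_conformant_manipulation_def encode_instance_inject)
  also have "\<dots> \<longleftrightarrow> packing (sets_of x) (num_manips x)" by (rule packing_iff_manipulation[OF L pos(2,1)])
  also have "\<dots> \<longleftrightarrow> satisfiable (literal x) (num_clauses x) (ntapes M + 3)"
    unfolding sets_of_def num_manips_def using packing_if_satisfiable[of "num_clauses x" "ntapes M + 3" "literal x", OF lit]
      satisfiable_if_packing[of "num_clauses x" "ntapes M + 3" "literal x", OF lit] by blast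
  also have "\<dots> \<longleftrightarrow> (\<exists>y. length y \<le> cert_bound x \<and> R x y)"
    unfolding literal_def num_clauses_def by (rule satisfiable_tableau[OF M refl comp])
  finally show ?thesis by (simp add: cert_bound_def)
qed

end

theorem acm_NP_hard: "NP_hard (approval_conformant_manipulation 4)"
  unfolding NP_hard_def
proof (intro allI impI)
  fix L assume "in_NP L"
  then obtain R p where "poly_time_relation R" and L: "\<And>x. x \<in> L \<longleftrightarrow> (\<exists>y. length y \<le> poly p (length x) \<and> R x y)"
    unfolding in_NP_def by blast
  then obtain M q where M: "machine_wf M" "2 \<le> ntapes M"
    and R: "\<And>x y. computes_within M [x, y] (poly q (length x + length y)) [R x y]"
    unfolding poly_time_relation_def by blast
  have "x \<in> L \<longleftrightarrow> reduction M p q x \<in> approval_conformant_manipulation 4" for x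
    using reduction_correct[OF M R] L by blast
  moreover have "poly_time_function (reduction M p q)"
    by (rule poly_time_function_lexp[OF lexp_reduction])
  ultimately show "poly_time_reducible L (approval_conformant_manipulation 4)"
    unfolding poly_time_reducible_def by blast
qed

theorem theorem1: "NP_complete (approval_conformant_manipulation 4)"
  unfolding NP_complete_def using acm_in_NP acm_NP_hard by blast

end
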